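(* Suppose $u(x,t)$ is a solution of the free Schrödinger equation in the quarter plane, and let $u_0(x)=u(x,0)$ and $g_0(t)=u(0,t)$. Then, for $x>0$, $t>0$, $$u(x,t)=\frac1\pi\int_{\mathbb R}e^{-2ikx-f(k)t}\hat u_0(k)\,dk+\frac{1}{2i\pi}\int_{\partial D_3^0}e^{-2ikx-f(k)t}\big[f'(k)\tilde g_0(f(k),t)+2i\hat u_0(-k)\big]dk,$$ where $f(k)=4ik^2$, $$\hat u_0(k)=\int_0^\infty e^{2ikx}u_0(x)\,dx\quad(\mathrm{Im}\,k\ge0),\qquad \tilde g_0(\kappa,t)=\int_0^te^{\kappa s}g_0(s)\,ds\quad(\kappa\in\mathbb C).$$ Moreover, the Neumann value $g_1(t)=u_x(0,t)$ is given by $$g_1(t)=\frac{e^{-\frac{i\pi}{4}}}{\sqrt\pi}\bigg[\frac{u_0(0)-g_0(0)}{\sqrt t}+\frac{1}{\sqrt t}\int_0^\infty e^{\frac{ix^2}{4t}}u_0'(x)\,dx-\int_0^t\frac{\dot g_0(s)}{\sqrt{t-s}}\,ds\bigg],\qquad t>0,$$ or, alternatively, by $$g_1(t)=\frac{e^{-\frac{i\pi}{4}}}{\sqrt{\pi t}}\bigg(u_0(0)+\int_0^\infty e^{\frac{ix^2}{4t}}u_0'(x)\,dx\bigg)+\frac2\pi\int_{\partial D_3^0}\bigg(g_0(t)-f(k)\int_0^te^{f(k)(s-t)}g_0(s)\,ds\bigg)dk,\qquad t>0.$$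
   Context: A solution of the free Schrödinger equation in the quarter plane is a smooth function $u:[0,\infty)\times[0,\infty)\to\mathbb C$ such that $u(\cdot,t)\in\mathcal S([0,\infty))$ for each $t\ge0$ and $iu_t+u_{xx}=0$ for $x>0$ and $t>0$. Here $\mathcal S([0,\infty))=\{v\in C^\infty([0,\infty))\mid x^nv^{(m)}(x)\in L^\infty([0,\infty))\text{ for all }n,m\ge0\}$. $D_3^0=\{\mathrm{Re}\,k<0\}\cap\{\mathrm{Im}\,k<0\}\subset\mathbb C$ is the open third quadrant. Its boundary $\partial D_3^0$ is oriented so that $D_3^0$ lies to the left, i.e. it runs from $-i\infty$ to $0$ along the negative imaginary axis and then from $0$ to $-\infty$ along the negative real axis. Integrals over $\mathbb R$ and over $\partial D_3^0$ are understood as improper (possibly only conditionally convergent) integrals. A dot denotes $d/dt$. *)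

theory Defs
  imports "HOL-Complex_Analysis.Complex_Analysis"
begin

(* The derivative within {0..} is one-sided at 0, so only the values on [0, \<infinity>) matter. *)
definition half_deriv :: "(real \<Rightarrow> complex) \<Rightarrow> real \<Rightarrow> complex" where
  "half_deriv v x = vector_derivative v (at x within {0..})"

definition schwartz_half_line :: "(real \<Rightarrow> complex) set" where
  "schwartz_half_line = {v.
     (\<forall>m. (half_deriv ^^ m) v differentiable_on {0..}) \<and>
     (\<forall>n m. bounded ((\<lambda>x. complex_of_real (x ^ n) * (half_deriv ^^ m) v x) ` {0..}))}"

definition partial_x :: "(real \<Rightarrow> real \<Rightarrow> complex) \<Rightarrow> real \<Rightarrow> real \<Rightarrow> complex" where
  "partial_x u x t = half_deriv (\<lambda>y. u y t) x"

definition partial_t :: "(real \<Rightarrow> real \<Rightarrow> complex) \<Rightarrow> real \<Rightarrow> real \<Rightarrow> complex" where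
  "partial_t u x t = half_deriv (\<lambda>s. u x s) t"

(* C^n up to the boundary: all iterated partial derivatives of order at most n, in every
   order of differentiation, exist and are jointly continuous on the closed quarter plane. *)
primrec Cn_quarter_plane :: "nat \<Rightarrow> (real \<Rightarrow> real \<Rightarrow> complex) \<Rightarrow> bool" where
  "Cn_quarter_plane 0 u \<longleftrightarrow> continuous_on ({0..} \<times> {0..}) (\<lambda>(x, t). u x t)"
| "Cn_quarter_plane (Suc n) u \<longleftrightarrow>
     continuous_on ({0..} \<times> {0..}) (\<lambda>(x, t). u x t) \<and>
     (\<forall>t\<ge>0. (\<lambda>x. u x t) differentiable_on {0..}) \<and>
     (\<forall>x\<ge>0. (\<lambda>t. u x t) differentiable_on {0..}) \<and>
     Cn_quarter_plane n (partial_x u) \<and> Cn_quarter_plane n (partial_t u)"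

definition smooth_quarter_plane :: "(real \<Rightarrow> real \<Rightarrow> complex) \<Rightarrow> bool" where
  "smooth_quarter_plane u \<longleftrightarrow> (\<forall>n. Cn_quarter_plane n u)"

definition free_schroedinger_solution :: "(real \<Rightarrow> real \<Rightarrow> complex) \<Rightarrow> bool" where
  "free_schroedinger_solution u \<longleftrightarrow>
     smooth_quarter_plane u \<and>
     (\<forall>t\<ge>0. (\<lambda>x. u x t) \<in> schwartz_half_line) \<and>
     (\<forall>x>0. \<forall>t>0. \<i> * partial_t u x t + partial_x (partial_x u) x t = 0)"

definition dispersion :: "complex \<Rightarrow> complex" where
  "dispersion k = 4 * \<i> * k\<^sup>2"

definition half_line_fourier :: "(real \<Rightarrow> complex) \<Rightarrow> complex \<Rightarrow> complex" where
  "half_line_fourier v k = integral {0..} (\<lambda>x. exp (2 * \<i> * k * complex_of_real x) * v x)"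

definition time_transform :: "(real \<Rightarrow> complex) \<Rightarrow> complex \<Rightarrow> real \<Rightarrow> complex" where
  "time_transform g \<kappa> t = integral {0..t} (\<lambda>s. exp (\<kappa> * complex_of_real s) * g s)"

(* From -iR to 0 along the negative imaginary axis, then from 0 to -S along the negative
   real axis: the truncated boundary of the open third quadrant, which lies to its left. *)
definition D3_contour :: "real \<Rightarrow> real \<Rightarrow> real \<Rightarrow> complex" where
  "D3_contour R S =
     linepath (- \<i> * complex_of_real R) 0 +++ linepath 0 (- complex_of_real S)"

(* The improper contour integral over the full boundary; the two ends are sent to infinity
   independently of each other.  (On the real line this is what has_integral on UNIV means,
   so improper integrals over intervals need no separate notion.) *)
definition has_D3_integral :: "(complex \<Rightarrow> complex) \<Rightarrow> complex \<Rightarrow> bool"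
    (infixr "has'_D3'_integral" 46) where
  "(h has_D3_integral J) \<longleftrightarrow>
     (\<forall>R>0. \<forall>S>0. h contour_integrable_on D3_contour R S) \<and>
     ((\<lambda>(R, S). contour_integral (D3_contour R S) h) \<longlongrightarrow> J) (at_top \<times>\<^sub>F at_top)"

end

theory Submission
  imports Defs "HOL-Probability.Sinc_Integral"
begin

text \<open>
  Let \<open>f(k) = 4ik\<^sup>2\<close>. Integrating \<open>e\<^bsup>2ikx + f(k)t\<^esup> u(x,t)\<close> over \<open>x > 0\<close> gives the global relation
  between the half-line transforms \<open>U(k,t)\<close> of \<open>u(\<cdot>,t)\<close> and \<open>U(k,0)\<close> and the time transforms of the two
  boundary values. The solution is Schwartz for each fixed time only, so differentiating under the
  integral is not justified. For a time interval on which
  \<open>Q(t) = sup (1 + |k|)|U(k,t)|\<close> (supremum over real \<open>k\<close>) is bounded, a polynomial cutoff and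
  Parseval's identity yield the relation, and the relation in turn bounds the variation of \<open>Q\<close> by a
  constant that depends on the boundary values alone. As \<open>{t. Q t \<le> 2n}\<close> contains closed sets
  \<open>E\<^sub>n\<close> covering \<open>[0,\<infinity>)\<close>, Baire's theorem then shows that \<open>Q\<close> is locally bounded.

  The representation of \<open>u\<close> follows from Fourier inversion at \<open>x > 0\<close>, the analyticity and decay of
  the boundary term in the fourth quadrant, and the global relation at \<open>-k\<close>, whose term
  \<open>U(-k,t)\<close> is analytic in the third quadrant and integrates to zero. For the Neumann value one
  inverts the transform of \<open>u\<^sub>x\<close> at \<open>x = 0\<close>: adding the values at \<open>k\<close> and \<open>-k\<close> eliminates \<open>u\<^sub>x(0,t)\<close>
  from the global relation, and the remaining \<open>k\<close>-integrals are Fresnel integrals.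
\<close>

section \<open>Rapidly decaying functions on the half-line\<close>

text \<open>The obstacle is a circle. The decay constants of u(.,t) come with no uniformity in t, so
  the error of a spatial cutoff cannot be estimated directly in x. Estimating it through Parseval
  needs a bound on Q, and Q is controlled only by the relation being proved. The circle opens
  because an assumed bound on Q enters qualitatively: it licenses the relation on an interval, and
  the relation limits the change of Q by a constant into which that bound does not enter. Such an
  estimate carries bounds across gaps of any kind, which is what the Baire argument asks for. The
  weight 1 + |k| is dictated by the corner x = 0: a nonzero u(0,t) leaves the transform with decay
  1/|k| and no better, while two such factors already have an integrable product. The same slow
  decay makes the real-axis integrals only conditionally convergent. They are reached from the
  negative imaginary axis, where x > 0 supplies exponential decay, or through primitives in k that
  are bounded and have limits.\<close>

definition decays :: "real \<Rightarrow> (real \<Rightarrow> complex) \<Rightarrow> bool" where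
  "decays C v \<longleftrightarrow> continuous_on {0..} v \<and> (\<forall>x\<ge>0. norm (v x) \<le> C / (1 + x)\<^sup>2)"

lemma decays_cont: "decays C v \<Longrightarrow> continuous_on {0..} v"
  and decays_bound: "decays C v \<Longrightarrow> x \<ge> 0 \<Longrightarrow> norm (v x) \<le> C / (1 + x)\<^sup>2"
  by (auto simp: decays_def)

lemma decays_nonneg:
  assumes "decays C v" shows "C \<ge> 0"
  using decays_bound[OF assms, of 0] norm_ge_zero[of "v 0"] by (simp del: norm_ge_zero)

lemma decays_norm_le: 
  assumes "decays C v" "x \<ge> 0" shows "norm (v x) \<le> C"
proof -
  have "C / (1 + x)\<^sup>2 \<le> C / 1"
    using assms decays_nonneg[OF assms(1)]
    by (intro divide_left_mono) (auto intro: one_le_power)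
  with decays_bound[OF assms] show ?thesis by simp
qed

lemma tendsto_at_top_transform:
  fixes f g :: "real \<Rightarrow> 'a::topological_space"
  assumes "(f \<longlongrightarrow> l) at_top" "\<And>x. x \<ge> 0 \<Longrightarrow> f x = g x"
  shows "(g \<longlongrightarrow> l) at_top"
  by (rule Lim_transform_eventually[OF assms(1) eventually_mono[OF eventually_ge_at_top assms(2)]])

lemma tendsto_0_le_inverse:
  fixes f :: "real \<Rightarrow> 'a::real_normed_vector"
  assumes "\<And>R. R > 0 \<Longrightarrow> norm (f R) \<le> C / R"
  shows "(f \<longlongrightarrow> 0) at_top"
proof (rule Lim_null_comparison)
  show "\<forall>\<^sub>F R in at_top. norm (f R) \<le> C / R"
    using eventually_gt_at_top[of 0] by eventually_elim (rule assms)
qed (rule real_tendsto_divide_at_top[OF tendsto_const filterlim_ident])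

lemma has_integral_inverse_square:
  fixes a C :: real
  assumes "a \<ge> 0" "C \<ge> 0"
  shows "((\<lambda>x. C / (1 + x)\<^sup>2) has_integral C / (1 + a)) {a..}"
proof (rule has_integral_to_inf)
  have FTC: "((\<lambda>x. C / (1 + x)\<^sup>2) has_integral (- C / (1 + y)) - (- C / (1 + a))) {a..y}" if "a \<le> y" for y
  proof (rule fundamental_theorem_of_calculus[OF that])
    fix x assume "x \<in> {a..y}"
    then have "1 + x \<noteq> 0" using assms by auto
    then have "((\<lambda>x. - C / (1 + x)) has_real_derivative C / (1 + x)\<^sup>2) (at x within {a..y})"
      by (auto intro!: derivative_eq_intros simp: power2_eq_square field_simps)
    then show "((\<lambda>x. - C / (1 + x)) has_vector_derivative C / (1 + x)\<^sup>2) (at x within {a..y})"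
      by (simp add: has_real_derivative_iff_has_vector_derivative)
  qed
  show "(\<lambda>x. C / (1 + x)\<^sup>2) integrable_on {a..y}" for y
    using FTC[of y] by (cases "a \<le> y") (auto simp: integrable_on_def)
  have "((\<lambda>y. (- C / (1 + y)) - (- C / (1 + a))) \<longlongrightarrow> 0 - (- C / (1 + a))) at_top"
    by (intro tendsto_diff tendsto_const real_tendsto_divide_at_top[OF tendsto_const]
        filterlim_tendsto_add_at_top[OF tendsto_const] filterlim_ident)
  moreover have "eventually (\<lambda>y. (- C / (1 + y)) - (- C / (1 + a)) = integral {a..y} (\<lambda>x. C / (1 + x)\<^sup>2)) at_top"
    using eventually_ge_at_top[of a] by eventually_elim (rule integral_unique[OF FTC, symmetric])
  ultimately show "((\<lambda>y. integral {a..y} (\<lambda>x. C / (1 + x)\<^sup>2)) \<longlongrightarrow> C / (1 + a)) at_top"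
    by (auto elim: Lim_transform_eventually)
qed (use assms in auto)

lemma continuous_bounded_by_integrable:
  fixes f :: "real \<Rightarrow> 'a::euclidean_space"
  assumes "continuous_on S f" "closed S" "h integrable_on S" "\<And>x. x \<in> S \<Longrightarrow> norm (f x) \<le> h x"
  shows "f integrable_on S" "norm (integral S f) \<le> integral S h"
proof -
  have "S \<in> sets lebesgue"
    by (intro sets_completionI_sets) (simp add: assms(2))
  then show "f integrable_on S"
    using measurable_bounded_by_integrable_imp_integrable[OF _ assms(3,4)]
      continuous_imp_measurable_on_sets_lebesgue[OF assms(1)] by blast
  then show "norm (integral S f) \<le> integral S h"
    using assms by (intro integral_norm_bound_integral) auto
qed

lemma decays_mult:
  assumes v: "decays C v" and g: "continuous_on {0..} g" and M: "\<And>x. x \<ge> 0 \<Longrightarrow> norm (g x) \<le> M"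
  shows "decays (M * C) (\<lambda>x. g x * v x)"
  unfolding decays_def
proof (intro conjI allI impI)
  show "continuous_on {0..} (\<lambda>x. g x * v x)"
    by (intro continuous_intros g decays_cont[OF v])
  fix x :: real assume "x \<ge> 0"
  moreover have "M \<ge> 0" using M[of 0] norm_ge_zero[of "g 0"] by linarith
  ultimately show "norm (g x * v x) \<le> M * C / (1 + x)\<^sup>2"
    using mult_mono[OF M[of x] decays_bound[OF v, of x]] by (simp add: norm_mult)
qed

text \<open>The integral of C/(1+x)^2 over the half-line is exactly C. With this weight a single
  constant bounds the supremum, the integral and, divided by 1 + a, the tail.\<close>

lemma decays_integrable:
  assumes "decays C v" "a \<ge> 0"
  shows "v integrable_on {a..}" "norm (integral {a..} v) \<le> C / (1 + a)"
proof -
  note I = has_integral_inverse_square[OF assms(2) decays_nonneg[OF assms(1)]]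
  have c: "continuous_on {a..} v"
    using decays_cont[OF assms(1)] by (rule continuous_on_subset) (use assms in auto)
  have b: "norm (v x) \<le> C / (1 + x)\<^sup>2" if "x \<in> {a..}" for x
    using decays_bound[OF assms(1)] that assms(2) by auto
  show "v integrable_on {a..}" "norm (integral {a..} v) \<le> C / (1 + a)"
    using continuous_bounded_by_integrable[OF c _ has_integral_integrable[OF I] b]
      integral_unique[OF I] by auto
qed

lemma decays_truncate:
  assumes "decays C v" "n \<ge> 0"
  shows "norm (integral {0..} v - integral {0..n} v) \<le> C / (1 + n)"
proof -
  have 1: "v integrable_on {0..n}"
    by (rule integrable_continuous_real, rule continuous_on_subset[OF decays_cont[OF assms(1)]]) auto
  have "{0..} = {0..n} \<union> {n..}" "negligible ({0..n} \<inter> {n..})"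
    using assms(2) by (auto intro: negligible_subset[of "{n}"])
  then have "integral {0..} v = integral {0..n} v + integral {n..} v"
    using integral_Un[OF 1 decays_integrable(1)[OF assms]] by simp
  then show ?thesis using decays_integrable(2)[OF assms] by simp
qed

lemma tendsto_inverse_1_plus: "((\<lambda>n::real. C / (1 + n)) \<longlongrightarrow> 0) at_top"
  by (intro real_tendsto_divide_at_top[OF tendsto_const]
        filterlim_tendsto_add_at_top[OF tendsto_const] filterlim_ident)

lemma decays_tendsto_integral:
  assumes "decays C v"
  shows "((\<lambda>n. integral {0..n} v) \<longlongrightarrow> integral {0..} v) at_top"
proof -
  have "eventually (\<lambda>n. norm (integral {0..n} v - integral {0..} v) \<le> C / (1 + n)) at_top"
    using eventually_ge_at_top[of 0]
    by eventually_elim (metis decays_truncate[OF assms] norm_minus_commute)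
  then have "((\<lambda>n. integral {0..n} v - integral {0..} v) \<longlongrightarrow> 0) at_top"
    by (rule Lim_null_comparison[OF _ tendsto_inverse_1_plus])
  then show ?thesis using LIM_zero_iff by blast
qed

lemma decays_tendsto_0:
  assumes "decays C v" shows "(v \<longlongrightarrow> 0) at_top"
proof -
  have "eventually (\<lambda>x. norm (v x) \<le> C / (1 + x)) at_top"
    using eventually_ge_at_top[of 0]
  proof eventually_elim
    fix x :: real assume x: "0 \<le> x"
    have "C / (1 + x)\<^sup>2 \<le> C / (1 + x)"
      using decays_nonneg[OF assms] x
      by (intro divide_left_mono) (auto simp: power2_eq_square mult_le_cancel_left1)
    then show "norm (v x) \<le> C / (1 + x)" using decays_bound[OF assms x] by simp
  qed
  then show ?thesis by (rule Lim_null_comparison[OF _ tendsto_inverse_1_plus])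
qed

lemma half_line_ftc:
  assumes F: "\<And>x. x \<ge> 0 \<Longrightarrow> (F has_vector_derivative F' x) (at x within {0..})"
    and F': "decays C F'" and lim: "(F \<longlongrightarrow> 0) at_top"
  shows "integral {0..} F' = - F 0"
proof -
  have eq: "F n - F 0 = integral {0..n} F'" if "n \<ge> 0" for n
    by (rule integral_unique[symmetric], rule fundamental_theorem_of_calculus)
      (use that in \<open>auto intro: has_vector_derivative_within_subset[OF F]\<close>)
  have "((\<lambda>n. F n - F 0) \<longlongrightarrow> 0 - F 0) at_top" by (intro tendsto_intros lim)
  from tendsto_at_top_transform[OF this eq]
  have "((\<lambda>n. integral {0..n} F') \<longlongrightarrow> 0 - F 0) at_top" .
  then show ?thesis
    using tendsto_unique[OF _ decays_tendsto_integral[OF F']] by auto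
qed

text \<open>Limits in the real parameter are tested on sequences. The shift by \<open>N\<close>
  discards the finitely many terms with negative parameter, about which nothing is assumed.\<close>

lemma dominated_convergence_at_top:
  fixes f :: "real \<Rightarrow> real \<Rightarrow> complex"
  assumes f: "\<And>s. s \<ge> 0 \<Longrightarrow> f s integrable_on A" and h: "h integrable_on A"
    and le: "\<And>s x. s \<ge> 0 \<Longrightarrow> x \<in> A \<Longrightarrow> norm (f s x) \<le> h x"
    and conv: "\<And>x. x \<in> A \<Longrightarrow> ((\<lambda>s. f s x) \<longlongrightarrow> g x) at_top"
  shows "g integrable_on A" "((\<lambda>s. integral A (f s)) \<longlongrightarrow> integral A g) at_top"
proof -
  have *: "g integrable_on A \<and> (\<lambda>n. integral A (f (X n))) \<longlonglongrightarrow> integral A g"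
    if X: "filterlim X at_top sequentially" for X
  proof -
    obtain N where N: "\<And>n. n \<ge> N \<Longrightarrow> X n \<ge> 0"
      using X by (auto simp: filterlim_at_top eventually_sequentially)
    have X': "filterlim (\<lambda>n. X (n + N)) at_top sequentially"
      using X by (rule filterlim_compose) (rule filterlim_add_const_nat_at_top)
    have D: "g integrable_on A" "(\<lambda>n. integral A (f (X (n + N)))) \<longlonglongrightarrow> integral A g"
      using dominated_convergence[of "\<lambda>n. f (X (n + N))" A h g] f h le N
        filterlim_compose[OF conv X'] by auto
    show ?thesis using D(1) LIMSEQ_offset[OF D(2)] by simp
  qed
  show "g integrable_on A" using *[OF filterlim_real_sequentially] by simp
  show "((\<lambda>s. integral A (f s)) \<longlongrightarrow> integral A g) at_top"
    by (rule tendsto_at_topI_sequentially) (use * in blast)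
qed

text \<open>The exchange is elementary on compact rectangles. The truncated inner integrals are
  bounded by \<open>2 * (M * C)\<close> uniformly in k and n, so dominated convergence in k removes
  the truncation on the left, and decay in y removes it on the right.\<close>

lemma half_line_swap:
  fixes \<kappa> :: "real \<Rightarrow> real \<Rightarrow> complex"
  assumes "a \<le> b" and v: "decays C v" and \<kappa>: "continuous_on ({a..b} \<times> {0..}) (\<lambda>(k, y). \<kappa> k y)"
    and M: "\<And>k y. k \<in> {a..b} \<Longrightarrow> y \<ge> 0 \<Longrightarrow> norm (\<kappa> k y) \<le> M"
  shows "((\<lambda>k. integral {0..} (\<lambda>y. \<kappa> k y * v y)) has_integral
           integral {0..} (\<lambda>y. integral {a..b} (\<lambda>k. \<kappa> k y) * v y)) {a..b}"
proof -
  have cy: "continuous_on {0..} (\<kappa> k)" if "k \<in> {a..b}" for k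
    by (rule continuous_on_compose2[OF \<kappa>, of "{0..}" "\<lambda>y. (k, y)", simplified])
       (use that in \<open>auto intro!: continuous_intros\<close>)
  have ck: "continuous_on {a..b} (\<lambda>k. \<kappa> k y)" if "y \<ge> 0" for y
    by (rule continuous_on_compose2[OF \<kappa>, of "{a..b}" "\<lambda>k. (k, y)", simplified])
       (use that in \<open>auto intro!: continuous_intros\<close>)
  have d: "decays (M * C) (\<lambda>y. \<kappa> k y * v y)" if "k \<in> {a..b}" for k
    using decays_mult[OF v cy[OF that]] M that by auto
  have cn: "continuous_on ({a..b} \<times> {0..n}) (\<lambda>(k, y). \<kappa> k y * v y)" for n :: real
    unfolding case_prod_unfold
    by (intro continuous_intros continuous_on_subset[OF \<kappa>[unfolded case_prod_unfold]]
        continuous_on_compose2[OF decays_cont[OF v]]) auto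
  have ci: "continuous_on {a..b} (\<lambda>k. integral {0..n} (\<lambda>y. \<kappa> k y * v y))" for n :: real
    using integral_continuous_on_param[of "{a..b}" 0 n "\<lambda>k y. \<kappa> k y * v y"] cn[of n] by simp
  have swap: "integral {a..b} (\<lambda>k. integral {0..n} (\<lambda>y. \<kappa> k y * v y)) =
      integral {0..n} (\<lambda>y. integral {a..b} (\<lambda>k. \<kappa> k y) * v y)" for n :: real
    using integral_swap_continuous[of a 0 b n "\<lambda>k y. \<kappa> k y * v y"] cn[of n] cbox_Pair_eq[of a 0 b n] by simp
  have b: "norm (integral {0..n} (\<lambda>y. \<kappa> k y * v y)) \<le> 2 * (M * C)" if "n \<ge> 0" "k \<in> {a..b}" for n k
  proof -
    have "M * C \<ge> 0" using decays_nonneg[OF d[OF that(2)]] .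
    then have "M * C / (1 + n) \<le> M * C" using that by (simp add: divide_le_eq mult_le_cancel_left1)
    moreover have "norm (integral {0..} (\<lambda>y. \<kappa> k y * v y)) \<le> M * C"
      using decays_integrable(2)[OF d[OF that(2)], of 0] by simp
    ultimately show ?thesis
      using decays_truncate[OF d[OF that(2)] that(1)]
        norm_triangle_sub[of "integral {0..n} (\<lambda>y. \<kappa> k y * v y)" "integral {0..} (\<lambda>y. \<kappa> k y * v y)"]
      by (simp add: norm_minus_commute)
  qed
  note lhs = dominated_convergence_at_top[OF integrable_continuous_real[OF ci] integrable_const_ivl b
      decays_tendsto_integral[OF d]]
  have cI: "continuous_on {0..} (\<lambda>y. integral {a..b} (\<lambda>k. \<kappa> k y))"
    using integral_continuous_on_param[of "{0..}" a b "\<lambda>y k. \<kappa> k y"]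
      continuous_on_compose2[OF \<kappa>, of "{0..} \<times> {a..b}" "\<lambda>(y, k). (k, y)"]
    by (simp add: case_prod_unfold continuous_intros mem_Times_iff image_subset_iff)
  have "norm (integral {a..b} (\<lambda>k. \<kappa> k y)) \<le> M * \<bar>b - a\<bar>" if "y \<ge> 0" for y
    using integral_bound[OF \<open>a \<le> b\<close> ck[OF that], of M] M that \<open>a \<le> b\<close> by auto
  then have "decays (M * \<bar>b - a\<bar> * C) (\<lambda>y. integral {a..b} (\<lambda>k. \<kappa> k y) * v y)"
    by (intro decays_mult[OF v cI]) auto
  note rhs = decays_tendsto_integral[OF this]
  show ?thesis
    using tendsto_unique[OF _ lhs(2) rhs[folded swap]] lhs(1) by (simp add: has_integral_integrable_integral)
qed

section \<open>The half-line Fourier transform\<close>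

lemma norm_fourier_kernel:
  assumes "Im k \<ge> 0" "x \<ge> 0"
  shows "norm (exp (2 * \<i> * k * of_real x)) \<le> 1"
  using assms by simp

lemma decays_fourier:
  assumes "decays C v" "Im k \<ge> 0"
  shows "decays C (\<lambda>x. exp (2 * \<i> * k * of_real x) * v x)"
  using decays_mult[OF assms(1), of "\<lambda>x. exp (2 * \<i> * k * of_real x)" 1]
    norm_fourier_kernel[OF assms(2)] by (simp add: continuous_intros)

lemma norm_half_line_fourier_le:
  assumes "decays C v" "Im k \<ge> 0"
  shows "norm (half_line_fourier v k) \<le> C"
  using decays_integrable(2)[OF decays_fourier[OF assms], of 0] by (simp add: half_line_fourier_def)

lemma half_line_fourier_deriv:
  assumes v: "decays C v" and v': "decays C' v'"
    and deriv: "\<And>x. x \<ge> 0 \<Longrightarrow> (v has_vector_derivative v' x) (at x within {0..})"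
    and k: "Im k \<ge> 0"
  shows "half_line_fourier v' k = - v 0 - 2 * \<i> * k * half_line_fourier v k"
proof -
  let ?e = "\<lambda>x. exp (2 * \<i> * k * of_real x)"
  note d = decays_fourier[OF v k] and d' = decays_fourier[OF v' k]
  have F: "((\<lambda>x. ?e x * v x) has_vector_derivative ?e x * v' x + 2 * \<i> * k * (?e x * v x)) (at x within {0..})"
    if "x \<ge> 0" for x
    by (auto intro!: derivative_eq_intros deriv that has_vector_derivative_real_field simp: algebra_simps)
  have d2: "decays (norm (2 * \<i> * k) * C) (\<lambda>x. 2 * \<i> * k * (?e x * v x))"
    by (rule decays_mult[OF d]) auto
  have "decays (C' + norm (2 * \<i> * k) * C) (\<lambda>x. ?e x * v' x + 2 * \<i> * k * (?e x * v x))"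
    unfolding decays_def
  proof (intro conjI allI impI)
    fix x :: real assume x: "x \<ge> 0"
    show "norm (?e x * v' x + 2 * \<i> * k * (?e x * v x)) \<le> (C' + norm (2 * \<i> * k) * C) / (1 + x)\<^sup>2"
      using norm_triangle_mono[OF decays_bound[OF d' x] decays_bound[OF d2 x]] by (simp add: add_divide_distrib)
  qed (intro continuous_intros decays_cont[OF v] decays_cont[OF v'])
  from half_line_ftc[OF F this decays_tendsto_0[OF d]]
  have "integral {0..} (\<lambda>x. ?e x * v' x + 2 * \<i> * k * (?e x * v x)) = - v 0" by simp
  also have "integral {0..} (\<lambda>x. ?e x * v' x + 2 * \<i> * k * (?e x * v x)) =
      half_line_fourier v' k + 2 * \<i> * k * half_line_fourier v k"
    unfolding half_line_fourier_def
    by (subst integral_add) (use decays_integrable(1)[OF d', of 0] decays_integrable(1)[OF d2, of 0] in auto)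
  finally show ?thesis by (simp add: algebra_simps eq_neg_iff_add_eq_0)
qed

text \<open>One integration by parts bounds 2|k| times the transform by |v(0)| plus the transform of
  v', each at most C. Since v(0) need not vanish, a further integration by parts would not improve
  the decay.\<close>

lemma half_line_fourier_bound:
  assumes v: "decays C v" and v': "decays C v'"
    and deriv: "\<And>x. x \<ge> 0 \<Longrightarrow> (v has_vector_derivative v' x) (at x within {0..})"
    and k: "Im k \<ge> 0"
  shows "(1 + norm k) * norm (half_line_fourier v k) \<le> 2 * C"
proof -
  have "2 * \<i> * k * half_line_fourier v k = - v 0 - half_line_fourier v' k"
    using half_line_fourier_deriv[OF assms] by (simp add: algebra_simps)
  then have "norm (2 * \<i> * k * half_line_fourier v k) \<le> norm (v 0) + norm (half_line_fourier v' k)"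
    by (metis norm_minus_cancel norm_triangle_ineq4)
  then have "2 * norm k * norm (half_line_fourier v k) \<le> C + C"
    using decays_norm_le[OF v, of 0] norm_half_line_fourier_le[OF v' k] by (simp add: norm_mult)
  then show ?thesis using norm_half_line_fourier_le[OF v k] by (simp add: algebra_simps)
qed

text \<open>The tail bound C/(1+n) does not see k because |exp(2ikx)| is at most 1 for Im k >= 0.
  Continuity on the closed and holomorphy on the open half-plane are both inherited through this
  limit.\<close>

lemma half_line_fourier_uniform_limit:
  assumes "decays C v"
  shows "uniform_limit {k. Im k \<ge> 0} (\<lambda>n k. integral {0..real n} (\<lambda>x. exp (2 * \<i> * k * of_real x) * v x))
           (half_line_fourier v) sequentially"
proof (rule uniform_limitI)
  fix e :: real assume "e > 0"
  have "(\<lambda>n. C / (1 + real n)) \<longlonglongrightarrow> 0"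
    by (rule filterlim_compose[OF tendsto_inverse_1_plus filterlim_real_sequentially])
  with \<open>e > 0\<close> have "eventually (\<lambda>n. C / (1 + real n) < e) sequentially"
    by (metis order_tendstoD(2))
  then show "\<forall>\<^sub>F n in sequentially. \<forall>k\<in>{k. Im k \<ge> 0}.
      dist (integral {0..real n} (\<lambda>x. exp (2 * \<i> * k * of_real x) * v x)) (half_line_fourier v k) < e"
  proof eventually_elim
    case (elim n)
    show ?case
      using decays_truncate[OF decays_fourier[OF assms], of _ "real n"] elim
      by (force simp: dist_norm half_line_fourier_def norm_minus_commute)
  qed
qed

lemma truncated_fourier_kernel_cont:
  assumes "continuous_on {0..} v"
  shows "continuous_on (U \<times> cbox 0 n) (\<lambda>(k, x). exp (2 * \<i> * k * of_real x) * v x)"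
  unfolding case_prod_unfold
  by (intro continuous_intros continuous_on_compose2[OF assms]) auto

lemma half_line_fourier_continuous:
  assumes "decays C v"
  shows "continuous_on {k. Im k \<ge> 0} (half_line_fourier v)"
proof (rule uniform_limit_theorem[OF _ half_line_fourier_uniform_limit[OF assms]])
  show "\<forall>\<^sub>F n in sequentially. continuous_on {k. Im k \<ge> 0}
      (\<lambda>k. integral {0..real n} (\<lambda>x. exp (2 * \<i> * k * of_real x) * v x))"
    using integral_continuous_on_param[OF truncated_fourier_kernel_cont[OF decays_cont[OF assms]], of "{k. Im k \<ge> 0}"]
    by simp
qed simp

lemma half_line_fourier_holomorphic:
  assumes "decays C v"
  shows "half_line_fourier v holomorphic_on {k. Im k > 0}"
proof (rule holomorphic_uniform_sequence[OF open_halfspace_Im_gt])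
  fix n :: nat
  let ?f = "\<lambda>k x. exp (2 * \<i> * k * of_real x) * v x"
  have "(\<lambda>k. integral (cbox 0 (real n)) (?f k)) holomorphic_on {k. Im k > 0}"
  proof (rule leibniz_rule_holomorphic)
    show "((\<lambda>k. ?f k x) has_field_derivative 2 * \<i> * of_real x * ?f k x) (at k within {k. Im k > 0})" for k x
      by (auto intro!: derivative_eq_intros)
    show "?f k integrable_on cbox 0 (real n)" for k
      by (intro integrable_continuous continuous_intros continuous_on_subset[OF decays_cont[OF assms]]) auto
    show "continuous_on ({k. Im k > 0} \<times> cbox 0 (real n)) (\<lambda>(k, x). 2 * \<i> * of_real x * ?f k x)"
      unfolding case_prod_unfold
      by (intro continuous_intros continuous_on_compose2[OF decays_cont[OF assms]]) auto
    show "convex {k. Im k > 0}" by (rule convex_halfspace_Im_gt)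
  qed
  then show "(\<lambda>k. integral {0..real n} (?f k)) holomorphic_on {k. Im k > 0}" by simp
next
  fix k assume "k \<in> {k. Im k > 0}"
  then obtain d where d: "d > 0" "cball k d \<subseteq> {k. Im k > 0}"
    using open_halfspace_Im_gt[of 0] open_contains_cball by blast
  then have "cball k d \<subseteq> {k. Im k \<ge> 0}" by force
  with d show "\<exists>d>0. cball k d \<subseteq> {k. Im k > 0} \<and>
      uniform_limit (cball k d) (\<lambda>n k. integral {0..real n} (\<lambda>x. exp (2 * \<i> * k * of_real x) * v x))
        (half_line_fourier v) sequentially"
    using uniform_limit_on_subset[OF half_line_fourier_uniform_limit[OF assms]] by blast
qed

section \<open>Pointwise Fourier inversion through the sine integral\<close>

lemma Si_odd: "Si (- x) = - Si x"
  using Si_neg[of x] Si_neg[of "- x"] by (cases "x \<ge> 0") auto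

lemma Si_at_bot: "(Si \<longlongrightarrow> - (pi / 2)) at_bot"
proof -
  have "((\<lambda>x. - Si (- x)) \<longlongrightarrow> - (pi / 2)) at_bot"
    by (intro tendsto_minus filterlim_compose[OF Si_at_top] filterlim_uminus_at_top_at_bot)
  then show ?thesis by (simp add: Si_odd)
qed

lemma Si_scaled_tendsto:
  "((\<lambda>S. Si (2 * S * a)) \<longlongrightarrow> pi / 2 * sgn a) at_top"
proof -
  consider "a > 0" | "a = 0" | "a < 0" by linarith
  then show ?thesis
  proof cases
    case 1
    have "filterlim (\<lambda>S. (2 * a) * S) at_top at_top"
      by (rule filterlim_tendsto_pos_mult_at_top[OF tendsto_const _ filterlim_ident]) (use 1 in auto)
    from filterlim_compose[OF Si_at_top this] 1 show ?thesis by (simp add: mult_ac)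
  next
    case 2
    have "Si 0 = 0" using Si_odd[of 0] by simp
    with 2 show ?thesis by simp
  next
    case 3
    have "filterlim (\<lambda>S. (2 * a) * S) at_bot at_top"
      by (rule filterlim_tendsto_neg_mult_at_bot[OF tendsto_const _ filterlim_ident]) (use 3 in auto)
    from filterlim_compose[OF Si_at_bot this] 3 show ?thesis by (simp add: mult_ac)
  qed
qed

lemma integral_dirichlet_kernel:
  fixes S w :: real
  assumes "S \<ge> 0"
  shows "integral {-S..S} (\<lambda>k. exp (2 * \<i> * of_real k * of_real w)) = of_real (2 * S * sinc (2 * S * w))"
proof (cases "w = 0")
  case True then show ?thesis using assms by (simp add: scaleR_conv_of_real)
next
  case False
  have "((\<lambda>k. exp (2 * \<i> * of_real k * of_real w)) has_integral
     exp (2 * \<i> * of_real S * of_real w) / (2 * \<i> * of_real w) -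
     exp (2 * \<i> * of_real (- S) * of_real w) / (2 * \<i> * of_real w)) {-S..S}"
    using assms False
    by (intro fundamental_theorem_of_calculus has_vector_derivative_real_field)
      (auto intro!: derivative_eq_intros)
  moreover have "exp (2 * \<i> * of_real S * of_real w) / (2 * \<i> * of_real w) -
     exp (2 * \<i> * of_real (- S) * of_real w) / (2 * \<i> * of_real w) =
     of_real (2 * S * sinc (2 * S * w))"
  proof -
    have "exp (2 * \<i> * of_real S * of_real w) = cis (2 * S * w)"
      "exp (2 * \<i> * of_real (- S) * of_real w) = cis (- (2 * S * w))"
      by (simp_all add: cis_conv_exp mult_ac)
    moreover have "cis (2 * S * w) - cis (- (2 * S * w)) = 2 * \<i> * of_real (sin (2 * S * w))"
      by (simp add: complex_eq_iff)
    ultimately show ?thesis using False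
      by (cases "S = 0") (auto simp: diff_divide_distrib[symmetric] field_simps)
  qed
  ultimately show ?thesis by (metis integral_unique)
qed

lemma continuous_on_Si [continuous_intros]:
  "continuous_on A f \<Longrightarrow> continuous_on A (\<lambda>x. Si (f x))"
  using continuous_on_compose2[of UNIV Si A f] isCont_Si by (simp add: continuous_at_imp_continuous_on)

lemma Si_times_decays:
  assumes B: "\<And>T. \<bar>Si T\<bar> \<le> B" and w: "decays C w"
  shows "decays (B * C) (\<lambda>y. of_real (Si (2 * S * (y - z))) * w y)"
  by (rule decays_mult[OF w]) (auto intro!: continuous_intros B)

text \<open>The Dirichlet kernel \<open>2 * S * sinc (2 * S * (y - z))\<close> grows with S, whereas
  its primitive \<open>Si (2 * S * (y - z))\<close> is bounded and converges. Integrating by parts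
  onto v' therefore prepares dominated convergence as S tends to infinity.\<close>

lemma fourier_inversion_partial:
  assumes v: "decays C v" and v': "decays C' v'"
    and deriv: "\<And>x. x \<ge> 0 \<Longrightarrow> (v has_vector_derivative v' x) (at x within {0..})"
    and S: "S \<ge> 0"
  shows "((\<lambda>k. exp (- 2 * \<i> * of_real k * of_real z) * half_line_fourier v (of_real k))
           has_integral of_real (Si (2 * S * z)) * v 0
             - integral {0..} (\<lambda>y. of_real (Si (2 * S * (y - z))) * v' y)) {-S..S}"
proof -
  let ?D = "\<lambda>y. of_real (2 * S * sinc (2 * S * (y - z)))"
  let ?s = "\<lambda>y. of_real (Si (2 * S * (y - z)))"
  have e: "exp (2 * \<i> * of_real k * of_real (y - z)) =
      exp (- 2 * \<i> * of_real k * of_real z) * exp (2 * \<i> * of_real k * of_real y)" for k y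
    by (simp add: exp_add[symmetric] algebra_simps)
  have "((\<lambda>k. integral {0..} (\<lambda>y. exp (2 * \<i> * of_real k * of_real (y - z)) * v y)) has_integral
      integral {0..} (\<lambda>y. integral {-S..S} (\<lambda>k. exp (2 * \<i> * of_real k * of_real (y - z))) * v y)) {-S..S}"
    by (rule half_line_swap[OF _ v, where M = 1])
      (use S in \<open>auto simp: case_prod_unfold intro!: continuous_intros\<close>)
  moreover have "integral {0..} (\<lambda>y. exp (2 * \<i> * of_real k * of_real (y - z)) * v y) =
      exp (- 2 * \<i> * of_real k * of_real z) * half_line_fourier v (of_real k)" for k
    unfolding e half_line_fourier_def by (simp only: mult.assoc integral_mult_right)
  ultimately have 1: "((\<lambda>k. exp (- 2 * \<i> * of_real k * of_real z) * half_line_fourier v (of_real k))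
     has_integral integral {0..} (\<lambda>y. ?D y * v y)) {-S..S}"
    by (simp only: integral_dirichlet_kernel[OF S])
  obtain B where B: "\<And>T. \<bar>Si T\<bar> \<le> B" using bounded_Si by blast
  note s = Si_times_decays[OF B, where S = S and z = z]
  have sinc1: "\<bar>sinc x\<bar> \<le> 1" for x using abs_sin_x_le_abs_x[of x] by (auto simp: divide_le_eq)
  have *: "norm (complex_of_real (2 * S * r)) \<le> 2 * S" if "\<bar>r\<bar> \<le> 1" for r
    using S that mult_left_le[of "\<bar>r\<bar>" "2 * S"] unfolding norm_of_real by (simp add: abs_mult)
  have D: "decays (2 * S * C) (\<lambda>y. ?D y * v y)"
    by (intro decays_mult[OF v] continuous_intros *[OF sinc1])
  have F: "((\<lambda>y. ?s y * v y) has_vector_derivative ?D y * v y + ?s y * v' y) (at y within {0..})" if "y \<ge> 0" for y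
  proof -
    have "((\<lambda>y. 2 * S * (y - z)) has_real_derivative 2 * S) (at y within {0..})"
      by (auto intro!: derivative_eq_intros)
    from DERIV_chain2[OF DERIV_Si this]
    have "((\<lambda>y. Si (2 * S * (y - z))) has_real_derivative 2 * S * sinc (2 * S * (y - z))) (at y within {0..})"
      by (simp only: mult.commute[of _ "2 * S"])
    then have "(?s has_vector_derivative ?D y) (at y within {0..})"
      by (rule has_vector_derivative_of_real)
    from has_vector_derivative_mult[OF this deriv[OF that]] show ?thesis by (simp add: algebra_simps)
  qed
  have "decays (2 * S * C + B * C') (\<lambda>y. ?D y * v y + ?s y * v' y)"
    using D s[OF v'] unfolding decays_def
    by (auto intro!: continuous_intros norm_triangle_mono simp: add_divide_distrib)
  from half_line_ftc[OF F this decays_tendsto_0[OF s[OF v]]]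
  have "integral {0..} (\<lambda>y. ?D y * v y + ?s y * v' y) = of_real (Si (2 * S * z)) * v 0"
    using Si_odd[of "2 * S * z"] by simp
  moreover have "integral {0..} (\<lambda>y. ?D y * v y + ?s y * v' y) =
      integral {0..} (\<lambda>y. ?D y * v y) + integral {0..} (\<lambda>y. ?s y * v' y)"
    by (intro integral_add decays_integrable(1)[OF D] decays_integrable(1)[OF s[OF v']]) auto
  ultimately show ?thesis using 1 by (simp add: algebra_simps)
qed


text \<open>The bound is free of both S and z, which makes it the dominating constant when the
  Parseval argument lets S tend to infinity under an integral over z.\<close>

lemma fourier_inversion_partial_bound:
  assumes B: "\<And>T. \<bar>Si T\<bar> \<le> B" and v: "decays C v" "decays C v'"
      "\<And>x. x \<ge> 0 \<Longrightarrow> (v has_vector_derivative v' x) (at x within {0..})" "S \<ge> 0"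
  shows "norm (integral {-S..S} (\<lambda>k. exp (- 2 * \<i> * of_real k * of_real z)
        * half_line_fourier v (of_real k))) \<le> 2 * B * C"
proof -
  have "B \<ge> 0" using B[of 0] by linarith
  then have "norm (of_real (Si (2 * S * z)) * v 0) \<le> B * C"
    using B decays_norm_le[OF v(1), of 0] by (auto simp: norm_mult intro!: mult_mono)
  moreover have "norm (integral {0..} (\<lambda>y. of_real (Si (2 * S * (y - z))) * v' y)) \<le> B * C"
    using decays_integrable(2)[OF Si_times_decays[OF B v(2)], of 0] by simp
  ultimately have "norm (of_real (Si (2 * S * z)) * v 0 -
      integral {0..} (\<lambda>y. of_real (Si (2 * S * (y - z))) * v' y)) \<le> 2 * B * C"
    using norm_triangle_ineq4[of "of_real (Si (2 * S * z)) * v 0"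
        "integral {0..} (\<lambda>y. of_real (Si (2 * S * (y - z))) * v' y)"] by linarith
  then show ?thesis
    by (simp only: integral_unique[OF fourier_inversion_partial[OF v]])
qed

text \<open>The phase 2kx makes the constant pi instead of 2 pi. At z = 0 only half of the kernel's
  mass lies in the half-line: the extension by zero jumps there and inversion returns half the
  value. The Neumann value is read off from this case.\<close>

lemma fourier_inversion:
  assumes v: "decays C v" and v': "decays C' v'"
    and deriv: "\<And>x. x \<ge> 0 \<Longrightarrow> (v has_vector_derivative v' x) (at x within {0..})"
    and z: "z \<ge> 0"
  shows "((\<lambda>S. integral {-S..S} (\<lambda>k. exp (- 2 * \<i> * of_real k * of_real z)
           * half_line_fourier v (of_real k)))
         \<longlongrightarrow> of_real (if z = 0 then pi / 2 else pi) * v z) at_top"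
proof -
  obtain B where B: "\<And>T. \<bar>Si T\<bar> \<le> B" using bounded_Si by blast
  let ?f = "\<lambda>S y. of_real (Si (2 * S * (y - z))) * v' y"
  let ?g = "\<lambda>y. of_real (pi / 2 * sgn (y - z)) * v' y"
  have "((\<lambda>S. integral {0..} (?f S)) \<longlongrightarrow> integral {0..} ?g) at_top"
  proof (rule dominated_convergence_at_top(2))
    show "(\<lambda>y. B * C' / (1 + y)\<^sup>2) integrable_on {0..}"
      using has_integral_inverse_square[of 0 "B * C'"] decays_nonneg[OF Si_times_decays[OF B v']]
      by (auto simp: integrable_on_def)
    show "norm (?f S y) \<le> B * C' / (1 + y)\<^sup>2" if "y \<in> {0..}" for S y
      using decays_bound[OF Si_times_decays[OF B v']] that by auto
    show "?f S integrable_on {0..}" for S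
      by (rule decays_integrable(1)[OF Si_times_decays[OF B v']]) simp
    show "((\<lambda>S. ?f S y) \<longlongrightarrow> ?g y) at_top" for y
      by (intro tendsto_mult tendsto_const tendsto_of_real Si_scaled_tendsto)
  qed
  \<comment> \<open>Away from y = z one has sgn(y - z) = 1 - 2 [y <= z]. The two pieces integrate v'
    to -v(0) over the half-line and to v(z) - v(0) over [0,z].\<close>
  moreover have "(?g has_integral of_real (pi / 2) * (- v 0 - 2 * (v z - v 0))) {0..}"
  proof (rule has_integral_spike_finite[of "{z}"])
    have "(v' has_integral v z - v 0) {0..z}"
      using z by (intro fundamental_theorem_of_calculus) (auto intro: has_vector_derivative_within_subset[OF deriv])
    then have 1: "((\<lambda>y. if y \<in> {0..z} then v' y else 0) has_integral v z - v 0) {0..}"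
      by (subst has_integral_restrict) auto
    have 2: "(v' has_integral - v 0) {0..}"
      using half_line_ftc[OF deriv v' decays_tendsto_0[OF v]] decays_integrable(1)[OF v', of 0]
      by (metis has_integral_integrable_integral order_refl)
    show "((\<lambda>y. of_real (pi / 2) * (v' y - 2 * (if y \<in> {0..z} then v' y else 0)))
        has_integral of_real (pi / 2) * (- v 0 - 2 * (v z - v 0))) {0..}"
      by (intro has_integral_mult_right has_integral_diff 1 2)
  qed (auto simp: sgn_if)
  ultimately have "((\<lambda>S. integral {0..} (?f S)) \<longlongrightarrow> of_real (pi / 2) * (- v 0 - 2 * (v z - v 0))) at_top"
    by (simp only: integral_unique)
  then have "((\<lambda>S. of_real (Si (2 * S * z)) * v 0 - integral {0..} (?f S)) \<longlongrightarrow>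
      of_real (pi / 2 * sgn z) * v 0 - of_real (pi / 2) * (- v 0 - 2 * (v z - v 0))) at_top"
    by (intro tendsto_intros Si_scaled_tendsto)
  also have "of_real (pi / 2 * sgn z) * v 0 - of_real (pi / 2) * (- v 0 - 2 * (v z - v 0)) =
      of_real (if z = 0 then pi / 2 else pi) * v z"
    using z by (auto simp: sgn_if algebra_simps)
  finally show ?thesis
    by (rule tendsto_at_top_transform) (rule integral_unique[OF fourier_inversion_partial[OF v v' deriv], symmetric])
qed

section \<open>Parseval pairing with a test function on a bounded interval\<close>

lemma finite_fourier_bound:
  assumes \<psi>: "\<And>x. x \<in> {0..R} \<Longrightarrow> (\<psi> has_vector_derivative \<psi>' x) (at x within {0..R})"
    and cont: "continuous_on {0..R} \<psi>'" and "R \<ge> 0"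
    and bound: "\<And>x. x \<in> {0..R} \<Longrightarrow> norm (\<psi> x) \<le> D / (1 + x)\<^sup>2" "\<And>x. x \<in> {0..R} \<Longrightarrow> norm (\<psi>' x) \<le> D / (1 + x)\<^sup>2"
  shows "(1 + \<bar>k\<bar>) * norm (integral {0..R} (\<lambda>x. exp (- 2 * \<i> * of_real k * of_real x) * \<psi> x)) \<le> 3 * D"
proof -
  let ?e = "\<lambda>x. exp (- 2 * \<i> * of_real k * of_real x)"
  have e1: "norm (?e x) = 1" for x by simp
  have "norm (\<psi> 0) \<ge> 0" "norm (\<psi> 0) \<le> D" using bound(1)[of 0] \<open>R \<ge> 0\<close> by auto
  then have D: "D \<ge> 0" by linarith
  have c\<psi>: "continuous_on {0..R} \<psi>"
    using \<psi> by (meson continuous_on_eq_continuous_within has_vector_derivative_continuous)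
  have I: "norm (integral {0..R} (\<lambda>x. ?e x * \<phi> x)) \<le> D" "(\<lambda>x. ?e x * \<phi> x) integrable_on {0..R}"
    if "continuous_on {0..R} \<phi>" "\<And>x. x \<in> {0..R} \<Longrightarrow> norm (\<phi> x) \<le> D / (1 + x)\<^sup>2" for \<phi>
  proof -
    note h = has_integral_inverse_square[OF order_refl D]
    have i: "(\<lambda>x. D / (1 + x)\<^sup>2) integrable_on {0..R}"
      using has_integral_integrable[OF h] by (rule integrable_on_subinterval) auto
    have "integral {0..R} (\<lambda>x. D / (1 + x)\<^sup>2) \<le> integral {0..} (\<lambda>x. D / (1 + x)\<^sup>2)"
      using has_integral_integrable[OF h] i D by (intro integral_subset_le) auto
    also have "\<dots> = D" using integral_unique[OF h] by simp
    finally have 1: "integral {0..R} (\<lambda>x. D / (1 + x)\<^sup>2) \<le> D" .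
    have 2: "continuous_on {0..R} (\<lambda>x. ?e x * \<phi> x)" by (intro continuous_intros that)
    show "norm (integral {0..R} (\<lambda>x. ?e x * \<phi> x)) \<le> D" "(\<lambda>x. ?e x * \<phi> x) integrable_on {0..R}"
      using continuous_bounded_by_integrable[OF 2 closed_atLeastAtMost i] that(2) 1
      by (auto simp: norm_mult)
  qed
  have H1: "((\<lambda>x. ?e x * \<psi>' x + (- 2 * \<i> * of_real k) * (?e x * \<psi> x)) has_integral ?e R * \<psi> R - ?e 0 * \<psi> 0) {0..R}"
    using \<open>R \<ge> 0\<close>
    by (intro fundamental_theorem_of_calculus)
      (auto intro!: derivative_eq_intros \<psi> has_vector_derivative_real_field simp: algebra_simps)
  have H2: "((\<lambda>x. ?e x * \<psi>' x + (- 2 * \<i> * of_real k) * (?e x * \<psi> x)) has_integral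
      integral {0..R} (\<lambda>x. ?e x * \<psi>' x) + (- 2 * \<i> * of_real k) * integral {0..R} (\<lambda>x. ?e x * \<psi> x)) {0..R}"
    by (intro has_integral_add has_integral_mult_right integrable_integral I(2) cont c\<psi> bound)
  have eq: "2 * \<i> * of_real k * integral {0..R} (\<lambda>x. ?e x * \<psi> x) =
      integral {0..R} (\<lambda>x. ?e x * \<psi>' x) - (?e R * \<psi> R - \<psi> 0)"
    using has_integral_unique[OF H1 H2] by (simp add: algebra_simps)
  have "norm (2 * \<i> * of_real k * integral {0..R} (\<lambda>x. ?e x * \<psi> x)) \<le>
      norm (integral {0..R} (\<lambda>x. ?e x * \<psi>' x)) + (norm (?e R * \<psi> R) + norm (\<psi> 0))"
    unfolding eq by (rule order_trans[OF norm_triangle_ineq4 add_left_mono[OF norm_triangle_ineq4]])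
  moreover have "norm (\<psi> x) \<le> D" if "x \<in> {0..R}" for x
    using bound(1)[OF that] that D frac_le[of D D 1 "(1 + x)\<^sup>2"] by (force intro: one_le_power)
  then have "norm (\<psi> 0) \<le> D" "norm (?e R * \<psi> R) \<le> D" using \<open>R \<ge> 0\<close> by (auto simp: norm_mult)
  \<comment> \<open>One D for the integral of \<psi>' and one for each boundary value. Halving this
    and adding the unweighted bound D gives 5D/2, which is rounded up to 3D.\<close>
  ultimately have "2 * \<bar>k\<bar> * norm (integral {0..R} (\<lambda>x. ?e x * \<psi> x)) \<le> D + (D + D)"
    using I(1)[OF cont bound(2)] by (simp add: norm_mult)
  then show ?thesis using I(1)[OF c\<psi> bound(1)] D by (simp add: algebra_simps)
qed

text \<open>By Parseval, pairing with a fixed test function is controlled by the weighted supremum of the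
  transform on the real line, which is the quantity that can be propagated in time.\<close>

lemma parseval_bound:
  assumes v: "decays C v" and v': "decays C v'"
    and deriv: "\<And>x. x \<ge> 0 \<Longrightarrow> (v has_vector_derivative v' x) (at x within {0..})"
    and P: "\<And>k::real. (1 + \<bar>k\<bar>) * norm (half_line_fourier v (of_real k)) \<le> P"
    and \<psi>: "\<And>x. x \<in> {0..R} \<Longrightarrow> (\<psi> has_vector_derivative \<psi>' x) (at x within {0..R})"
    and cont: "continuous_on {0..R} \<psi>'" and R: "R \<ge> 0"
    and bound: "\<And>x. x \<in> {0..R} \<Longrightarrow> norm (\<psi> x) \<le> D / (1 + x)\<^sup>2" "\<And>x. x \<in> {0..R} \<Longrightarrow> norm (\<psi>' x) \<le> D / (1 + x)\<^sup>2"
  shows "norm (integral {0..R} (\<lambda>x. \<psi> x * v x)) \<le> 3 * D * P"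
proof -
  let ?e = "\<lambda>k x. exp (- 2 * \<i> * of_real k * of_real x)"
  let ?h = "\<lambda>k::real. half_line_fourier v (of_real k)"
  define J where "J S = integral {0..R} (\<lambda>x. \<psi> x * integral {-S..S} (\<lambda>k. ?e k x * ?h k))" for S
  have c\<psi>: "continuous_on {0..R} \<psi>"
    using \<psi> by (meson continuous_on_eq_continuous_within has_vector_derivative_continuous)
  have D: "D \<ge> 0" using bound(1)[of 0] R norm_ge_zero[of "\<psi> 0"] by (auto simp del: norm_ge_zero)
  have ch: "continuous_on UNIV ?h"
    by (rule continuous_on_compose2[OF half_line_fourier_continuous[OF v]]) (auto intro!: continuous_intros)
  have c2: "continuous_on (A \<times> B) (\<lambda>(k, x). ?e k x * ?h k)" for A B
    unfolding case_prod_unfold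
    by (intro continuous_intros continuous_on_compose2[OF ch]) auto
  have c2': "continuous_on (A \<times> B) (\<lambda>(x, k). ?e k x * ?h k)" for A B
    unfolding case_prod_unfold
    by (intro continuous_intros continuous_on_compose2[OF ch]) auto
  have c3: "continuous_on ({-S..S} \<times> {0..R}) (\<lambda>(k, x). \<psi> x * (?e k x * ?h k))" for S
    unfolding case_prod_unfold
    by (intro continuous_intros continuous_on_compose2[OF ch] continuous_on_compose2[OF c\<psi>]) auto
  \<comment> \<open>Each of the two transforms contributes a factor 1/(1+|k|). Their product is
    below 1/(1+k^2), whose integral over the line is pi; this pi cancels against the one produced by
    the inversion formula.\<close>
  have J: "norm (J S) \<le> 3 * D * P * pi" if "S \<ge> 0" for S
  proof -
    have "J S = integral {0..R} (\<lambda>x. integral {-S..S} (\<lambda>k. \<psi> x * (?e k x * ?h k)))"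
      by (simp add: J_def)
    also have "\<dots> = integral {-S..S} (\<lambda>k. integral {0..R} (\<lambda>x. \<psi> x * (?e k x * ?h k)))"
      using integral_swap_continuous[of "- S" 0 S R "\<lambda>k x. \<psi> x * (?e k x * ?h k)"] c3[of S]
        cbox_Pair_eq[of "-S" 0 S R] by simp
    also have "\<dots> = integral {-S..S} (\<lambda>k. integral {0..R} (\<lambda>x. ?e k x * \<psi> x) * ?h k)"
    proof (rule integral_cong)
      fix k
      show "integral {0..R} (\<lambda>x. \<psi> x * (?e k x * ?h k)) = integral {0..R} (\<lambda>x. ?e k x * \<psi> x) * ?h k"
        by (subst integral_mult_left[symmetric]) (simp only: mult_ac)
    qed
    finally have J: "J S = integral {-S..S} (\<lambda>k. integral {0..R} (\<lambda>x. ?e k x * \<psi> x) * ?h k)" .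
    have c5: "continuous_on ({-S..S} \<times> {0..R}) (\<lambda>(k, x). ?e k x * \<psi> x)"
      unfolding case_prod_unfold by (intro continuous_intros continuous_on_compose2[OF c\<psi>]) auto
    have c4: "continuous_on {-S..S} (\<lambda>k. integral {0..R} (\<lambda>x. ?e k x * \<psi> x))"
      using integral_continuous_on_param[of "{-S..S}" 0 R "\<lambda>k x. ?e k x * \<psi> x"] c5 by simp
    have hi: "((\<lambda>k. 3 * D * P * inverse (1 + k\<^sup>2)) has_integral 3 * D * P * (arctan S - arctan (- S))) {-S..S}"
      using that
      by (intro has_integral_mult_right fundamental_theorem_of_calculus)
        (auto intro!: derivative_eq_intros simp: has_real_derivative_iff_has_vector_derivative[symmetric])
    have "norm (J S) \<le> integral {-S..S} (\<lambda>k. 3 * D * P * inverse (1 + k\<^sup>2))"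
      unfolding J
    proof (rule continuous_bounded_by_integrable(2)[OF _ _ has_integral_integrable[OF hi]])
      show "continuous_on {-S..S} (\<lambda>k. integral {0..R} (\<lambda>x. ?e k x * \<psi> x) * ?h k)"
        by (intro continuous_intros c4 continuous_on_subset[OF ch]) auto
      fix k
      have "((1 + \<bar>k\<bar>) * norm (integral {0..R} (\<lambda>x. ?e k x * \<psi> x))) * ((1 + \<bar>k\<bar>) * norm (?h k)) \<le> 3 * D * P"
        by (intro mult_mono finite_fourier_bound[OF \<psi> cont R bound] P) (use D in auto)
      then have "(1 + \<bar>k\<bar>)\<^sup>2 * norm (integral {0..R} (\<lambda>x. ?e k x * \<psi> x) * ?h k) \<le> 3 * D * P"
        by (simp add: power2_eq_square norm_mult mult_ac)
      moreover have "(1 + k\<^sup>2) * norm (integral {0..R} (\<lambda>x. ?e k x * \<psi> x) * ?h k) \<le>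
          (1 + \<bar>k\<bar>)\<^sup>2 * norm (integral {0..R} (\<lambda>x. ?e k x * \<psi> x) * ?h k)"
        by (intro mult_right_mono) (auto simp: power2_eq_square algebra_simps)
      ultimately have "(1 + k\<^sup>2) * norm (integral {0..R} (\<lambda>x. ?e k x * \<psi> x) * ?h k) \<le> 3 * D * P" by linarith
      moreover have "1 + k\<^sup>2 > 0" by (simp add: add_pos_nonneg)
      ultimately show "norm (integral {0..R} (\<lambda>x. ?e k x * \<psi> x) * ?h k) \<le> 3 * D * P * inverse (1 + k\<^sup>2)"
        by (simp add: field_simps)
    qed simp
    also have "\<dots> = 3 * D * P * (arctan S - arctan (- S))" by (rule integral_unique[OF hi])
    also have "\<dots> \<le> 3 * D * P * pi"
    proof (rule mult_left_mono)
      show "arctan S - arctan (- S) \<le> pi" using arctan_ubound[of S] by (simp add: arctan_minus)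
      have "P \<ge> 0" using P[of 0] norm_ge_zero[of "?h 0"] by (simp del: norm_ge_zero)
      then show "0 \<le> 3 * D * P" using D by simp
    qed
    finally show ?thesis .
  qed
  obtain B where B: "\<And>T. \<bar>Si T\<bar> \<le> B" using bounded_Si by blast
  have "B \<ge> 0" using B[of 0] by linarith
  note bd = fourier_inversion_partial_bound[OF B v v' deriv]
  let ?g = "\<lambda>x. \<psi> x * (of_real (if x = 0 then pi / 2 else pi) * v x)"
  have "((\<lambda>S. integral {0..R} (\<lambda>x. \<psi> x * integral {-S..S} (\<lambda>k. ?e k x * ?h k))) \<longlongrightarrow> integral {0..R} ?g) at_top"
  proof (rule dominated_convergence_at_top(2)[where h = "\<lambda>_. D * (2 * B * C)"])
    show "(\<lambda>x. \<psi> x * integral {-S..S} (\<lambda>k. ?e k x * ?h k)) integrable_on {0..R}" for S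
      using integral_continuous_on_param[of "{0..R}" "-S" S "\<lambda>x k. ?e k x * ?h k"] c2' c\<psi>
      by (intro integrable_continuous_real continuous_intros) auto
    show "norm (\<psi> x * integral {-S..S} (\<lambda>k. ?e k x * ?h k)) \<le> D * (2 * B * C)" if "S \<ge> 0" "x \<in> {0..R}" for S x
    proof -
      have "norm (\<psi> x) \<le> D"
        using bound(1)[OF that(2)] that D frac_le[of D D 1 "(1 + x)\<^sup>2"] by (force intro: one_le_power)
      then show ?thesis using bd[OF _ that(1), of x] D unfolding norm_mult by (intro mult_mono) auto
    qed
    show "((\<lambda>S. \<psi> x * integral {-S..S} (\<lambda>k. ?e k x * ?h k)) \<longlongrightarrow> ?g x) at_top" if "x \<in> {0..R}" for x
      using fourier_inversion[OF v v' deriv, of x] that by (intro tendsto_intros) auto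
  qed auto
  \<comment> \<open>Only at the single point x = 0 does inversion give pi/2 in place of pi.\<close>
  also have "integral {0..R} ?g = integral {0..R} (\<lambda>x. of_real pi * (\<psi> x * v x))"
    by (rule integral_spike[of "{0}"]) auto
  finally have "(J \<longlongrightarrow> of_real pi * integral {0..R} (\<lambda>x. \<psi> x * v x)) at_top"
    unfolding J_def by simp
  then have "norm (of_real pi * integral {0..R} (\<lambda>x. \<psi> x * v x)) \<le> 3 * D * P * pi"
  proof (rule Lim_norm_ubound[rotated])
    show "\<forall>\<^sub>F S in at_top. norm (J S) \<le> 3 * D * P * pi"
      using eventually_ge_at_top[of 0] by eventually_elim (rule J)
  qed simp
  then show ?thesis by (simp add: norm_mult)
qed

section \<open>The global relation\<close>

text \<open>Let \<open>K\<close> be the closed set of times near which \<open>Q\<close> is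
  unbounded. If \<open>K\<close> were nonempty, some \<open>E n\<close> would contain a relatively
  open piece of it. A time s in a gap of \<open>K\<close> near that piece is joined to a point of
  \<open>K\<close> where \<open>Q\<close> is at most \<open>M n\<close>, and \<open>step\<close>
  transports this bound to s. It is essential that \<open>C\<close> is chosen before m: the
  provisional bound on the gap must not enter the result.\<close>

lemma locally_bounded_by_baire:
  fixes Q :: "real \<Rightarrow> real" and E :: "nat \<Rightarrow> real set" and M :: "nat \<Rightarrow> real"
  assumes closed: "\<And>n. closed (E n)" and cover: "\<And>t. t \<ge> 0 \<Longrightarrow> \<exists>n. t \<in> E n"
    and bound: "\<And>n t. t \<in> E n \<Longrightarrow> Q t \<le> M n"
    and step: "\<And>T. \<exists>C. \<forall>s t m. 0 \<le> s \<and> s \<le> t \<and> t \<le> T \<and> (\<forall>r\<in>{s..t}. Q r \<le> m) \<longrightarrow> \<bar>Q s - Q t\<bar> \<le> C"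
    and "T \<ge> 0"
  obtains m where "\<And>r. r \<in> {0..T} \<Longrightarrow> Q r \<le> m"
proof -
  define good where "good r \<longleftrightarrow> (\<exists>e>0. \<exists>m. \<forall>s\<ge>0. \<bar>s - r\<bar> < e \<longrightarrow> Q s \<le> m)" for r
  have compact_bound: "\<exists>m. \<forall>s\<in>{a..b}. Q s \<le> m" if ab: "0 \<le> a" "a \<le> b" and g: "\<And>r. r \<in> {a..b} \<Longrightarrow> good r" for a b
  proof -
    let ?P = "\<lambda>a b. \<exists>m. \<forall>s\<in>{a..b}. s \<ge> 0 \<longrightarrow> Q s \<le> m"
    have "?P a b"
    proof (rule Bolzano[where P = ?P and a = a and b = b])
      fix a b c assume "?P a b" "?P b c"
      then obtain m1 m2 where "\<forall>s\<in>{a..b}. s \<ge> 0 \<longrightarrow> Q s \<le> m1" "\<forall>s\<in>{b..c}. s \<ge> 0 \<longrightarrow> Q s \<le> m2" by blast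
      then have "\<forall>s\<in>{a..c}. s \<ge> 0 \<longrightarrow> Q s \<le> max m1 m2"
        by (metis atLeastAtMost_iff linear max.coboundedI1 max.coboundedI2)
      then show "?P a c" by blast
    next
      fix x assume "a \<le> x" "x \<le> b"
      then obtain e m where "e > 0" and e: "\<And>s. s \<ge> 0 \<Longrightarrow> \<bar>s - x\<bar> < e \<Longrightarrow> Q s \<le> m"
        using g[of x] by (auto simp: good_def)
      show "\<exists>d>0. \<forall>a b. a \<le> x \<and> x \<le> b \<and> b - a < d \<longrightarrow> ?P a b"
      proof (rule exI[of _ e], intro conjI \<open>e > 0\<close> allI impI)
        fix a b assume "a \<le> x \<and> x \<le> b \<and> b - a < e"
        then have "\<forall>s\<in>{a..b}. s \<ge> 0 \<longrightarrow> Q s \<le> m" by (auto intro!: e)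
        then show "?P a b" by blast
      qed
    qed fact
    with ab show ?thesis by (meson atLeastAtMost_iff order_trans)
  qed
  define K where "K = {r. r \<ge> 0 \<and> \<not> good r}"
  have "open {r. r < 0 \<or> good r}"
  proof (rule openI)
    fix r assume r: "r \<in> {r. r < 0 \<or> good r}"
    show "\<exists>e>0. ball r e \<subseteq> {r. r < 0 \<or> good r}"
    proof (cases "r < 0")
      case True
      then show ?thesis by (intro exI[of _ "- r"]) (auto simp: dist_real_def)
    next
      case False
      with r obtain e m where "e > 0" and e: "\<And>s. s \<ge> 0 \<Longrightarrow> \<bar>s - r\<bar> < e \<Longrightarrow> Q s \<le> m"
        by (auto simp: good_def)
      have "good p" if "p \<in> ball r e" for p
      proof -
        have "\<forall>s\<ge>0. \<bar>s - p\<bar> < e - \<bar>p - r\<bar> \<longrightarrow> Q s \<le> m" by (auto intro!: e)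
        moreover have "e - \<bar>p - r\<bar> > 0" using that by (auto simp: dist_real_def)
        ultimately show ?thesis unfolding good_def by blast
      qed
      then show ?thesis using \<open>e > 0\<close> by blast
    qed
  qed
  moreover have "K = - {r. r < 0 \<or> good r}" by (auto simp: K_def)
  ultimately have clK: "closed K" by (simp add: closed_def)
  have "K = {}"
  proof (rule ccontr)
    assume "K \<noteq> {}"
    have "\<exists>n. \<not> K \<subseteq> closure (K - E n)"
    proof (rule ccontr)
      assume dense: "\<nexists>n. \<not> K \<subseteq> closure (K - E n)"
      \<comment> \<open>Each \<open>K - E n\<close> is open in \<open>K\<close>. If all were dense,
        Baire would make their intersection dense in \<open>K\<close>, but the covering makes it
        empty.\<close>
      have "K \<subseteq> closure (\<Inter>(range (\<lambda>n. K - E n)))"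
      proof (rule Baire[OF clK])
        show "openin (top_of_set K) T \<and> K \<subseteq> closure T" if "T \<in> range (\<lambda>n. K - E n)" for T
          using that dense closed by (auto simp: openin_open Diff_eq intro!: exI[of _ "- E _"])
      qed simp
      moreover have "\<Inter>(range (\<lambda>n. K - E n)) = {}"
        using cover by (auto simp: K_def)
      ultimately have "K \<subseteq> closure {}" by metis
      then show False using \<open>K \<noteq> {}\<close> by simp
    qed
    then obtain n r where r: "r \<in> K" "r \<notin> closure (K - E n)" by blast
    then obtain e where "e > 0" and e: "ball r e \<inter> (K - E n) = {}"
      by (metis Diff_eq_empty_iff disjoint_iff_not_equal closure_approachable dist_commute mem_ball)
    obtain C where C: "\<And>s t m. 0 \<le> s \<Longrightarrow> s \<le> t \<Longrightarrow> t \<le> r + e \<Longrightarrow> (\<And>p. p \<in> {s..t} \<Longrightarrow> Q p \<le> m) \<Longrightarrow> \<bar>Q s - Q t\<bar> \<le> C"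
      using step[of "r + e"] by blast
    have "r \<ge> 0" using r by (simp add: K_def)
    have "C \<ge> 0" using C[of r r "Q r"] \<open>r \<ge> 0\<close> \<open>e > 0\<close> by auto
    have Kb: "Q c \<le> M n" if "c \<in> K" "\<bar>c - r\<bar> < e" for c
    proof (rule bound)
      have "c \<in> ball r e" using that by (auto simp: dist_real_def abs_minus_commute)
      with e that show "c \<in> E n" by blast
    qed
    have "Q s \<le> M n + C" if s: "s \<ge> 0" "\<bar>s - r\<bar> < e" for s
    proof (cases "s \<in> K")
      case True
      then show ?thesis using Kb[OF _ s(2)] \<open>C \<ge> 0\<close> by simp
    next
      case False
      then have "s \<noteq> r" using r by auto
      then consider "r < s" | "s < r" by linarith
      then show ?thesis
      proof cases
        case 1
        let ?L = "K \<inter> {r..s}"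
        \<comment> \<open>The last bad time before s. All of (c,s] is good, so \<open>Q\<close> is
          bounded on [p,s] for every p > c, with a bound that might blow up as p approaches
          c.\<close>
        define c where "c = Sup ?L"
        have L: "closed ?L" "?L \<noteq> {}" "bdd_above ?L" "r \<in> ?L" using clK r 1 by auto
        have c: "c \<in> ?L" unfolding c_def by (rule closed_contains_Sup[OF L(2,3,1)])
        have "c \<noteq> s" using c False by auto
        then have cs: "c < s" "c \<ge> 0" using c by (auto simp: K_def)
        have g: "good p" if "p \<in> {c<..s}" for p
        proof (rule ccontr)
          assume "\<not> good p"
          then have "p \<in> ?L" using that c by (auto simp: K_def)
          then have "p \<le> c" unfolding c_def by (rule cSup_upper[OF _ L(3)])
          with that show False by simp
        qed
        \<comment> \<open>On [p,s] the step estimate applies and gives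
          \<open>Q p \<le> Q s + C\<close> uniformly in p. Together with the single value
          \<open>Q c\<close> this bounds \<open>Q\<close> on the whole of [c,s], so that the step
          estimate may be used from c itself.\<close>
        have "Q p \<le> max (Q c) (Q s + C)" if p: "p \<in> {c..s}" for p
        proof (cases "p = c")
          case False
          then obtain m where "\<And>q. q \<in> {p..s} \<Longrightarrow> Q q \<le> m"
            using compact_bound[of p s] g p cs by force
          then have "\<bar>Q p - Q s\<bar> \<le> C" using C[of p s m] p cs s by auto
          then show ?thesis by linarith
        qed simp
        then have "\<bar>Q c - Q s\<bar> \<le> C" using C[of c s "max (Q c) (Q s + C)"] cs s by auto
        moreover have "Q c \<le> M n" using c s by (intro Kb) auto
        ultimately show ?thesis by linarith
      next
        case 2
        let ?L = "K \<inter> {s..r}"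
        define c where "c = Inf ?L"
        have L: "closed ?L" "?L \<noteq> {}" "bdd_below ?L" "r \<in> ?L" using clK r 2 by auto
        have c: "c \<in> ?L" unfolding c_def by (rule closed_contains_Inf[OF L(2,3,1)])
        have "c \<noteq> s" using c False by auto
        then have cs: "s < c" "c \<le> r" using c by auto
        have g: "good p" if "p \<in> {s..<c}" for p
        proof (rule ccontr)
          assume "\<not> good p"
          then have "p \<in> ?L" using that c s by (auto simp: K_def)
          then have "c \<le> p" unfolding c_def by (rule cInf_lower[OF _ L(3)])
          with that show False by simp
        qed
        have "Q p \<le> max (Q c) (Q s + C)" if p: "p \<in> {s..c}" for p
        proof (cases "p = c")
          case False
          then obtain m where "\<And>q. q \<in> {s..p} \<Longrightarrow> Q q \<le> m"
            using compact_bound[of s p] g p cs s by force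
          then have "\<bar>Q s - Q p\<bar> \<le> C" using C[of s p m] p cs s \<open>e > 0\<close> by auto
          then show ?thesis by linarith
        qed simp
        then have "\<bar>Q s - Q c\<bar> \<le> C" using C[of s c "max (Q c) (Q s + C)"] cs s \<open>e > 0\<close> by auto
        moreover have "Q c \<le> M n" using cs s by (intro Kb) (use c in auto)
        ultimately show ?thesis by linarith
      qed
    qed
    then have "good r" unfolding good_def using \<open>e > 0\<close> by blast
    then show False using r by (simp add: K_def)
  qed
  then have "good r" if "r \<in> {0..T}" for r using that by (auto simp: K_def)
  then obtain m where "\<forall>s\<in>{0..T}. Q s \<le> m"
    using compact_bound[of 0 T] \<open>T \<ge> 0\<close> by auto
  then show thesis using that by blast
qed


section \<open>Regularity, boundary values and the truncated identities for a solution\<close>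

locale quarter_plane_solution =
  fixes u :: "real \<Rightarrow> real \<Rightarrow> complex"
  assumes sol: "free_schroedinger_solution u"
begin

abbreviation ux :: "real \<Rightarrow> real \<Rightarrow> complex" where "ux \<equiv> partial_x u"
abbreviation uxx :: "real \<Rightarrow> real \<Rightarrow> complex" where "uxx \<equiv> partial_x ux"
abbreviation ut :: "real \<Rightarrow> real \<Rightarrow> complex" where "ut \<equiv> partial_t u"
abbreviation uxt :: "real \<Rightarrow> real \<Rightarrow> complex" where "uxt \<equiv> partial_t ux"

lemma Cn3: "Cn_quarter_plane 3 u"
  using sol by (auto simp: free_schroedinger_solution_def smooth_quarter_plane_def)

lemma continuous:
  "continuous_on ({0..} \<times> {0..}) (\<lambda>(x, t). u x t)" "continuous_on ({0..} \<times> {0..}) (\<lambda>(x, t). ux x t)"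
  "continuous_on ({0..} \<times> {0..}) (\<lambda>(x, t). uxx x t)" "continuous_on ({0..} \<times> {0..}) (\<lambda>(x, t). ut x t)"
  "continuous_on ({0..} \<times> {0..}) (\<lambda>(x, t). uxt x t)"
  using Cn3 by (auto simp: numeral_3_eq_3)

lemma has_derivs:
  assumes "x \<ge> 0" "t \<ge> 0"
  shows "((\<lambda>x. u x t) has_vector_derivative ux x t) (at x within {0..})"
    "((\<lambda>x. ux x t) has_vector_derivative uxx x t) (at x within {0..})"
    "((\<lambda>t. u x t) has_vector_derivative ut x t) (at t within {0..})"
    "((\<lambda>t. ux x t) has_vector_derivative uxt x t) (at t within {0..})"
  using Cn3 assms
  by (auto simp: numeral_3_eq_3 partial_x_def partial_t_def half_deriv_def differentiable_on_def
      vector_derivative_works[symmetric])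

lemma schroedinger:
  assumes "x > 0" "t > 0" shows "ut x t = \<i> * uxx x t"
proof -
  have "\<i> * ut x t + uxx x t = 0"
    using sol assms by (auto simp: free_schroedinger_solution_def)
  then have "\<i> * (\<i> * ut x t + uxx x t) = 0" by simp
  then show ?thesis by (simp add: algebra_simps)
qed

lemma schwartz_decays:
  assumes "v \<in> schwartz_half_line"
  obtains C where "decays C ((half_deriv ^^ m) v)"
proof -
  let ?w = "(half_deriv ^^ m) v"
  have bd: "bounded ((\<lambda>x. of_real (x ^ n) * ?w x) ` {0..})" for n
    using assms by (auto simp: schwartz_half_line_def)
  have "\<exists>B. \<forall>x\<ge>0. x ^ n * norm (?w x) \<le> B" for n
    using bd[of n] unfolding bounded_iff by (auto simp: norm_mult norm_power)
  then obtain B where B: "\<And>n x. x \<ge> 0 \<Longrightarrow> x ^ n * norm (?w x) \<le> B n" by metis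
  have "decays (B 0 + 2 * B 1 + B 2) ?w"
    unfolding decays_def
  proof (intro conjI allI impI)
    show "continuous_on {0..} ?w"
      using assms by (auto simp: schwartz_half_line_def intro: differentiable_imp_continuous_on)
    fix x :: real assume x: "x \<ge> 0"
    have "norm (?w x) * (1 + x)\<^sup>2 = x ^ 0 * norm (?w x) + 2 * (x ^ 1 * norm (?w x)) + x ^ 2 * norm (?w x)"
      by (simp add: power2_eq_square algebra_simps)
    also have "\<dots> \<le> B 0 + 2 * B 1 + B 2" using B[OF x, of 0] B[OF x, of 1] B[OF x, of 2] by linarith
    finally show "norm (?w x) \<le> (B 0 + 2 * B 1 + B 2) / (1 + x)\<^sup>2"
      using x by (simp add: pos_le_divide_eq)
  qed
  then show thesis by (rule that)
qed

lemma decays_mono: "decays C v \<Longrightarrow> C \<le> C' \<Longrightarrow> decays C' v"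
  unfolding decays_def by (meson divide_right_mono order_trans zero_le_power2)

lemma solution_decays:
  assumes "t \<ge> 0"
  obtains C where "decays C (\<lambda>x. u x t)" "decays C (\<lambda>x. ux x t)" "decays C (\<lambda>x. uxx x t)"
proof -
  have S: "(\<lambda>x. u x t) \<in> schwartz_half_line"
    using sol assms by (auto simp: free_schroedinger_solution_def)
  have "ux = (\<lambda>x t. half_deriv (\<lambda>x. u x t) x)" "uxx = (\<lambda>x t. half_deriv (half_deriv (\<lambda>x. u x t)) x)"
    by (auto simp: partial_x_def fun_eq_iff)
  then have *: "(\<lambda>x. ux x t) = (half_deriv ^^ 1) (\<lambda>x. u x t)" "(\<lambda>x. uxx x t) = (half_deriv ^^ 2) (\<lambda>x. u x t)"
    by (simp_all add: numeral_2_eq_2)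
  obtain C0 C1 C2 where "decays C0 (\<lambda>x. u x t)" "decays C1 (\<lambda>x. ux x t)" "decays C2 (\<lambda>x. uxx x t)"
    using schwartz_decays[OF S, of 0] schwartz_decays[OF S, of 1] schwartz_decays[OF S, of 2]
    unfolding * by (metis funpow_0)
  then have "decays (max C0 (max C1 C2)) (\<lambda>x. u x t)" "decays (max C0 (max C1 C2)) (\<lambda>x. ux x t)"
    "decays (max C0 (max C1 C2)) (\<lambda>x. uxx x t)"
    by (auto elim: decays_mono)
  then show thesis by (rule that)
qed

definition hat :: "real \<Rightarrow> complex \<Rightarrow> complex" where
  "hat t = half_line_fourier (\<lambda>x. u x t)"

text \<open>Integrating i exp(2ikx) u_xx by parts twice over the half-line gives -f(k) times the
  transform of u and, from x = 0, minus this expression.\<close>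

definition bdry :: "complex \<Rightarrow> real \<Rightarrow> complex" where
  "bdry k \<tau> = \<i> * ux 0 \<tau> + 2 * k * u 0 \<tau>"

text \<open>A predicate on an interval [s,t], because the relation is at the outset available only
  on intervals where the weighted transform is bounded.\<close>

definition global_relation :: "real \<Rightarrow> real \<Rightarrow> complex \<Rightarrow> bool" where
  "global_relation s t k \<longleftrightarrow> exp (dispersion k * t) * hat t k - exp (dispersion k * s) * hat s k =
     - integral {s..t} (\<lambda>\<tau>. exp (dispersion k * \<tau>) * bdry k \<tau>)"

lemma continuous_time:
  assumes "x \<ge> 0" "A \<subseteq> {0..}"
  shows "continuous_on A (\<lambda>t. u x t)" "continuous_on A (\<lambda>t. ux x t)"
    "continuous_on A (\<lambda>t. ut x t)" "continuous_on A (\<lambda>t. uxt x t)"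
proof -
  have "continuous_on A (\<lambda>t. F x t)" if "continuous_on ({0..} \<times> {0..}) (\<lambda>(x, t). F x t)" for F :: "real \<Rightarrow> real \<Rightarrow> complex"
    by (rule continuous_on_compose2[OF that, of A "\<lambda>t. (x, t)", simplified])
      (use assms in \<open>auto intro!: continuous_intros\<close>)
  then show "continuous_on A (\<lambda>t. u x t)" "continuous_on A (\<lambda>t. ux x t)"
    "continuous_on A (\<lambda>t. ut x t)" "continuous_on A (\<lambda>t. uxt x t)"
    using continuous by auto
qed

lemma continuous_space:
  assumes "t \<ge> 0" "A \<subseteq> {0..}"
  shows "continuous_on A (\<lambda>x. u x t)" "continuous_on A (\<lambda>x. ux x t)"
  by (rule continuous_on_subset[OF differentiable_imp_continuous_on assms(2)],
      use has_derivs[OF _ assms(1)] in \<open>auto simp: differentiable_on_def intro: differentiableI_vector\<close>)+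

lemma continuous_bdry:
  assumes "A \<subseteq> {0..}" shows "continuous_on A (bdry k)"
  unfolding bdry_def using assms by (intro continuous_intros continuous_time) auto

text \<open>Green's identity: \<open>w * uxx - w'' * u\<close> is the x-derivative of
  \<open>w * ux - w' * u\<close>, and the double zero of \<open>w\<close> at \<open>R\<close> leaves
  boundary terms at x = 0 only.\<close>

lemma cutoff_spatial_identity:
  fixes w w' w'' :: "real \<Rightarrow> complex"
  assumes "\<tau> \<ge> 0" "R \<ge> 0"
    and w: "\<And>x. (w has_vector_derivative w' x) (at x)" "\<And>x. (w' has_vector_derivative w'' x) (at x)"
    and w0: "w R = 0" "w' R = 0" "w 0 = 1" and cont: "continuous_on UNIV w''"
  shows "integral {0..R} (\<lambda>x. w x * (\<kappa> * u x \<tau> + \<i> * uxx x \<tau>)) =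
      integral {0..R} (\<lambda>x. (\<kappa> * w x + \<i> * w'' x) * u x \<tau>) - \<i> * (ux 0 \<tau> - w' 0 * u 0 \<tau>)"
proof -
  have wc: "continuous_on A w" for A
    using w(1) by (meson continuous_at_imp_continuous_on has_vector_derivative_continuous)
  have "((\<lambda>x. \<i> * (w x * uxx x \<tau> - w'' x * u x \<tau>)) has_integral
      \<i> * (w R * ux R \<tau> - w' R * u R \<tau>) - \<i> * (w 0 * ux 0 \<tau> - w' 0 * u 0 \<tau>)) {0..R}"
  proof (intro fundamental_theorem_of_calculus assms(2))
    fix x assume "x \<in> {0..R}"
    then have d: "((\<lambda>x. u x \<tau>) has_vector_derivative ux x \<tau>) (at x within {0..R})"
      "((\<lambda>x. ux x \<tau>) has_vector_derivative uxx x \<tau>) (at x within {0..R})"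
      using has_derivs[of x \<tau>] assms(1) by (auto intro: has_vector_derivative_within_subset)
    note dw = has_vector_derivative_at_within[OF w(1)] has_vector_derivative_at_within[OF w(2)]
    show "((\<lambda>x. \<i> * (w x * ux x \<tau> - w' x * u x \<tau>)) has_vector_derivative
        \<i> * (w x * uxx x \<tau> - w'' x * u x \<tau>)) (at x within {0..R})"
      using has_vector_derivative_mult_right[OF has_vector_derivative_diff[OF
          has_vector_derivative_mult[OF dw(1)[of x "{0..R}"] d(2)]
          has_vector_derivative_mult[OF dw(2)[of x "{0..R}"] d(1)]], of \<i>]
      by (simp add: algebra_simps)
  qed
  moreover have "((\<lambda>x. (\<kappa> * w x + \<i> * w'' x) * u x \<tau>) has_integral
      integral {0..R} (\<lambda>x. (\<kappa> * w x + \<i> * w'' x) * u x \<tau>)) {0..R}"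
    by (intro integrable_integral integrable_continuous_real continuous_intros wc continuous_space
        continuous_on_subset[OF cont]) (use assms in auto)
  ultimately have "((\<lambda>x. \<i> * (w x * uxx x \<tau> - w'' x * u x \<tau>) + (\<kappa> * w x + \<i> * w'' x) * u x \<tau>) has_integral
      (\<i> * (w R * ux R \<tau> - w' R * u R \<tau>) - \<i> * (w 0 * ux 0 \<tau> - w' 0 * u 0 \<tau>)) +
      integral {0..R} (\<lambda>x. (\<kappa> * w x + \<i> * w'' x) * u x \<tau>)) {0..R}"
    by (rule has_integral_add)
  moreover have "\<i> * (w x * uxx x \<tau> - w'' x * u x \<tau>) + (\<kappa> * w x + \<i> * w'' x) * u x \<tau> =
      w x * (\<kappa> * u x \<tau> + \<i> * uxx x \<tau>)" for x
    by (simp add: algebra_simps)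
  ultimately show ?thesis using w0 by (simp add: integral_unique algebra_simps)
qed

text \<open>On the compact interval [0,R] joint continuity of u_t justifies differentiation under
  the integral, which decay at each single time would not do on the half-line.\<close>

lemma cutoff_time_identity:
  fixes w w' w'' :: "real \<Rightarrow> complex"
  assumes st: "0 \<le> s" "s \<le> t" and "R \<ge> 0"
    and w: "\<And>x. (w has_vector_derivative w' x) (at x)" "\<And>x. (w' has_vector_derivative w'' x) (at x)"
    and w0: "w R = 0" "w' R = 0" "w 0 = 1" and cont: "continuous_on UNIV w''"
  shows "((\<lambda>\<tau>. exp (\<kappa> * \<tau>) * (integral {0..R} (\<lambda>x. (\<kappa> * w x + \<i> * w'' x) * u x \<tau>) - \<i> * (ux 0 \<tau> - w' 0 * u 0 \<tau>)))
     has_integral exp (\<kappa> * t) * integral {0..R} (\<lambda>x. w x * u x t) - exp (\<kappa> * s) * integral {0..R} (\<lambda>x. w x * u x s)) {s..t}"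
proof -
  have wc: "continuous_on A w" for A
    using w(1) by (meson continuous_at_imp_continuous_on has_vector_derivative_continuous)
  define H where "H \<tau> = integral (cbox 0 R) (\<lambda>x. exp (\<kappa> * of_real \<tau>) * (w x * u x \<tau>))" for \<tau>
  have H: "H \<tau> = exp (\<kappa> * \<tau>) * integral {0..R} (\<lambda>x. w x * u x \<tau>)" for \<tau>
    by (simp add: H_def)
  have cu: "continuous_on ({s..t} \<times> cbox 0 R) (\<lambda>p. u (snd p) (fst p))"
    "continuous_on ({s..t} \<times> cbox 0 R) (\<lambda>p. ut (snd p) (fst p))"
    using continuous_on_compose2[OF continuous(1), of "{s..t} \<times> cbox 0 R" "\<lambda>p. (snd p, fst p)"]
      continuous_on_compose2[OF continuous(4), of "{s..t} \<times> cbox 0 R" "\<lambda>p. (snd p, fst p)"] st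
    by (auto simp: continuous_intros image_subset_iff)
  have D: "(H has_vector_derivative integral (cbox 0 R)
      (\<lambda>x. exp (\<kappa> * of_real \<tau>) * (w x * (\<kappa> * u x \<tau> + ut x \<tau>)))) (at \<tau> within {s..t})" if "\<tau> \<in> {s..t}" for \<tau>
    unfolding H_def
  proof (rule leibniz_rule_vector_derivative[where fx = "\<lambda>\<tau> x. exp (\<kappa> * of_real \<tau>) * (w x * (\<kappa> * u x \<tau> + ut x \<tau>))"])
    fix \<tau> x :: real assume "\<tau> \<in> {s..t}" "x \<in> cbox 0 R"
    then have "((\<lambda>t. u x t) has_vector_derivative ut x \<tau>) (at \<tau> within {s..t})"
      using has_derivs(3)[of x \<tau>] st by (auto intro: has_vector_derivative_within_subset)
    then show "((\<lambda>\<tau>. exp (\<kappa> * of_real \<tau>) * (w x * u x \<tau>)) has_vector_derivative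
        exp (\<kappa> * of_real \<tau>) * (w x * (\<kappa> * u x \<tau> + ut x \<tau>))) (at \<tau> within {s..t})"
      by (auto intro!: derivative_eq_intros has_vector_derivative_real_field simp: algebra_simps)
  next
    show "(\<lambda>x. exp (\<kappa> * of_real \<tau>) * (w x * u x \<tau>)) integrable_on cbox 0 R" if "\<tau> \<in> {s..t}" for \<tau>
      by (intro integrable_continuous continuous_intros wc continuous_space) (use that st in auto)
    show "continuous_on ({s..t} \<times> cbox 0 R) (\<lambda>(\<tau>, x). exp (\<kappa> * of_real \<tau>) * (w x * (\<kappa> * u x \<tau> + ut x \<tau>)))"
      unfolding case_prod_unfold
      by (intro continuous_intros cu continuous_on_compose2[OF wc[of UNIV]]) auto
  qed (use that in auto)
  \<comment> \<open>The equation is known for x > 0 and t > 0 only. Hence the form of the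
    fundamental theorem that asks for derivatives in the interior, and a null set at x = 0.\<close>
  have "((\<lambda>\<tau>. exp (\<kappa> * \<tau>) * (integral {0..R} (\<lambda>x. (\<kappa> * w x + \<i> * w'' x) * u x \<tau>) - \<i> * (ux 0 \<tau> - w' 0 * u 0 \<tau>)))
     has_integral H t - H s) {s..t}"
  proof (rule fundamental_theorem_of_calculus_interior[OF st(2)])
    show "continuous_on {s..t} H"
      using D by (meson continuous_on_eq_continuous_within has_vector_derivative_continuous)
    fix \<tau> assume \<tau>: "\<tau> \<in> {s<..<t}"
    have "integral {0..R} (\<lambda>x. w x * (\<kappa> * u x \<tau> + ut x \<tau>)) = integral {0..R} (\<lambda>x. w x * (\<kappa> * u x \<tau> + \<i> * uxx x \<tau>))"
      by (rule integral_spike[of "{0}"]) (use \<tau> st schroedinger in auto)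
    also have "\<dots> = integral {0..R} (\<lambda>x. (\<kappa> * w x + \<i> * w'' x) * u x \<tau>) - \<i> * (ux 0 \<tau> - w' 0 * u 0 \<tau>)"
      using \<tau> st by (intro cutoff_spatial_identity assms) auto
    finally show "(H has_vector_derivative exp (\<kappa> * \<tau>) * (integral {0..R} (\<lambda>x. (\<kappa> * w x + \<i> * w'' x) * u x \<tau>) -
        \<i> * (ux 0 \<tau> - w' 0 * u 0 \<tau>))) (at \<tau>)"
      using D[of \<tau>] \<tau> at_within_interior[of \<tau> "{s..t}"] by simp
  qed
  then show ?thesis by (simp add: H)
qed

end

section \<open>The polynomial cutoff of the Fourier kernel and the conditional global
  relation\<close>

lemma tendsto_cutoff_fourier:
  assumes v: "decays C v" and k: "Im k \<ge> 0"
  shows "((\<lambda>R. integral {0..R} (\<lambda>x. of_real (1 - x / R) ^ 4 * exp (2 * \<i> * k * of_real x) * v x))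
     \<longlongrightarrow> half_line_fourier v k) at_top"
proof -
  let ?e = "\<lambda>x. exp (2 * \<i> * k * of_real x) * v x"
  let ?g = "\<lambda>R x. of_real (1 - x / R) ^ 4 * exp (2 * \<i> * k * of_real x) * v x"
  let ?f = "\<lambda>R x. if x \<in> {0..R} then ?g R x else 0"
  note d = decays_fourier[OF v k]
  have gi: "?g R integrable_on {0..R}" for R
  proof (rule integrable_continuous_real, cases "R = 0")
    case False
    then show "continuous_on {0..R} (?g R)"
      by (intro continuous_intros continuous_on_subset[OF decays_cont[OF v]]) auto
  qed auto
  have eq: "integral {0..} (?f R) = integral {0..R} (?g R)" for R
    using has_integral_restrict[of "{0..R}" "{0..}" "?g R"] gi[of R]
    by (metis (no_types, lifting) Icc_subset_Ici_iff order_refl has_integral_integrable_integral integral_unique)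
  have "((\<lambda>R. integral {0..} (?f R)) \<longlongrightarrow> integral {0..} ?e) at_top"
  proof (rule dominated_convergence_at_top(2))
    show "?f R integrable_on {0..}" for R
      using has_integral_restrict[of "{0..R}" "{0..}" "?g R"] gi[of R]
      by (metis (no_types, lifting) Icc_subset_Ici_iff order_refl integrable_on_def)
    show "(\<lambda>x. C / (1 + x)\<^sup>2) integrable_on {0..}"
      using has_integral_inverse_square[OF order_refl decays_nonneg[OF v]] by (auto simp: integrable_on_def)
    show "norm (?f R x) \<le> C / (1 + x)\<^sup>2" if "R \<ge> 0" "x \<in> {0..}" for R x
    proof (cases "x \<in> {0..R}")
      case True
      then have "\<bar>1 - x / R\<bar> \<le> 1" by (cases "R = 0") (auto simp: abs_le_iff divide_le_eq)
      then have "\<bar>1 - x / R\<bar> ^ 4 \<le> 1" by (intro power_le_one) auto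
      then have "norm (?g R x) \<le> 1 * norm (?e x)"
        unfolding mult.assoc norm_mult[of "of_real (1 - x / R) ^ 4"] norm_power norm_of_real
        by (rule mult_right_mono) simp
      with decays_bound[OF d, of x] that True show ?thesis by simp
    next
      case False
      have "C / (1 + x)\<^sup>2 \<ge> 0" using decays_nonneg[OF v] by simp
      then show ?thesis using False by (simp only: if_False norm_zero)
    qed
    show "((\<lambda>R. ?f R x) \<longlongrightarrow> ?e x) at_top" if "x \<in> {0..}" for x
    proof (rule Lim_transform_eventually)
      have "((\<lambda>R. 1 - x / R) \<longlongrightarrow> 1 - 0) at_top"
        by (intro tendsto_intros real_tendsto_divide_at_top[OF tendsto_const filterlim_ident])
      then have "((\<lambda>R. of_real (1 - x / R) ^ 4 * ?e x) \<longlongrightarrow> of_real (1 - 0) ^ 4 * ?e x) at_top"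
        by (intro tendsto_mult_right tendsto_power tendsto_of_real)
      then show "((\<lambda>R. of_real (1 - x / R) ^ 4 * ?e x) \<longlongrightarrow> ?e x) at_top" by simp
      show "\<forall>\<^sub>F R in at_top. of_real (1 - x / R) ^ 4 * ?e x = ?f R x"
        using eventually_ge_at_top[of x] by eventually_elim (use that in auto)
    qed
  qed
  then show ?thesis by (simp only: eq half_line_fourier_def)
qed

text \<open>Squaring min(1,\<eta>)(1+x) <= 1 + \<eta>x <= exp(\<eta>x). It converts exponential
  decay into the quadratic decay that all the estimates use.\<close>

lemma square_times_exp_le:
  fixes \<eta> x :: real
  assumes "\<eta> > 0" "x \<ge> 0"
  shows "exp (- 2 * \<eta> * x) \<le> (1 / (min 1 \<eta>)\<^sup>2) / (1 + x)\<^sup>2"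
proof -
  have m: "0 < min 1 \<eta>" using assms by (simp add: min_def)
  have "min 1 \<eta> * x \<le> \<eta> * x" using assms by (intro mult_right_mono) auto
  then have "min 1 \<eta> * (1 + x) \<le> exp (\<eta> * x)"
    using exp_ge_add_one_self[of "\<eta> * x"] min.cobounded1[of 1 \<eta>] unfolding distrib_left mult_1_right
    by linarith
  then have "(min 1 \<eta> * (1 + x))\<^sup>2 \<le> (exp (\<eta> * x))\<^sup>2"
    using m assms by (intro power_mono) auto
  also have "(exp (\<eta> * x))\<^sup>2 = exp (2 * \<eta> * x)" by (simp add: exp_double[symmetric] mult.assoc)
  finally have "(min 1 \<eta>)\<^sup>2 * (1 + x)\<^sup>2 \<le> exp (2 * \<eta> * x)" by (simp add: power_mult_distrib)
  moreover have "(min 1 \<eta>)\<^sup>2 * (1 + x)\<^sup>2 > 0" using m assms by simp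
  ultimately have "inverse (exp (2 * \<eta> * x)) \<le> inverse ((min 1 \<eta>)\<^sup>2 * (1 + x)\<^sup>2)"
    by (intro le_imp_inverse_le)
  then show ?thesis by (simp add: exp_minus divide_inverse)
qed

text \<open>The weight \<open>(1 - x/R)\<^sup>4\<close> has small derivatives and vanishes at \<open>R\<close> together with its
  first derivative, so it cuts off the Fourier kernel without boundary terms at \<open>R\<close>.\<close>

lemma cutoff_bounds:
  fixes k :: complex and R x :: real
  assumes "Im k > 0" "R \<ge> 1" "x \<in> {0..R}"
  defines "p \<equiv> of_real (1 - x / R)" and "\<rho> \<equiv> of_real R"
  shows "norm (\<i> * (12 / \<rho>\<^sup>2 * p\<^sup>2 - 16 * \<i> * k / \<rho> * p ^ 3) * exp (2 * \<i> * k * of_real x))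
      \<le> ((24 + 72 * norm k + 32 * (norm k)\<^sup>2) / (min 1 (Im k))\<^sup>2 / R) / (1 + x)\<^sup>2" (is "norm (?a * ?e) \<le> _")
    and "norm (\<i> * (- 24 / \<rho> ^ 3 * p + 48 * \<i> * k / \<rho>\<^sup>2 * p\<^sup>2 + 2 * \<i> * k * (12 / \<rho>\<^sup>2 * p\<^sup>2 - 16 * \<i> * k / \<rho> * p ^ 3))
        * exp (2 * \<i> * k * of_real x))
      \<le> ((24 + 72 * norm k + 32 * (norm k)\<^sup>2) / (min 1 (Im k))\<^sup>2 / R) / (1 + x)\<^sup>2" (is "norm (?b * _) \<le> _")
proof -
  \<comment> \<open>Collected from the second expression as 24 + 48|k| + 2|k|(12 + 16|k|); this also
    dominates the 12 + 16|k| that the first one needs.\<close>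
  let ?K = "24 + 72 * norm k + 32 * (norm k)\<^sup>2"
  have "norm p = \<bar>1 - x / R\<bar>" by (simp only: p_def norm_of_real)
  then have p: "norm p \<le> 1" using assms(2,3) by (auto simp: abs_le_iff divide_le_eq)
  then have pn: "norm p ^ n \<le> 1" for n by (intro power_le_one) auto
  have R: "1 / R ^ 2 \<le> 1 / R" "1 / R ^ 3 \<le> 1 / R"
    using assms(2) power_increasing[of 1 2 R] power_increasing[of 1 3 R] by (auto intro!: divide_left_mono)
  have e: "norm ?e \<le> (1 / (min 1 (Im k))\<^sup>2) / (1 + x)\<^sup>2"
    using square_times_exp_le[of "Im k" x] assms by (simp add: mult_ac)
  have t: "norm (12 / \<rho>\<^sup>2 * p\<^sup>2) \<le> 12 / R" "norm (16 * \<i> * k / \<rho> * p ^ 3) \<le> 16 * norm k / R"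
    "norm (- 24 / \<rho> ^ 3 * p) \<le> 24 / R" "norm (48 * \<i> * k / \<rho>\<^sup>2 * p\<^sup>2) \<le> 48 * norm k / R"
  proof -
    have "norm (12 / \<rho>\<^sup>2 * p\<^sup>2) = 12 * (1 / R ^ 2) * norm p ^ 2"
      by (simp add: norm_mult norm_divide norm_power \<rho>_def)
    also have "\<dots> \<le> 12 * (1 / R) * 1" using R pn[of 2] assms by (intro mult_mono) auto
    finally show "norm (12 / \<rho>\<^sup>2 * p\<^sup>2) \<le> 12 / R" by simp
    have "norm (16 * \<i> * k / \<rho> * p ^ 3) = 16 * norm k * (1 / R) * norm p ^ 3"
      using assms(2) by (simp add: norm_mult norm_divide norm_power \<rho>_def)
    also have "\<dots> \<le> 16 * norm k * (1 / R) * 1" using pn[of 3] assms by (intro mult_mono) auto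
    finally show "norm (16 * \<i> * k / \<rho> * p ^ 3) \<le> 16 * norm k / R" by simp
    have "norm (- 24 / \<rho> ^ 3 * p) = 24 * (1 / R ^ 3) * norm p"
      using assms(2) by (simp add: norm_mult norm_divide norm_power \<rho>_def)
    also have "\<dots> \<le> 24 * (1 / R) * 1" using R p assms by (intro mult_mono) auto
    finally show "norm (- 24 / \<rho> ^ 3 * p) \<le> 24 / R" by simp
    have "norm (48 * \<i> * k / \<rho>\<^sup>2 * p\<^sup>2) = 48 * norm k * (1 / R ^ 2) * norm p ^ 2"
      by (simp add: norm_mult norm_divide norm_power \<rho>_def)
    also have "\<dots> \<le> 48 * norm k * (1 / R) * 1" using R pn[of 2] assms by (intro mult_mono) auto
    finally show "norm (48 * \<i> * k / \<rho>\<^sup>2 * p\<^sup>2) \<le> 48 * norm k / R" by simp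
  qed
  have in1: "norm (12 / \<rho>\<^sup>2 * p\<^sup>2 - 16 * \<i> * k / \<rho> * p ^ 3) \<le> (12 + 16 * norm k) / R"
    using order_trans[OF norm_triangle_ineq4 add_mono[OF t(1,2)]] by (simp add: add_divide_distrib)
  have "(12 + 16 * norm k) / R \<le> ?K / R"
    using assms by (intro divide_right_mono) auto
  with in1 have a: "norm ?a \<le> ?K / R" by (simp add: norm_mult)
  have in2: "norm (2 * \<i> * k * (12 / \<rho>\<^sup>2 * p\<^sup>2 - 16 * \<i> * k / \<rho> * p ^ 3)) \<le> 2 * norm k * ((12 + 16 * norm k) / R)"
    using mult_left_mono[OF in1, of "2 * norm k"] unfolding norm_mult[of "2 * \<i> * k"] by (simp only: norm_mult) simp
  have "norm (- 24 / \<rho> ^ 3 * p + 48 * \<i> * k / \<rho>\<^sup>2 * p\<^sup>2 + 2 * \<i> * k * (12 / \<rho>\<^sup>2 * p\<^sup>2 - 16 * \<i> * k / \<rho> * p ^ 3))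
      \<le> 24 / R + 48 * norm k / R + 2 * norm k * ((12 + 16 * norm k) / R)"
    by (rule norm_triangle_mono[OF norm_triangle_mono[OF t(3,4)] in2])
  also have "\<dots> = ?K / R" by (simp add: add_divide_distrib power2_eq_square algebra_simps)
  finally have b: "norm ?b \<le> ?K / R" by (simp add: norm_mult)
  have *: "norm (c * ?e) \<le> (?K / (min 1 (Im k))\<^sup>2 / R) / (1 + x)\<^sup>2" if "norm c \<le> ?K / R" for c
  proof -
    have "norm (c * ?e) \<le> (?K / R) * ((1 / (min 1 (Im k))\<^sup>2) / (1 + x)\<^sup>2)"
      unfolding norm_mult by (rule mult_mono[OF that e]) (use assms in auto)
    then show ?thesis by (simp add: field_simps)
  qed
  show "norm (?a * ?e) \<le> (?K / (min 1 (Im k))\<^sup>2 / R) / (1 + x)\<^sup>2" by (rule *[OF a])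
  show "norm (?b * ?e) \<le> (?K / (min 1 (Im k))\<^sup>2 / R) / (1 + x)\<^sup>2" by (rule *[OF b])
qed

context quarter_plane_solution begin

text \<open>The cutoff violates the relation by an error that is of order 1/R for each test
  function, but u(.,\<tau>) must be paired with it for all \<tau> in [s,t]. The hypothesis
  \<open>M\<close> makes the Parseval bound uniform in \<tau>, so the time integral of the error is
  still of order 1/R.\<close>

lemma global_relation_upper:
  assumes st: "0 \<le> s" "s \<le> t" and k: "Im k > 0"
    and M: "\<And>r l::real. r \<in> {s..t} \<Longrightarrow> (1 + \<bar>l\<bar>) * norm (hat r (of_real l)) \<le> M"
  shows "global_relation s t k"
proof -
  let ?f = "dispersion k"
  define K where "K = (24 + 72 * norm k + 32 * (norm k)\<^sup>2) / (min 1 (Im k))\<^sup>2"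
  define e where "e x = exp (2 * \<i> * k * of_real x)" for x
  define p where "p R x = complex_of_real (1 - x / R)" for R x
  define w where "w R x = p R x ^ 4 * e x" for R x
  define w' where "w' R x = (- 4 / of_real R * p R x ^ 3 + 2 * \<i> * k * p R x ^ 4) * e x" for R x
  define w'' where "w'' R x = (12 / (of_real R)\<^sup>2 * p R x ^ 2 - 16 * \<i> * k / of_real R * p R x ^ 3
      + (2 * \<i> * k)\<^sup>2 * p R x ^ 4) * e x" for R x
  \<comment> \<open>This is f(k) w + i w''. As i(2ik)^2 = -f(k), the terms of order one cancel, and
    each remaining term carries at least one factor 1/R.\<close>
  define \<psi> where "\<psi> R x = \<i> * (12 / (of_real R)\<^sup>2 * (p R x)\<^sup>2 - 16 * \<i> * k / of_real R * p R x ^ 3) * e x" for R x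
  define \<psi>' where "\<psi>' R x = \<i> * (- 24 / of_real R ^ 3 * p R x + 48 * \<i> * k / (of_real R)\<^sup>2 * (p R x)\<^sup>2
     + 2 * \<i> * k * (12 / (of_real R)\<^sup>2 * (p R x)\<^sup>2 - 16 * \<i> * k / of_real R * p R x ^ 3)) * e x" for R x
  have e': "(e has_vector_derivative 2 * \<i> * k * e x) (at x within A)" for x A
    unfolding e_def by (rule has_vector_derivative_real_field) (auto intro!: derivative_eq_intros)
  have p': "((\<lambda>x. p R x ^ n) has_vector_derivative of_nat n * p R x ^ (n - 1) * (- 1 / of_real R)) (at x within A)"
    if "R \<noteq> 0" for R x A n
  proof -
    have "((\<lambda>z. (1 - z / of_real R) ^ n) has_field_derivative
       of_nat n * (1 - of_real x / of_real R) ^ (n - 1) * (- 1 / of_real R)) (at (of_real x))"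
      using that by (auto intro!: derivative_eq_intros)
    from has_vector_derivative_real_field[OF this] show ?thesis by (simp add: p_def)
  qed
  have ce: "continuous_on A e" for A by (auto simp: e_def intro!: continuous_intros)
  have cp: "continuous_on A (p R)" if "R \<noteq> 0" for A R
    unfolding p_def using that by (intro continuous_intros) auto
  have w1: "(w R has_vector_derivative w' R x) (at x)" if "R \<noteq> 0" for R x
    unfolding w_def[abs_def] w'_def
    by (rule has_vector_derivative_eq_rhs[OF has_vector_derivative_mult[OF p'[OF that] e']])
      (simp add: algebra_simps)
  have w2: "(w' R has_vector_derivative w'' R x) (at x)" if "R \<noteq> 0" for R x
    unfolding w'_def[abs_def] w''_def
    by (rule has_vector_derivative_eq_rhs[OF has_vector_derivative_mult[OF has_vector_derivative_add[OF
       has_vector_derivative_mult_right[OF p'[OF that]] has_vector_derivative_mult_right[OF p'[OF that]]] e']])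
      (simp add: algebra_simps power2_eq_square)
  have \<psi>1: "(\<psi> R has_vector_derivative \<psi>' R x) (at x within A)" if "R \<noteq> 0" for R x A
    unfolding \<psi>_def[abs_def] \<psi>'_def
    by (rule has_vector_derivative_eq_rhs[OF has_vector_derivative_mult[OF has_vector_derivative_mult_right[OF has_vector_derivative_diff[OF
       has_vector_derivative_mult_right[OF p'[OF that]] has_vector_derivative_mult_right[OF p'[OF that]]]] e']])
      (simp add: algebra_simps power2_eq_square power3_eq_cube)
  have \<psi>w: "?f * w R x + \<i> * w'' R x = \<psi> R x" for R x
    by (simp add: dispersion_def w_def w''_def \<psi>_def algebra_simps power2_eq_square)
  have w0: "w R R = 0" "w' R R = 0" "w R 0 = 1" "w' R 0 = 2 * \<i> * k - 4 / of_real R" if "R \<noteq> 0" for R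
    using that by (simp_all add: w_def w'_def p_def e_def)
  have cw: "continuous_on UNIV (w'' R)" if "R \<noteq> 0" for R
    unfolding w''_def by (intro continuous_intros ce cp[OF that])
  have pv: "norm (integral {0..R} (\<lambda>x. \<psi> R x * u x \<tau>)) \<le> 3 * (K / R) * M" if R: "R \<ge> 1" and \<tau>: "\<tau> \<in> {s..t}" for R \<tau>
  proof -
    have \<tau>0: "\<tau> \<ge> 0" using \<tau> st by simp
    from R have R0: "R \<noteq> 0" by simp
    obtain C where C: "decays C (\<lambda>x. u x \<tau>)" "decays C (\<lambda>x. ux x \<tau>)" using solution_decays[OF \<tau>0] .
    show ?thesis
    proof (rule parseval_bound[OF C])
      show "((\<lambda>x. u x \<tau>) has_vector_derivative ux x \<tau>) (at x within {0..})" if "x \<ge> 0" for x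
        by (rule has_derivs[OF that \<tau>0])
      show "(1 + \<bar>l\<bar>) * norm (half_line_fourier (\<lambda>x. u x \<tau>) (of_real l)) \<le> M" for l
        using M[OF \<tau>] by (simp add: hat_def)
      show "continuous_on {0..R} (\<psi>' R)"
        unfolding \<psi>'_def by (intro continuous_intros ce cp[OF R0])
      show "norm (\<psi> R x) \<le> K / R / (1 + x)\<^sup>2" "norm (\<psi>' R x) \<le> K / R / (1 + x)\<^sup>2" if "x \<in> {0..R}" for x
        using cutoff_bounds[OF k R that] by (simp_all only: \<psi>_def \<psi>'_def p_def e_def K_def)
    qed (use \<psi>1 R0 R in auto)
  qed
  have c0: "continuous_on {s..t} (\<lambda>\<tau>. u 0 \<tau>)" using st by (intro continuous_time) auto
  obtain U where U: "\<And>\<tau>. \<tau> \<in> {s..t} \<Longrightarrow> norm (u 0 \<tau>) \<le> U"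
    using compact_imp_bounded[OF compact_continuous_image[OF c0 compact_Icc]] unfolding bounded_iff by blast
  let ?B = "integral {s..t} (\<lambda>\<tau>. exp (?f * \<tau>) * bdry k \<tau>)"
  \<comment> \<open>The defect of the relation for the cutoff transform. It is the time integral of
    the \<psi>-pairing and of -(4i/R) u(0,\<tau>), the latter because w'(0) = 2ik - 4/R deviates
    from 2ik.\<close>
  define L where "L R = exp (?f * t) * integral {0..R} (\<lambda>x. w R x * u x t) - exp (?f * s) * integral {0..R} (\<lambda>x. w R x * u x s) + ?B" for R
  have bB: "((\<lambda>\<tau>. exp (?f * \<tau>) * bdry k \<tau>) has_integral ?B) {s..t}"
    by (intro integrable_integral integrable_continuous_real continuous_intros continuous_bdry) (use st in auto)
  have LR: "norm (L R) \<le> (exp (norm ?f * t) * (3 * K * M + 4 * U) * (t - s)) / R" if "R \<ge> 1" for R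
  proof -
    from that have R0: "R \<noteq> 0" "R \<ge> 0" by auto
    let ?h = "\<lambda>\<tau>. exp (?f * \<tau>) * (integral {0..R} (\<lambda>x. \<psi> R x * u x \<tau>) - 4 * \<i> / of_real R * u 0 \<tau>)"
    have "((\<lambda>\<tau>. exp (?f * \<tau>) * (integral {0..R} (\<lambda>x. (?f * w R x + \<i> * w'' R x) * u x \<tau>) - \<i> * (ux 0 \<tau> - w' R 0 * u 0 \<tau>))
        + exp (?f * \<tau>) * bdry k \<tau>) has_integral L R) {s..t}"
      unfolding L_def
      by (intro has_integral_add bB cutoff_time_identity st R0 w1 w2 w0 cw)
    also have "(\<lambda>\<tau>. exp (?f * \<tau>) * (integral {0..R} (\<lambda>x. (?f * w R x + \<i> * w'' R x) * u x \<tau>) - \<i> * (ux 0 \<tau> - w' R 0 * u 0 \<tau>))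
        + exp (?f * \<tau>) * bdry k \<tau>) = ?h"
      by (simp only: \<psi>w w0(4)[OF R0(1)]) (simp add: bdry_def fun_eq_iff algebra_simps)
    finally have h: "(?h has_integral L R) (cbox s t)" by simp
    have hb: "norm (?h \<tau>) \<le> exp (norm ?f * t) * ((3 * K * M + 4 * U) / R)" if \<tau>: "\<tau> \<in> {s..t}" for \<tau>
    proof -
      have "Re (?f * of_real \<tau>) \<le> norm ?f * t"
        using order_trans[OF complex_Re_le_cmod, of "?f * of_real \<tau>" "norm ?f * t"] \<tau> st
        by (simp add: norm_mult mult_left_mono)
      then have 1: "norm (exp (?f * \<tau>)) \<le> exp (norm ?f * t)" by simp
      have "norm (4 * \<i> / of_real R * u 0 \<tau>) \<le> 4 * U / R"
        using U[OF \<tau>] R0 by (simp add: norm_mult norm_divide divide_right_mono)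
      from order_trans[OF norm_triangle_ineq4 add_mono[OF pv[OF \<open>R \<ge> 1\<close> \<tau>] this]]
      have 2: "norm (integral {0..R} (\<lambda>x. \<psi> R x * u x \<tau>) - 4 * \<i> / of_real R * u 0 \<tau>) \<le> (3 * K * M + 4 * U) / R"
        by (simp add: add_divide_distrib)
      show ?thesis unfolding norm_mult[of "exp _"] by (rule mult_mono[OF 1 2]) auto
    qed
    have "0 \<le> norm (?h s)" by simp
    also have "\<dots> \<le> exp (norm ?f * t) * ((3 * K * M + 4 * U) / R)" using st by (intro hb) auto
    finally have "norm (L R) \<le> exp (norm ?f * t) * ((3 * K * M + 4 * U) / R) * measure lborel (cbox s t)"
      by (intro has_integral_bound[OF _ h]) (use hb in auto)
    then show ?thesis using st by simp
  qed
  obtain C1 where C1: "decays C1 (\<lambda>x. u x t)" using solution_decays[of t] st by auto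
  obtain C2 where C2: "decays C2 (\<lambda>x. u x s)" using solution_decays[of s] st by auto
  have "(L \<longlongrightarrow> exp (?f * t) * hat t k - exp (?f * s) * hat s k + ?B) at_top"
    unfolding L_def[abs_def] hat_def w_def p_def e_def
    by (intro tendsto_intros tendsto_cutoff_fourier[OF C1] tendsto_cutoff_fourier[OF C2]) (use k in auto)
  moreover have "(L \<longlongrightarrow> 0) at_top"
    by (rule Lim_null_comparison[OF eventually_mono[OF eventually_ge_at_top[of 1] LR]
          real_tendsto_divide_at_top[OF tendsto_const filterlim_ident]])
  ultimately have "exp (?f * t) * hat t k - exp (?f * s) * hat s k + ?B = 0"
    by (intro tendsto_unique[OF trivial_limit_at_top_linorder])
  then show ?thesis by (simp add: global_relation_def eq_neg_iff_add_eq_0)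
qed


lemma hat_continuous: "t \<ge> 0 \<Longrightarrow> continuous_on {k. Im k \<ge> 0} (hat t)"
  using solution_decays[of t] half_line_fourier_continuous unfolding hat_def by metis

text \<open>The cutoff needs the exponential decay of exp(2ikx), hence Im k > 0, whereas the
  supremum to be propagated lives on the real axis. Both sides are continuous up to that axis and
  the hypothesis \<open>M\<close> does not refer to k, so approaching along k + i/(n+1)
  suffices.\<close>

lemma global_relation_closed_upper:
  assumes st: "0 \<le> s" "s \<le> t" and k: "Im k \<ge> 0"
    and M: "\<And>r l::real. r \<in> {s..t} \<Longrightarrow> (1 + \<bar>l\<bar>) * norm (hat r (of_real l)) \<le> M"
  shows "global_relation s t k"
proof -
  let ?D = "\<lambda>k. exp (dispersion k * t) * hat t k - exp (dispersion k * s) * hat s k +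
     integral {s..t} (\<lambda>\<tau>. exp (dispersion k * \<tau>) * bdry k \<tau>)"
  define X where "X n = k + \<i> * of_real (1 / Suc n)" for n
  have X: "Im (X n) > 0" for n using k by (simp add: X_def add_nonneg_pos)
  have "(\<lambda>n. 1 / real (Suc n)) \<longlonglongrightarrow> 0" by (rule lim_1_over_n[THEN LIMSEQ_Suc])
  then have "X \<longlonglongrightarrow> k + \<i> * of_real 0"
    unfolding X_def[abs_def] by (intro tendsto_intros)
  then have lim: "X \<longlonglongrightarrow> k" by simp
  have c2: "continuous_on ({k. Im k \<ge> 0} \<times> cbox s t) (\<lambda>(k, \<tau>). exp (dispersion k * of_real \<tau>) * bdry k \<tau>)"
    unfolding case_prod_unfold dispersion_def bdry_def
    by (intro continuous_intros continuous_on_compose2[OF continuous_time(1)[of 0 "{0..}"]]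
        continuous_on_compose2[OF continuous_time(2)[of 0 "{0..}"]]) (use st in auto)
  have cont: "continuous_on {k. Im k \<ge> 0} ?D"
    using integral_continuous_on_param[OF c2] st
    by (intro continuous_intros hat_continuous) (auto simp: dispersion_def intro!: continuous_intros)
  have "(\<lambda>n. ?D (X n)) \<longlonglongrightarrow> ?D k"
    by (rule continuous_on_tendsto_compose[OF cont lim]) (use k X in \<open>auto simp: less_imp_le\<close>)
  moreover have "?D (X n) = 0" for n
    using global_relation_upper[OF st X M] by (simp add: global_relation_def)
  ultimately have "(\<lambda>n. 0) \<longlonglongrightarrow> ?D k" by simp
  from LIMSEQ_unique[OF this tendsto_const] have "?D k = 0" .
  then show ?thesis by (simp add: global_relation_def eq_neg_iff_add_eq_0)
qed

section \<open>Decay in k of the time transforms of the boundary values\<close>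

lemma bounded_on_time_interval:
  assumes "continuous_on {0..T} h"
  obtains A where "\<And>\<tau>::real. \<tau> \<in> {0..T} \<Longrightarrow> norm (h \<tau> :: complex) \<le> A"
  using compact_imp_bounded[OF compact_continuous_image[OF assms compact_Icc]] unfolding bounded_iff by blast

definition bdry' :: "complex \<Rightarrow> real \<Rightarrow> complex" where
  "bdry' k \<tau> = \<i> * uxt 0 \<tau> + 2 * k * ut 0 \<tau>"

lemma boundary_data_bound:
  fixes T :: real
  shows "\<exists>A\<ge>0. \<forall>k. \<forall>\<tau>\<in>{0..T}. norm (bdry k \<tau>) \<le> A * (1 + 2 * norm k) \<and> norm (bdry' k \<tau>) \<le> A * (1 + 2 * norm k)"
proof -
  have sub: "{0..T} \<subseteq> {0..}" by auto
  obtain A1 A2 A3 A4 where A: "\<And>\<tau>. \<tau> \<in> {0..T} \<Longrightarrow> norm (u 0 \<tau>) \<le> A1" "\<And>\<tau>. \<tau> \<in> {0..T} \<Longrightarrow> norm (ux 0 \<tau>) \<le> A2"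
    "\<And>\<tau>. \<tau> \<in> {0..T} \<Longrightarrow> norm (ut 0 \<tau>) \<le> A3" "\<And>\<tau>. \<tau> \<in> {0..T} \<Longrightarrow> norm (uxt 0 \<tau>) \<le> A4"
    using bounded_on_time_interval[OF continuous_time(1)[OF order_refl sub]]
      bounded_on_time_interval[OF continuous_time(2)[OF order_refl sub]]
      bounded_on_time_interval[OF continuous_time(3)[OF order_refl sub]]
      bounded_on_time_interval[OF continuous_time(4)[OF order_refl sub]] by metis
  define A where "A = \<bar>A1\<bar> + \<bar>A2\<bar> + \<bar>A3\<bar> + \<bar>A4\<bar>"
  have *: "norm (\<i> * p + 2 * k * q) \<le> A * (1 + 2 * norm k)" if "norm p \<le> A" "norm q \<le> A" for p q k
  proof -
    have "norm (\<i> * p + 2 * k * q) \<le> norm p + 2 * norm k * norm q"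
      using norm_triangle_ineq[of "\<i> * p" "2 * k * q"] by (simp add: norm_mult)
    also have "\<dots> \<le> A + 2 * norm k * A" using that by (intro add_mono mult_left_mono) auto
    finally show ?thesis by (simp add: algebra_simps)
  qed
  show ?thesis
  proof (intro exI[of _ A] conjI allI ballI)
    show "A \<ge> 0" by (simp add: A_def)
    fix k \<tau> assume t: "\<tau> \<in> {0..T}"
    show "norm (bdry k \<tau>) \<le> A * (1 + 2 * norm k)"
      unfolding bdry_def using A[OF t] by (intro *) (auto simp: A_def)
    show "norm (bdry' k \<tau>) \<le> A * (1 + 2 * norm k)"
      unfolding bdry'_def using A[OF t] by (intro *) (auto simp: A_def)
  qed
qed

text \<open>For Re f(k) >= 0 the factor exp(f(k)(\<tau> - t)) is at most 1 in modulus. Integrating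
  by parts in \<tau> divides by |f(k)| = 4|k|^2, against a growth of the data linear in |k|; this
  leaves 1/|k|. The constant sees only the boundary values on [0,T], as the propagation in time
  demands.\<close>

lemma boundary_transform_decay:
  fixes T :: real
  shows "\<exists>C\<ge>0. \<forall>s t k. 0 \<le> s \<and> s \<le> t \<and> t \<le> T \<and> Re (dispersion k) \<ge> 0 \<longrightarrow>
    (1 + norm k) * norm (integral {s..t} (\<lambda>\<tau>. exp (dispersion k * of_real (\<tau> - t)) * bdry k \<tau>)) \<le> C"
proof -
  obtain A where A: "A \<ge> 0" "\<And>k \<tau>. \<tau> \<in> {0..T} \<Longrightarrow> norm (bdry k \<tau>) \<le> A * (1 + 2 * norm k)"
    "\<And>k \<tau>. \<tau> \<in> {0..T} \<Longrightarrow> norm (bdry' k \<tau>) \<le> A * (1 + 2 * norm k)"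
    using boundary_data_bound[of T] by metis
  \<comment> \<open>For |k| > 1 the two endpoint terms and the integral add up to A(1 + 2|k|)(2 +
    T), and 3A(2 + |T|) would do. The crude estimate for |k| <= 1, with 1 + |k| <= 2, doubles this
    to 6A(2 + |T|).\<close>
  have *: "(1 + norm k) * norm (integral {s..t} (\<lambda>\<tau>. exp (dispersion k * of_real (\<tau> - t)) * bdry k \<tau>)) \<le> 6 * A * (2 + \<bar>T\<bar>)"
    if st: "0 \<le> s" "s \<le> t" "t \<le> T" and f: "Re (dispersion k) \<ge> 0" for s t k
  proof -
    let ?f = "dispersion k"
    let ?e = "\<lambda>\<tau>. exp (?f * of_real (\<tau> - t))"
    let ?I = "integral {s..t} (\<lambda>\<tau>. ?e \<tau> * bdry k \<tau>)"
    have e: "norm (?e \<tau>) \<le> 1" if "\<tau> \<in> {s..t}" for \<tau>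
      using that f by (simp add: mult_nonneg_nonpos)
    have sub: "{s..t} \<subseteq> {0..}" using st by auto
    have bd: "norm (integral {s..t} (\<lambda>\<tau>. ?e \<tau> * h \<tau>)) \<le> A * (1 + 2 * norm k) * T"
      if "continuous_on {s..t} h" "\<And>\<tau>. \<tau> \<in> {0..T} \<Longrightarrow> norm (h \<tau>) \<le> A * (1 + 2 * norm k)" for h
    proof -
      have "norm (integral {s..t} (\<lambda>\<tau>. ?e \<tau> * h \<tau>)) \<le> (1 * (A * (1 + 2 * norm k))) * (t - s)"
      proof (rule integral_bound[OF st(2)])
        show "continuous_on {s..t} (\<lambda>\<tau>. ?e \<tau> * h \<tau>)" by (intro continuous_intros that)
        fix \<tau> assume "\<tau> \<in> {s..t}"
        then show "norm (?e \<tau> * h \<tau>) \<le> 1 * (A * (1 + 2 * norm k))"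
          unfolding norm_mult[of "?e \<tau>"] using st by (intro mult_mono e that) auto
      qed
      also have "\<dots> \<le> (1 * (A * (1 + 2 * norm k))) * T" using st A(1) by (intro mult_left_mono) auto
      finally show ?thesis by simp
    qed
    have cb': "continuous_on {s..t} (bdry' k)"
      unfolding bdry'_def using sub by (intro continuous_intros continuous_time) auto
    show ?thesis
    proof (cases "norm k \<le> 1")
      case True
      have "norm ?I \<le> A * (1 + 2 * norm k) * T" by (rule bd[OF continuous_bdry[OF sub] A(2)])
      also have "\<dots> \<le> A * 3 * (2 + \<bar>T\<bar>)" using True A(1) st by (intro mult_mono) auto
      finally have "(1 + norm k) * norm ?I \<le> 2 * (A * 3 * (2 + \<bar>T\<bar>))" using True by (intro mult_mono) auto
      then show ?thesis by simp
    next
      case False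
      then have k: "norm k > 1" by simp
      have f0: "?f \<noteq> 0" and fn: "norm ?f = 4 * norm k * norm k"
        using k by (auto simp: dispersion_def norm_mult norm_power power2_eq_square)
      have "((\<lambda>\<tau>. ?e \<tau> * (?f * bdry k \<tau>) + ?e \<tau> * bdry' k \<tau>) has_integral ?e t * bdry k t - ?e s * bdry k s) {s..t}"
      proof (rule fundamental_theorem_of_calculus[OF st(2)])
        fix \<tau> assume \<tau>: "\<tau> \<in> {s..t}"
        have d: "((\<lambda>\<tau>. u 0 \<tau>) has_vector_derivative ut 0 \<tau>) (at \<tau> within {s..t})"
          "((\<lambda>\<tau>. ux 0 \<tau>) has_vector_derivative uxt 0 \<tau>) (at \<tau> within {s..t})"
          using has_derivs(3,4)[of 0 \<tau>] \<tau> st by (auto intro: has_vector_derivative_within_subset)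
        have d1: "(bdry k has_vector_derivative bdry' k \<tau>) (at \<tau> within {s..t})"
          unfolding bdry_def[abs_def] bdry'_def
          by (intro has_vector_derivative_add has_vector_derivative_mult_right d)
        have d2: "(?e has_vector_derivative ?e \<tau> * ?f) (at \<tau> within {s..t})"
          unfolding of_real_diff by (rule has_vector_derivative_real_field) (auto intro!: derivative_eq_intros)
        show "((\<lambda>\<tau>. ?e \<tau> * bdry k \<tau>) has_vector_derivative ?e \<tau> * (?f * bdry k \<tau>) + ?e \<tau> * bdry' k \<tau>)
            (at \<tau> within {s..t})"
          by (rule has_vector_derivative_eq_rhs[OF has_vector_derivative_mult[OF d2 d1]]) (simp add: algebra_simps)
      qed
      moreover have "((\<lambda>\<tau>. ?e \<tau> * (?f * bdry k \<tau>) + ?e \<tau> * bdry' k \<tau>) has_integral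
          ?f * ?I + integral {s..t} (\<lambda>\<tau>. ?e \<tau> * bdry' k \<tau>)) {s..t}"
      proof (rule has_integral_add)
        have "((\<lambda>\<tau>. ?f * (?e \<tau> * bdry k \<tau>)) has_integral ?f * ?I) {s..t}"
          by (intro has_integral_mult_right integrable_integral integrable_continuous_real continuous_intros continuous_bdry[OF sub])
        then show "((\<lambda>\<tau>. ?e \<tau> * (?f * bdry k \<tau>)) has_integral ?f * ?I) {s..t}" by (simp add: mult_ac)
        show "((\<lambda>\<tau>. ?e \<tau> * bdry' k \<tau>) has_integral integral {s..t} (\<lambda>\<tau>. ?e \<tau> * bdry' k \<tau>)) {s..t}"
          by (intro integrable_integral integrable_continuous_real continuous_intros cb')
      qed
      ultimately have "?e t * bdry k t - ?e s * bdry k s = ?f * ?I + integral {s..t} (\<lambda>\<tau>. ?e \<tau> * bdry' k \<tau>)"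
        by (rule has_integral_unique)
      then have "?f * ?I = ?e t * bdry k t - (?e s * bdry k s + integral {s..t} (\<lambda>\<tau>. ?e \<tau> * bdry' k \<tau>))"
        by (simp add: algebra_simps)
      then have "norm (?f * ?I) \<le> norm (?e t * bdry k t) + (norm (?e s * bdry k s) + norm (integral {s..t} (\<lambda>\<tau>. ?e \<tau> * bdry' k \<tau>)))"
        by (simp only:) (rule order_trans[OF norm_triangle_ineq4 add_left_mono[OF norm_triangle_ineq]])
      moreover have bk: "norm (?e \<tau> * bdry k \<tau>) \<le> 1 * (A * (1 + 2 * norm k))" if "\<tau> \<in> {s..t}" for \<tau>
        unfolding norm_mult[of "?e \<tau>"] using st that by (intro mult_mono e A) auto
      moreover have "t \<in> {s..t}" "s \<in> {s..t}" using st by auto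
      moreover have "A * (1 + 2 * norm k) * (2 + T) = A * (1 + 2 * norm k) * T + 2 * (A * (1 + 2 * norm k))"
        by (simp add: algebra_simps)
      ultimately have "norm (?f * ?I) \<le> A * (1 + 2 * norm k) * (2 + T)"
        using bd[OF cb' A(3)] bk[of t] bk[of s] unfolding mult_1 by linarith
      also have "\<dots> \<le> A * (3 * norm k) * (2 + \<bar>T\<bar>)"
        using k A(1) st by (intro mult_mono) auto
      finally have "norm k * (4 * norm k * norm ?I) \<le> norm k * (3 * A * (2 + \<bar>T\<bar>))"
        by (simp add: norm_mult fn mult_ac)
      then have "4 * norm k * norm ?I \<le> 3 * A * (2 + \<bar>T\<bar>)"
        by (rule mult_left_le_imp_le) (use k in linarith)
      moreover have "(1 + norm k) * norm ?I \<le> (4 * norm k) * norm ?I" using k by (intro mult_right_mono) auto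
      moreover have "3 * A * (2 + \<bar>T\<bar>) \<le> 6 * A * (2 + \<bar>T\<bar>)" using A(1) by (intro mult_right_mono) auto
      ultimately show ?thesis by linarith
    qed
  qed
  show ?thesis
    by (rule exI[of _ "6 * A * (2 + \<bar>T\<bar>)"]) (use A(1) * in \<open>simp del: integral_mult_left\<close>)
qed

section \<open>Propagation in time of the weighted supremum Q of the overview\<close>

definition hat_sup :: "real \<Rightarrow> real" where
  "hat_sup t = (SUP l::real. (1 + \<bar>l\<bar>) * norm (hat t (of_real l)))"

lemma hat_sup_bound_decays:
  assumes "t \<ge> 0" "decays C (\<lambda>x. u x t)" "decays C (\<lambda>x. ux x t)" "Im k \<ge> 0"
  shows "(1 + norm k) * norm (hat t k) \<le> 2 * C"
  unfolding hat_def using half_line_fourier_bound[OF assms(2,3) has_derivs(1)[OF _ assms(1)] assms(4)] .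

lemma le_hat_sup:
  assumes "t \<ge> 0"
  shows "(1 + \<bar>l\<bar>) * norm (hat t (of_real l)) \<le> hat_sup t"
proof -
  obtain C where C: "decays C (\<lambda>x. u x t)" "decays C (\<lambda>x. ux x t)" using solution_decays[OF assms] by blast
  have "(1 + \<bar>l\<bar>) * norm (hat t (of_real l)) \<le> 2 * C" for l
    using hat_sup_bound_decays[OF assms C, of "of_real l"] by simp
  then show ?thesis unfolding hat_sup_def by (intro cSUP_upper) (auto intro!: bdd_aboveI2)
qed

text \<open>For real k the factors exp(f(k)t) have modulus one, so by the global relation
  |\<open>hat s k\<close>| and |\<open>hat t k\<close>| differ by at most the modulus of the
  boundary transform. The bound m only licenses the relation and leaves no trace in
  \<open>C\<close>.\<close>

lemma hat_sup_step:
  fixes T :: real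
  shows "\<exists>C. \<forall>s t m. 0 \<le> s \<and> s \<le> t \<and> t \<le> T \<and> (\<forall>r\<in>{s..t}. hat_sup r \<le> m) \<longrightarrow> \<bar>hat_sup s - hat_sup t\<bar> \<le> C"
proof -
  obtain C where C: "C \<ge> 0" "\<And>s t k. 0 \<le> s \<Longrightarrow> s \<le> t \<Longrightarrow> t \<le> T \<Longrightarrow> Re (dispersion k) \<ge> 0 \<Longrightarrow>
    (1 + norm k) * norm (integral {s..t} (\<lambda>\<tau>. exp (dispersion k * of_real (\<tau> - t)) * bdry k \<tau>)) \<le> C"
    using boundary_transform_decay[of T] by metis
  have "\<bar>hat_sup s - hat_sup t\<bar> \<le> C"
    if st: "0 \<le> s" "s \<le> t" "t \<le> T" and m: "\<And>r. r \<in> {s..t} \<Longrightarrow> hat_sup r \<le> m" for s t m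
  proof -
    have *: "\<bar>(1 + \<bar>l\<bar>) * norm (hat s (of_real l)) - (1 + \<bar>l\<bar>) * norm (hat t (of_real l))\<bar> \<le> C" for l
    proof -
      let ?k = "of_real l"
      have R: "Re (dispersion ?k) = 0" by (simp add: dispersion_def power2_eq_square)
      have ne: "norm (exp (dispersion ?k * of_real r)) = 1" for r by (simp add: R)
      have "global_relation s t ?k"
        by (rule global_relation_closed_upper[OF st(1,2), of _ m])
          (use st in \<open>auto intro!: order_trans[OF le_hat_sup m]\<close>)
      then have g: "exp (dispersion ?k * t) * hat t ?k - exp (dispersion ?k * s) * hat s ?k =
        - integral {s..t} (\<lambda>\<tau>. exp (dispersion ?k * \<tau>) * bdry ?k \<tau>)"
        by (simp add: global_relation_def)
      have E: "exp (dispersion ?k * of_real \<tau>) * bdry ?k \<tau> =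
          exp (dispersion ?k * of_real t) * (exp (dispersion ?k * of_real (\<tau> - t)) * bdry ?k \<tau>)" for \<tau>
        by (simp add: mult.assoc[symmetric] exp_add[symmetric] algebra_simps)
      have "integral {s..t} (\<lambda>\<tau>. exp (dispersion ?k * \<tau>) * bdry ?k \<tau>) = exp (dispersion ?k * of_real t) *
          integral {s..t} (\<lambda>\<tau>. exp (dispersion ?k * of_real (\<tau> - t)) * bdry ?k \<tau>)"
        unfolding E by (rule integral_mult_right)
      then have "norm (integral {s..t} (\<lambda>\<tau>. exp (dispersion ?k * \<tau>) * bdry ?k \<tau>)) =
          norm (integral {s..t} (\<lambda>\<tau>. exp (dispersion ?k * of_real (\<tau> - t)) * bdry ?k \<tau>))"
        by (simp only: norm_mult[of "exp _"] ne mult_1)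
      with g have n: "norm (exp (dispersion ?k * t) * hat t ?k - exp (dispersion ?k * s) * hat s ?k) =
          norm (integral {s..t} (\<lambda>\<tau>. exp (dispersion ?k * of_real (\<tau> - t)) * bdry ?k \<tau>))" by simp
      have "\<bar>norm (hat t ?k) - norm (hat s ?k)\<bar> \<le> norm (exp (dispersion ?k * t) * hat t ?k - exp (dispersion ?k * s) * hat s ?k)"
        using norm_triangle_ineq3[of "exp (dispersion ?k * t) * hat t ?k" "exp (dispersion ?k * s) * hat s ?k"]
        by (simp only: norm_mult ne mult_1)
      then have "(1 + \<bar>l\<bar>) * \<bar>norm (hat t ?k) - norm (hat s ?k)\<bar> \<le> C"
        using C(2)[OF st, of ?k] R n by (auto intro: order_trans[OF mult_left_mono])
      then show ?thesis
        by (simp add: right_diff_distrib[symmetric] abs_mult abs_minus_commute)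
    qed
    have "hat_sup s \<le> hat_sup t + C"
      unfolding hat_sup_def[of s]
    proof (rule cSUP_least)
      fix l :: real
      show "(1 + \<bar>l\<bar>) * norm (hat s (of_real l)) \<le> hat_sup t + C"
        using *[of l] le_hat_sup[of t l] st by linarith
    qed simp
    moreover have "hat_sup t \<le> hat_sup s + C"
      unfolding hat_sup_def[of t]
    proof (rule cSUP_least)
      fix l :: real
      show "(1 + \<bar>l\<bar>) * norm (hat t (of_real l)) \<le> hat_sup s + C"
        using *[of l] le_hat_sup[of s l] st by linarith
    qed simp
    ultimately show ?thesis by linarith
  qed
  then show ?thesis by blast
qed

lemma hat_sup_locally_bounded:
  assumes "T \<ge> 0"
  obtains m where "\<And>r. r \<in> {0..T} \<Longrightarrow> hat_sup r \<le> m"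
proof -
  \<comment> \<open>\<open>hat_sup\<close> has no evident continuity in time, so pointwise bounds in
    x are used instead: each is a closed condition on t because u and u_x are continuous in t. The
    derivative is included since the bound on the transform integrates by parts once.\<close>
  define E where "E n = {t. t \<ge> 0 \<and> (\<forall>x\<in>{0..}. norm (u x t) \<le> real n / (1 + x)\<^sup>2 \<and> norm (ux x t) \<le> real n / (1 + x)\<^sup>2)}" for n
  show thesis
  proof (rule locally_bounded_by_baire[where Q = hat_sup and E = E and M = "\<lambda>n. 2 * real n" and T = T])
    fix n
    have "E n = {0..} \<inter> (\<Inter>x\<in>{0..}. {t\<in>{0..}. norm (u x t) \<le> real n / (1 + x)\<^sup>2} \<inter> {t\<in>{0..}. norm (ux x t) \<le> real n / (1 + x)\<^sup>2})"
      by (auto simp: E_def)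
    also have "closed \<dots>"
      by (intro closed_Int closed_INT ballI continuous_closed_preimage_constant continuous_on_closed_Collect_le
          continuous_intros continuous_time) auto
    finally show "closed (E n)" .
    fix t assume "t \<in> E n"
    then have t: "t \<ge> 0" and d: "decays (real n) (\<lambda>x. u x t)" "decays (real n) (\<lambda>x. ux x t)"
      by (auto simp: E_def decays_def continuous_space)
    show "hat_sup t \<le> 2 * real n"
      unfolding hat_sup_def
      by (rule cSUP_least) (use hat_sup_bound_decays[OF t d, of "of_real _"] in auto)
  next
    fix t :: real assume t: "t \<ge> 0"
    obtain C where C: "decays C (\<lambda>x. u x t)" "decays C (\<lambda>x. ux x t)" using solution_decays[OF t] by blast
    obtain n where "C \<le> real n" using real_arch_simple by blast
    then have "decays (real n) (\<lambda>x. u x t)" "decays (real n) (\<lambda>x. ux x t)" using C decays_mono by blast+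
    then show "\<exists>n. t \<in> E n" using t by (auto simp: E_def decays_def)
  next
    fix T :: real
    show "\<exists>C. \<forall>s t m. 0 \<le> s \<and> s \<le> t \<and> t \<le> T \<and> (\<forall>r\<in>{s..t}. hat_sup r \<le> m) \<longrightarrow> \<bar>hat_sup s - hat_sup t\<bar> \<le> C"
      by (rule hat_sup_step)
  qed (use assms that in auto)
qed

lemma global_relation:
  assumes "t \<ge> 0" "Im k \<ge> 0"
  shows "exp (dispersion k * t) * hat t k = hat 0 k - integral {0..t} (\<lambda>\<tau>. exp (dispersion k * \<tau>) * bdry k \<tau>)"
proof -
  obtain m where m: "\<And>r. r \<in> {0..t} \<Longrightarrow> hat_sup r \<le> m" using hat_sup_locally_bounded[OF assms(1)] by blast
  have "global_relation 0 t k"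
    by (rule global_relation_closed_upper[OF order_refl assms, of m])
      (auto intro!: order_trans[OF le_hat_sup m])
  then show ?thesis by (simp add: global_relation_def algebra_simps)
qed

end

section \<open>Contour and Fresnel integrals\<close>

lemma contour_integral_ray:
  assumes cont: "continuous_on {0..R} (\<lambda>r. f (c * of_real r))" and R: "R \<ge> 0"
  shows "(f has_contour_integral integral {0..R} (\<lambda>r. c * f (c * of_real r))) (linepath 0 (c * of_real R))"
proof (cases "R = 0")
  case False
  with R have R: "R > 0" by simp
  have "((\<lambda>r. c * f (c * of_real r)) has_integral integral {0..R} (\<lambda>r. c * f (c * of_real r))) {0..R}"
    by (intro integrable_integral integrable_continuous_real continuous_intros cont)
  from has_integral_stretch_real[OF this False]
  have "((\<lambda>s. c * f (c * of_real (R * s))) has_integral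
      (1 / \<bar>R\<bar>) *\<^sub>R integral {0..R} (\<lambda>r. c * f (c * of_real r))) ((\<lambda>x. x / R) ` {0..R})" .
  also have "(\<lambda>x. x / R) ` {0..R} = {0..1}" using R by simp
  finally have H: "((\<lambda>s. of_real R * (c * f (c * of_real (R * s)))) has_integral
      of_real R * ((1 / \<bar>R\<bar>) *\<^sub>R integral {0..R} (\<lambda>r. c * f (c * of_real r)))) {0..1}"
    by (rule has_integral_mult_right)
  have scale: "complex_of_real R * ((1 / \<bar>R\<bar>) *\<^sub>R z) = z" for z using R by (simp add: scaleR_conv_of_real)
  have "of_real R * (c * f (c * of_real (R * s))) =
      f (linepath 0 (c * of_real R) s) * (c * of_real R - 0)" for s
    by (simp add: linepath_def scaleR_conv_of_real mult_ac)
  then show ?thesis using H unfolding has_contour_integral_linepath by (simp only: scale)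
qed simp

abbreviation imaginary_ray :: "real \<Rightarrow> real \<Rightarrow> complex" where
  "imaginary_ray R \<equiv> linepath (- \<i> * of_real R) 0"

lemma has_D3_integral_split:
  assumes cont: "\<And>R. R > 0 \<Longrightarrow> continuous_on (closed_segment (- \<i> * of_real R) 0) h"
    "\<And>S. S > 0 \<Longrightarrow> continuous_on (closed_segment 0 (- of_real S)) h"
    and V: "((\<lambda>R. contour_integral (imaginary_ray R) h) \<longlongrightarrow> V) at_top"
    and W: "((\<lambda>S. contour_integral (linepath 0 (- of_real S)) h) \<longlongrightarrow> W) at_top"
  shows "h has_D3_integral V + W"
proof -
  have i: "h contour_integrable_on imaginary_ray R" "h contour_integrable_on linepath 0 (- of_real R)" if "R > 0" for R
    using cont[OF that] by (auto intro: contour_integrable_continuous_linepath)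
  have eq: "contour_integral (D3_contour R S) h = contour_integral (imaginary_ray R) h +
      contour_integral (linepath 0 (- of_real S)) h" if "R > 0" "S > 0" for R S
    unfolding D3_contour_def using i(1)[OF that(1)] i(2)[OF that(2)] by simp
  have "((\<lambda>p. contour_integral (linepath (- \<i> * of_real (fst p)) 0) h +
      contour_integral (linepath 0 (- of_real (snd p))) h) \<longlongrightarrow> V + W) (at_top \<times>\<^sub>F at_top)"
    by (intro tendsto_add filterlim_compose[OF V filterlim_fst] filterlim_compose[OF W filterlim_snd])
  moreover have "\<forall>\<^sub>F p in at_top \<times>\<^sub>F at_top. fst p > (0::real) \<and> snd p > (0::real)"
    using eventually_compose_filterlim[OF eventually_gt_at_top[of 0] filterlim_fst]
      eventually_compose_filterlim[OF eventually_gt_at_top[of 0] filterlim_snd] by (rule eventually_conj)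
  then have "\<forall>\<^sub>F p in at_top \<times>\<^sub>F at_top. contour_integral (linepath (- \<i> * of_real (fst p)) 0) h +
      contour_integral (linepath 0 (- of_real (snd p))) h = (case p of (R, S) \<Rightarrow> contour_integral (D3_contour R S) h)"
    by eventually_elim (use eq in \<open>auto simp: case_prod_unfold\<close>)
  ultimately have "((\<lambda>(R, S). contour_integral (D3_contour R S) h) \<longlongrightarrow> V + W) (at_top \<times>\<^sub>F at_top)"
    by (rule Lim_transform_eventually)
  moreover have "h contour_integrable_on D3_contour R S" if "R > 0" "S > 0" for R S
    unfolding D3_contour_def by (intro contour_integrable_joinI i that) auto
  ultimately show ?thesis by (auto simp: has_D3_integral_def)
qed

lemma integral_exp_segment_le:
  assumes "c > 0"
  shows "((\<lambda>s::real. exp (- c * (1 - s))) has_integral (1 - exp (- c)) / c) {0..1}"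
proof -
  have "((\<lambda>s. exp (- c * (1 - s))) has_integral exp (- c * (1 - 1)) / c - exp (- c * (1 - 0)) / c) {0..1}"
    using assms
    by (intro fundamental_theorem_of_calculus)
      (auto intro!: derivative_eq_intros simp: has_real_derivative_iff_has_vector_derivative[symmetric])
  then show ?thesis by (simp add: diff_divide_distrib)
qed

text \<open>The connecting segment from \<open>-iR\<close> to \<open>\<sigma>R\<close> replaces the quarter circle of Jordan's lemma.\<close>

lemma quadrant_segment_tendsto_0:
  fixes \<sigma> x C :: real
  assumes \<sigma>: "\<sigma> = 1 \<or> \<sigma> = - 1" and x: "x > 0"
    and cont: "continuous_on {k. Im k \<le> 0} h"
    and bound: "\<And>k. Im k \<le> 0 \<Longrightarrow> \<sigma> * Re k \<ge> 0 \<Longrightarrow> (1 + norm k) * norm (h k) \<le> C * exp (2 * x * Im k)"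
  shows "((\<lambda>R. contour_integral (linepath (- \<i> * of_real R) (of_real (\<sigma> * R))) h) \<longlongrightarrow> 0) at_top"
proof (rule tendsto_0_le_inverse[where C = "2 * C / x"])
  have C: "C \<ge> 0" using bound[of 0] by (auto intro: order_trans[OF norm_ge_zero])
  fix R :: real assume R: "R > 0"
  let ?g = "linepath (- \<i> * of_real R) (of_real (\<sigma> * R))"
  let ?d = "of_real (\<sigma> * R) - (- \<i> * of_real R)"
  have g: "Im (?g s) = - R * (1 - s)" "Re (?g s) = \<sigma> * R * s" for s
    by (simp_all add: linepath_def algebra_simps)
  have ci: "continuous_on (closed_segment (- \<i> * of_real R) (of_real (\<sigma> * R))) h"
  proof (rule continuous_on_subset[OF cont])
    show "closed_segment (- \<i> * of_real R) (of_real (\<sigma> * R)) \<subseteq> {k. Im k \<le> 0}"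
      using R by (intro closed_segment_subset) (auto simp: convex_halfspace_Im_le)
  qed
  have I: "((\<lambda>s. h (?g s) * ?d) has_integral contour_integral ?g h) {0..1}"
    using has_contour_integral_integral[OF contour_integrable_continuous_linepath[OF ci]]
    by (simp only: has_contour_integral_linepath)
  have hI: "((\<lambda>s. 4 * C * exp (- (2 * x * R) * (1 - s))) has_integral 4 * C * ((1 - exp (- (2 * x * R))) / (2 * x * R))) {0..1}"
    using x R by (intro has_integral_mult_right integral_exp_segment_le) auto
  have "norm ?d \<le> norm (complex_of_real (\<sigma> * R)) + norm (- \<i> * complex_of_real R)" by (rule norm_triangle_ineq4)
  also have "\<dots> = 2 * R" using \<sigma> R by (auto simp: norm_mult)
  finally have d: "norm ?d \<le> 2 * R" .
  have "norm (h (?g s) * ?d) \<le> 4 * C * exp (- (2 * x * R) * (1 - s))" if s: "s \<in> {0..1}" for s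
  proof -
    \<comment> \<open>On the segment |Re k| + |Im k| = R, hence |k| >= R/2. The decay 1/(1+|k|) thus
      absorbs the length of the segment, and integrating the exponential supplies the factor 1/R
      that tends to zero.\<close>
    have "R * (1 - s) = \<bar>Im (?g s)\<bar>" "R * s = \<bar>Re (?g s)\<bar>"
      unfolding g using s R \<sigma> by (auto simp: abs_mult)
    then have "R * (1 - s) + R * s \<le> 2 * norm (?g s)"
      using abs_Im_le_cmod[of "?g s"] abs_Re_le_cmod[of "?g s"] by linarith
    then have A: "R * norm (h (?g s)) \<le> 2 * ((1 + norm (?g s)) * norm (h (?g s)))"
      using mult_right_mono[of R "2 * (1 + norm (?g s))" "norm (h (?g s))"] by (simp add: algebra_simps)
    have "Im (?g s) \<le> 0" "\<sigma> * Re (?g s) \<ge> 0"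
      unfolding g using s R \<sigma> by auto
    then have "2 * ((1 + norm (?g s)) * norm (h (?g s))) \<le> 2 * (C * exp (2 * x * Im (?g s)))"
      by (intro mult_left_mono bound) auto
    moreover have "2 * x * Im (?g s) = - (2 * x * R) * (1 - s)" unfolding g by simp
    ultimately have *: "R * norm (h (?g s)) \<le> 2 * (C * exp (- (2 * x * R) * (1 - s)))"
      using A by (simp only:)
    have "norm (h (?g s) * ?d) \<le> norm (h (?g s)) * (2 * R)"
      unfolding norm_mult[of "h (?g s)"] by (rule mult_left_mono[OF d]) simp
    also have "\<dots> \<le> 4 * C * exp (- (2 * x * R) * (1 - s))" using * by (simp add: mult_ac)
    finally show ?thesis .
  qed
  then have "norm (integral {0..1} (\<lambda>s. h (?g s) * ?d)) \<le> integral {0..1} (\<lambda>s. 4 * C * exp (- (2 * x * R) * (1 - s)))"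
    by (intro integral_norm_bound_integral has_integral_integrable[OF I] has_integral_integrable[OF hI])
  then have "norm (contour_integral ?g h) \<le> 4 * C * ((1 - exp (- (2 * x * R))) / (2 * x * R))"
    by (simp only: integral_unique[OF I] integral_unique[OF hI])
  also have "\<dots> \<le> 4 * C * (1 / (2 * x * R))"
    using C x R by (intro mult_left_mono divide_right_mono) auto
  also have "\<dots> = (2 * C / x) / R" by simp
  finally show "norm (contour_integral ?g h) \<le> (2 * C / x) / R" .
qed

text \<open>On the imaginary axis exp(2x Im k) with x > 0 makes the integral absolutely convergent.
  Cauchy's theorem carries the value over to a real half-axis, where decay 1/|k| alone would not
  give convergence. The sign \<sigma> selects the fourth (1) or the third (-1) quadrant.\<close>

lemma quadrant_contour:
  fixes \<sigma> x C :: real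
  assumes \<sigma>: "\<sigma> = 1 \<or> \<sigma> = - 1" and x: "x > 0"
    and cont: "continuous_on {k. Im k \<le> 0} h" and hol: "h holomorphic_on {k. Im k < 0}"
    and bound: "\<And>k. Im k \<le> 0 \<Longrightarrow> \<sigma> * Re k \<ge> 0 \<Longrightarrow> (1 + norm k) * norm (h k) \<le> C * exp (2 * x * Im k)"
  obtains V where "((\<lambda>R. contour_integral (imaginary_ray R) h) \<longlongrightarrow> V) at_top"
    "((\<lambda>R. contour_integral (linepath 0 (of_real (\<sigma> * R))) h) \<longlongrightarrow> - V) at_top"
proof -
  define V where "V = integral {0..} (\<lambda>r. \<i> * h (- \<i> * of_real r))"
  have ch: "continuous_on {0..} (\<lambda>r. h (- \<i> * of_real r))"
    by (rule continuous_on_compose2[OF cont]) (auto intro!: continuous_intros)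
  have d: "decays (C / (min 1 x)\<^sup>2) (\<lambda>r. \<i> * h (- \<i> * of_real r))"
    unfolding decays_def
  proof (intro conjI allI impI continuous_intros ch)
    fix r :: real assume r: "r \<ge> 0"
    have "norm (h (- \<i> * of_real r)) \<le> (1 + r) * norm (h (- \<i> * of_real r))"
      using r by (simp add: mult_le_cancel_right1)
    also have "\<dots> \<le> C * exp (- 2 * x * r)"
      using bound[of "- \<i> * of_real r"] r by (simp add: norm_mult)
    also have "\<dots> \<le> C * ((1 / (min 1 x)\<^sup>2) / (1 + r)\<^sup>2)"
    proof (rule mult_left_mono[OF square_times_exp_le[OF x r]])
      show "C \<ge> 0" using bound[of 0] by (auto intro: order_trans[OF norm_ge_zero])
    qed
    finally show "norm (\<i> * h (- \<i> * of_real r)) \<le> C / (min 1 x)\<^sup>2 / (1 + r)\<^sup>2"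
      by (simp add: norm_mult)
  qed
  have down: "contour_integral (imaginary_ray R) h = integral {0..R} (\<lambda>r. \<i> * h (- \<i> * of_real r))"
    if R: "R \<ge> 0" for R
  proof -
    have "continuous_on {0..R} (\<lambda>r. h (- \<i> * of_real r))"
      by (rule continuous_on_subset[OF ch]) auto
    from contour_integral_unique[OF contour_integral_ray[OF this R]]
    have "contour_integral (linepath 0 (- \<i> * of_real R)) h = integral {0..R} (\<lambda>r. - \<i> * h (- \<i> * of_real r))" .
    moreover have "contour_integral (imaginary_ray R) h = - contour_integral (linepath 0 (- \<i> * of_real R)) h"
    proof (rule contour_integral_reverse_linepath, rule continuous_on_subset[OF cont])
      show "closed_segment (- \<i> * of_real R) 0 \<subseteq> {k. Im k \<le> 0}"
        using R by (intro closed_segment_subset) (auto simp: convex_halfspace_Im_le)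
    qed
    ultimately show ?thesis by (simp add: integral_neg[symmetric] del: integral_neg)
  qed
  have 1: "((\<lambda>R. contour_integral (imaginary_ray R) h) \<longlongrightarrow> V) at_top"
    by (rule tendsto_at_top_transform[OF decays_tendsto_integral[OF d, folded V_def] down[symmetric]])
  have triangle: "contour_integral (linepath 0 (of_real (\<sigma> * R))) h =
      contour_integral (linepath (- \<i> * of_real R) (of_real (\<sigma> * R))) h - contour_integral (imaginary_ray R) h"
    if R: "R \<ge> 0" for R
  proof -
    let ?a = "- \<i> * of_real R" and ?c = "of_real (\<sigma> * R)"
    have sub: "convex hull {?a, 0, ?c} \<subseteq> {k. Im k \<le> 0}"
      using R by (intro hull_minimal) (auto simp: convex_halfspace_Im_le)
    have "interior (convex hull {?a, 0, ?c}) \<subseteq> interior {k. Im k \<le> 0}" by (rule interior_mono[OF sub])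
    also have "interior {k. Im k \<le> 0} = {k. Im k < 0}"
      using interior_halfspace_le[of "\<i>" 0] by (simp add: inner_complex_def)
    finally have int: "interior (convex hull {?a, 0, ?c}) \<subseteq> {k. Im k < 0}" .
    have seg: "closed_segment p q \<subseteq> {k. Im k \<le> 0}" if "p \<in> {?a, 0, ?c}" "q \<in> {?a, 0, ?c}" for p q
      by (rule order_trans[OF _ sub]) (intro closed_segment_subset hull_inc that convex_convex_hull)
    have i: "h contour_integrable_on linepath p q" if "p \<in> {?a, 0, ?c}" "q \<in> {?a, 0, ?c}" for p q
      by (rule contour_integrable_continuous_linepath[OF continuous_on_subset[OF cont seg[OF that]]])
    \<comment> \<open>One edge lies on the real axis, the boundary of the domain of holomorphy, so
      the form of Cauchy's theorem with mere continuity on the closed triangle is used.\<close>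
    have "contour_integral (linepath ?a 0 +++ linepath 0 ?c +++ linepath ?c ?a) h = 0"
      by (rule contour_integral_unique, rule Cauchy_theorem_triangle_interior)
        (use continuous_on_subset[OF cont sub] holomorphic_on_subset[OF hol int] in auto)
    then have "contour_integral (linepath ?a 0) h + (contour_integral (linepath 0 ?c) h + contour_integral (linepath ?c ?a) h) = 0"
      using i[of ?a 0] i[of 0 ?c] i[of ?c ?a] by (simp add: contour_integrable_joinI)
    moreover have "contour_integral (linepath ?c ?a) h = - contour_integral (linepath ?a ?c) h"
      by (rule contour_integral_reverse_linepath, rule continuous_on_subset[OF cont seg]) auto
    ultimately show ?thesis by (simp add: algebra_simps)
  qed
  have "((\<lambda>R. contour_integral (linepath (- \<i> * of_real R) (of_real (\<sigma> * R))) h - contour_integral (imaginary_ray R) h) \<longlongrightarrow> 0 - V) at_top"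
    by (intro tendsto_diff 1 quadrant_segment_tendsto_0[OF \<sigma> x cont bound])
  then have 2: "((\<lambda>R. contour_integral (linepath 0 (of_real (\<sigma> * R))) h) \<longlongrightarrow> 0 - V) at_top"
    by (rule tendsto_at_top_transform[OF _ triangle[symmetric]])
  show thesis by (rule that[OF 1]) (use 2 in simp)
qed

section \<open>Conditionally convergent integrals and the Gauss primitive\<close>

lemma has_integral_UNIV_antiderivative:
  fixes f :: "real \<Rightarrow> complex"
  assumes f: "\<And>a b. a \<le> b \<Longrightarrow> (f has_integral \<Phi> b - \<Phi> a) {a..b}"
    and p: "(\<Phi> \<longlongrightarrow> p) at_top" and q: "(\<Phi> \<longlongrightarrow> q) at_bot"
  shows "(f has_integral p - q) UNIV"
  \<comment> \<open>The gauge integral over the line only asks for convergence over intervals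
    containing a large ball. Limits of the primitive at both ends suffice; absolute integrability
    does not enter.\<close>
  unfolding has_integral_alt'
proof (intro conjI allI impI)
  show "(\<lambda>x. if x \<in> UNIV then f x else 0) integrable_on cbox a b" for a b :: real
    using f[of a b] by (cases "a \<le> b") (auto simp: integrable_on_def)
  fix e :: real assume "e > 0"
  then have "e / 2 > 0" by simp
  then have "\<forall>\<^sub>F b in at_top. dist (\<Phi> b) p < e / 2" "\<forall>\<^sub>F a in at_bot. dist (\<Phi> a) q < e / 2"
    by (rule tendstoD[OF p], rule tendstoD[OF q])
  then obtain B A where BA: "\<And>b. b \<ge> B \<Longrightarrow> dist (\<Phi> b) p < e / 2" "\<And>a. a \<le> A \<Longrightarrow> dist (\<Phi> a) q < e / 2"
    by (auto simp: eventually_at_top_linorder eventually_at_bot_linorder)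
  define N where "N = \<bar>A\<bar> + \<bar>B\<bar> + 1"
  have "norm (integral (cbox a b) (\<lambda>x. if x \<in> UNIV then f x else 0) - (p - q)) < e" if sub: "ball 0 N \<subseteq> cbox a b" for a b
  proof -
    have "- N < N" by (simp add: N_def)
    then have "closure {-N<..<N} = {-N..N}" by simp
    moreover have "closure {-N<..<N} \<subseteq> {a..b}"
      using closure_mono[OF sub] by (simp add: ball_eq_greaterThanLessThan)
    ultimately have ab: "a \<le> - N" "N \<le> b" using \<open>- N < N\<close> by auto
    then have "integral {a..b} f = \<Phi> b - \<Phi> a" using \<open>- N < N\<close> by (intro integral_unique f) auto
    moreover have "norm ((\<Phi> b - \<Phi> a) - (p - q)) \<le> dist (\<Phi> b) p + dist (\<Phi> a) q"
      using norm_triangle_ineq4[of "\<Phi> b - p" "\<Phi> a - q"] by (simp add: dist_norm algebra_simps)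
    moreover have "b \<ge> B" "a \<le> A" using ab by (auto simp: N_def)
    then have "dist (\<Phi> b) p < e / 2" "dist (\<Phi> a) q < e / 2"
      using BA(1)[of b] BA(2)[of a] by simp_all
    ultimately show ?thesis by simp
  qed
  then show "\<exists>B>0. \<forall>a b. ball 0 B \<subseteq> cbox a b \<longrightarrow> norm (integral (cbox a b) (\<lambda>x. if x \<in> UNIV then f x else 0) - (p - q)) < e"
    by (intro exI[of _ N]) (auto simp: N_def)
qed

text \<open>This is sqrt(pi)/2 times the error function as an entire function. It is chosen from the
  primitives of exp(-z^2) that exist on the simply connected plane and normalised at 0.\<close>

definition gauss_primitive :: "complex \<Rightarrow> complex" where
  "gauss_primitive = (SOME E. E 0 = 0 \<and> (\<forall>z. (E has_field_derivative exp (- z\<^sup>2)) (at z)))"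

lemma gauss_primitive_0: "gauss_primitive 0 = 0"
  and gauss_primitive_deriv: "(gauss_primitive has_field_derivative exp (- z\<^sup>2)) (at z)"
proof -
  have "(\<lambda>z::complex. exp (- z\<^sup>2)) holomorphic_on UNIV" by (intro holomorphic_intros)
  then have "\<exists>E::complex\<Rightarrow>complex. E 0 = 0 \<and> (\<forall>z. (E has_field_derivative exp (- z\<^sup>2)) (at z))"
  proof (rule holomorphic_convex_primitive'[OF convex_UNIV open_UNIV])
    fix g :: "complex \<Rightarrow> complex"
    assume "\<And>z. z \<in> UNIV \<Longrightarrow> (g has_field_derivative exp (- z\<^sup>2)) (at z within UNIV)"
    then have "(g has_field_derivative exp (- z\<^sup>2)) (at z)" for z by simp
    then have "((\<lambda>z. g z - g 0) has_field_derivative exp (- z\<^sup>2)) (at z)" for z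
      using DERIV_diff[OF _ DERIV_const] by fastforce
    then show ?thesis by (intro exI[of _ "\<lambda>z. g z - g 0"]) simp
  qed
  from someI_ex[OF this] show "gauss_primitive 0 = 0" "(gauss_primitive has_field_derivative exp (- z\<^sup>2)) (at z)"
    unfolding gauss_primitive_def[symmetric] by auto
qed

lemma gauss_primitive_minus: "gauss_primitive (- z) = - gauss_primitive z"
proof -
  have d: "((\<lambda>z. gauss_primitive (- z)) has_field_derivative - exp (- z\<^sup>2)) (at z)" for z
  proof -
    have "((\<lambda>z. gauss_primitive (- z)) has_field_derivative exp (- (- z)\<^sup>2) * (- 1)) (at z)"
      by (rule DERIV_chain2[where f = gauss_primitive and g = uminus, OF gauss_primitive_deriv])
        (auto intro!: derivative_eq_intros)
    then show ?thesis by simp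
  qed
  have "((\<lambda>z. gauss_primitive z + gauss_primitive (- z)) has_field_derivative 0) (at z)" for z
    using DERIV_add[OF gauss_primitive_deriv[of z] d[of z]] by simp
  then obtain c where "\<And>z. gauss_primitive z + gauss_primitive (- z) = c"
    using has_field_derivative_zero_constant[of UNIV "\<lambda>z. gauss_primitive z + gauss_primitive (- z)"] by auto
  from this[of 0] this[of z] show ?thesis by (simp add: gauss_primitive_0 eq_neg_iff_add_eq_0 add.commute)
qed

lemma continuous_on_gauss_primitive [continuous_intros]:
  "continuous_on A f \<Longrightarrow> continuous_on A (\<lambda>x. gauss_primitive (f x))"
  using continuous_on_compose2[of UNIV gauss_primitive A f] gauss_primitive_deriv
  by (meson DERIV_continuous_on DERIV_subset subset_UNIV top_greatest)

lemma gauss_primitive_has_integral: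
  assumes "a \<le> b"
  shows "((\<lambda>y. c * exp (- (d + c * of_real y)\<^sup>2)) has_integral
     gauss_primitive (d + c * of_real b) - gauss_primitive (d + c * of_real a)) {a..b}"
proof (rule fundamental_theorem_of_calculus[OF assms])
  fix y
  have "((\<lambda>z. gauss_primitive (d + c * z)) has_field_derivative exp (- (d + c * of_real y)\<^sup>2) * c) (at (of_real y))"
    by (rule DERIV_chain2[OF gauss_primitive_deriv]) (auto intro!: derivative_eq_intros)
  from has_vector_derivative_real_field[OF this]
  show "((\<lambda>y. gauss_primitive (d + c * of_real y)) has_vector_derivative c * exp (- (d + c * of_real y)\<^sup>2)) (at y within {a..b})"
    by (simp add: mult.commute)
qed

lemma gauss_primitive_real_tendsto:
  "((\<lambda>R. gauss_primitive (of_real R)) \<longlongrightarrow> of_real (sqrt pi / 2)) at_top"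
proof -
  let ?g = "\<lambda>y::real. complex_of_real (exp (- y\<^sup>2))"
  have "has_bochner_integral lborel (\<lambda>x. indicator {0..} x *\<^sub>R exp (- x\<^sup>2)) (sqrt pi / 2)" by (rule gaussian_moment_0)
  then have "((\<lambda>x. indicator {0..} x *\<^sub>R exp (- x\<^sup>2)) has_integral (sqrt pi / 2)) UNIV"
    using has_integral_integral_lborel by (metis has_bochner_integral_iff)
  also have "(\<lambda>x. indicator {0..} x *\<^sub>R exp (- x\<^sup>2)) = (\<lambda>x::real. if x \<in> {0..} then exp (- x\<^sup>2) else 0)"
    by (auto simp: fun_eq_iff)
  finally have "((\<lambda>x. exp (- x\<^sup>2)) has_integral (sqrt pi / 2)) {0..}"
    by (simp only: has_integral_restrict_UNIV)
  then have I: "(?g has_integral of_real (sqrt pi / 2)) {0..}" by (rule has_integral_of_real)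
  have d: "decays 2 ?g"
    unfolding decays_def
  proof (intro conjI allI impI)
    fix x :: real assume x: "x \<ge> 0"
    have "(1 + x)\<^sup>2 \<le> 2 * (1 + x\<^sup>2)" using zero_le_power2[of "x - 1"] by (simp add: power2_eq_square algebra_simps)
    also have "\<dots> \<le> 2 * exp (x\<^sup>2)" using mult_left_mono[OF exp_ge_add_one_self[of "x\<^sup>2"], of 2] by simp
    finally have "exp (- x\<^sup>2) * (1 + x)\<^sup>2 \<le> exp (- x\<^sup>2) * (2 * exp (x\<^sup>2))" by (intro mult_left_mono) auto
    also have "\<dots> = 2" by (simp add: exp_minus)
    finally show "norm (?g x) \<le> 2 / (1 + x)\<^sup>2" using x by (simp add: pos_le_divide_eq)
  qed (auto intro!: continuous_intros)
  have "((\<lambda>n. integral {0..n} ?g) \<longlongrightarrow> of_real (sqrt pi / 2)) at_top"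
    using decays_tendsto_integral[OF d] unfolding integral_unique[OF I] .
  then show ?thesis
  proof (rule tendsto_at_top_transform)
    fix R :: real assume "R \<ge> 0"
    from gauss_primitive_has_integral[OF this, of 1 0]
    show "integral {0..R} ?g = gauss_primitive (of_real R)"
      by (simp add: gauss_primitive_0 exp_of_real[symmetric] integral_unique)
  qed
qed

text \<open>For \<sigma> = 1 or -1 the square of (1 + i\<sigma>)w is 2i\<sigma>w^2, purely
  imaginary. Along this direction the Gauss primitive is a Fresnel integral.\<close>

abbreviation gauss_diagonal :: "real \<Rightarrow> real \<Rightarrow> complex" where
  "gauss_diagonal \<sigma> w \<equiv> gauss_primitive ((1 + \<i> * complex_of_real \<sigma>) * complex_of_real w)"

text \<open>On the vertical segment from R to (1 + i\<sigma>)R the integrand has modulus exp(y^2 -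
  R^2) <= exp(Ry - R^2) for 0 <= y <= R. The detour from the real Gauss integral therefore costs at
  most 1/R.\<close>

lemma gauss_primitive_diagonal_tendsto:
  fixes \<sigma> :: real
  assumes "\<sigma> = 1 \<or> \<sigma> = - 1"
  shows "((\<lambda>R. gauss_diagonal \<sigma> R) \<longlongrightarrow> of_real (sqrt pi / 2)) at_top"
proof -
  have "((\<lambda>R. gauss_diagonal \<sigma> R - gauss_primitive (of_real R)) \<longlongrightarrow> 0) at_top"
  proof (rule tendsto_0_le_inverse[where C = 1])
    fix R :: real assume R: "R > 0"
    let ?h = "\<lambda>y. (\<i> * \<sigma>) * exp (- (of_real R + (\<i> * \<sigma>) * of_real y)\<^sup>2)"
    have I: "(?h has_integral gauss_diagonal \<sigma> R - gauss_primitive (of_real R)) {0..R}"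
      using gauss_primitive_has_integral[of 0 R "\<i> * \<sigma>" "of_real R"] R by (simp add: algebra_simps)
    have J: "((\<lambda>y. exp (R * y - R\<^sup>2)) has_integral exp (R * R - R\<^sup>2) / R - exp (R * 0 - R\<^sup>2) / R) {0..R}"
      using R by (intro fundamental_theorem_of_calculus)
        (auto intro!: derivative_eq_intros simp: has_real_derivative_iff_has_vector_derivative[symmetric])
    have "norm (?h y) \<le> exp (R * y - R\<^sup>2)" if "y \<in> {0..R}" for y
    proof -
      have "Re (- (of_real R + (\<i> * \<sigma>) * of_real y)\<^sup>2) = y\<^sup>2 - R\<^sup>2"
        using assms by (auto simp: power2_eq_square algebra_simps)
      moreover have "y\<^sup>2 \<le> R * y" using that by (simp add: power2_eq_square mult_right_mono)
      moreover have "norm (\<i> * of_real \<sigma>) = 1" using assms by (auto simp: norm_mult)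
      ultimately show ?thesis by (simp only: norm_mult[of "\<i> * of_real \<sigma>"] norm_exp_eq_Re) simp
    qed
    then have "norm (integral {0..R} ?h) \<le> integral {0..R} (\<lambda>y. exp (R * y - R\<^sup>2))"
      by (intro integral_norm_bound_integral has_integral_integrable[OF I] has_integral_integrable[OF J])
    then have "norm (gauss_diagonal \<sigma> R - gauss_primitive (of_real R)) \<le>
        exp (R * R - R\<^sup>2) / R - exp (R * 0 - R\<^sup>2) / R"
      by (simp only: integral_unique[OF I] integral_unique[OF J])
    also have "\<dots> \<le> 1 / R" using R by (simp add: power2_eq_square)
    finally show "norm (gauss_diagonal \<sigma> R - gauss_primitive (of_real R)) \<le> 1 / R" .
  qed
  from tendsto_add[OF this gauss_primitive_real_tendsto] show ?thesis by simp
qed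

lemma gauss_primitive_ray_tendsto:
  fixes \<sigma> \<mu> :: real
  assumes \<sigma>: "\<sigma> = 1 \<or> \<sigma> = - 1" and \<mu>: "\<mu> > 0"
  shows "((\<lambda>w. gauss_diagonal \<sigma> (\<mu> * (w - c))) \<longlongrightarrow> of_real (sqrt pi / 2)) at_top"
    and "((\<lambda>w. gauss_diagonal \<sigma> (\<mu> * (w - c))) \<longlongrightarrow> - of_real (sqrt pi / 2)) at_bot"
proof -
  have "filterlim (\<lambda>w. w + - c) at_top at_top" for c :: real
    by (rule filterlim_tendsto_add_at_top[OF tendsto_const filterlim_ident, THEN filterlim_cong[THEN iffD1, rotated 3]]) (auto simp: add.commute)
  then have t: "filterlim (\<lambda>w. \<mu> * (w - c)) at_top at_top" for c
    by (intro filterlim_tendsto_pos_mult_at_top[OF tendsto_const \<mu>]) simp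
  show "((\<lambda>w. gauss_diagonal \<sigma> (\<mu> * (w - c))) \<longlongrightarrow> of_real (sqrt pi / 2)) at_top"
    by (rule filterlim_compose[OF gauss_primitive_diagonal_tendsto[OF \<sigma>] t])
  have "((\<lambda>w. - gauss_diagonal \<sigma> (\<mu> * (w - (- c)))) \<longlongrightarrow> - of_real (sqrt pi / 2)) at_top"
    by (rule tendsto_minus[OF filterlim_compose[OF gauss_primitive_diagonal_tendsto[OF \<sigma>] t]])
  then have "((\<lambda>w. gauss_primitive (- ((1 + \<i> * \<sigma>) * of_real (\<mu> * (w - (- c)))))) \<longlongrightarrow> - of_real (sqrt pi / 2)) at_top"
    by (simp only: gauss_primitive_minus)
  from filterlim_compose[OF this filterlim_uminus_at_top_at_bot]
  show "((\<lambda>w. gauss_diagonal \<sigma> (\<mu> * (w - c))) \<longlongrightarrow> - of_real (sqrt pi / 2)) at_bot"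
    by (rule back_subst[of "\<lambda>F. (F \<longlongrightarrow> _) _"]) (simp add: fun_eq_iff algebra_simps)
qed

text \<open>A limit at infinity, a compact piece and oddness. The bound holds for Fresnel integrals
  of every length and so provides the dominating functions below.\<close>

lemma gauss_primitive_ray_bounded:
  fixes \<sigma> :: real
  assumes \<sigma>: "\<sigma> = 1 \<or> \<sigma> = - 1"
  shows "\<exists>B\<ge>0. \<forall>w. norm (gauss_diagonal \<sigma> w) \<le> B"
proof -
  let ?F = "\<lambda>w. gauss_diagonal \<sigma> w"
  have "((\<lambda>w. norm (?F w)) \<longlongrightarrow> norm (complex_of_real (sqrt pi / 2))) at_top"
    by (intro tendsto_norm gauss_primitive_diagonal_tendsto[OF \<sigma>])
  then have "\<forall>\<^sub>F w in at_top. norm (?F w) < norm (complex_of_real (sqrt pi / 2)) + 1"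
    by (rule order_tendstoD) simp
  then obtain N where N: "\<And>w. w \<ge> N \<Longrightarrow> norm (?F w) < norm (complex_of_real (sqrt pi / 2)) + 1"
    by (auto simp: eventually_at_top_linorder)
  have "compact (?F ` {0..N})" by (intro compact_continuous_image continuous_intros compact_Icc)
  from compact_imp_bounded[OF this] obtain A where A: "\<And>w. w \<in> {0..N} \<Longrightarrow> norm (?F w) \<le> A"
    unfolding bounded_iff by blast
  define B where "B = \<bar>A\<bar> + (norm (complex_of_real (sqrt pi / 2)) + 1)"
  have pos: "norm (?F w) \<le> B" if "w \<ge> 0" for w
    using A[of w] N[of w] that unfolding B_def by (cases "w \<le> N") (auto simp: add_increasing add_increasing2)
  have "norm (?F w) \<le> B" for w
  proof (cases "w \<ge> 0")
    case False
    have "?F w = - ?F (- w)" by (simp flip: gauss_primitive_minus)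
    with pos[of "- w"] False show ?thesis by simp
  qed (rule pos)
  moreover have "B \<ge> 0" by (simp add: B_def add_nonneg_nonneg)
  ultimately show ?thesis by blast
qed

lemma one_plus_i_squared:
  fixes \<sigma> :: real
  assumes "\<sigma> = 1 \<or> \<sigma> = - 1"
  shows "(1 + \<i> * of_real \<sigma>)\<^sup>2 = 2 * \<i> * of_real \<sigma>" "1 + \<i> * of_real \<sigma> \<noteq> 0"
  using assms by (auto simp: power2_eq_square algebra_simps complex_eq_iff)

text \<open>Completing the square: with \<open>\<lambda> = (1 + i\<sigma>)\<surd>(2t)\<close> one has \<open>\<lambda>\<^sup>2 = 4i\<sigma>t\<close>.\<close>

lemma fresnel_has_integral:
  fixes \<sigma> t \<kappa> a b :: real
  assumes \<sigma>: "\<sigma> = 1 \<or> \<sigma> = - 1" and t: "t > 0" and ab: "a \<le> b"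
  defines "G \<equiv> \<lambda>w. gauss_diagonal \<sigma> (sqrt (2 * t) * (w - \<kappa> / (4 * t)))"
  shows "((\<lambda>k. exp (\<i> * of_real (\<sigma> * (2 * \<kappa> * k - 4 * t * k\<^sup>2)))) has_integral
     exp (\<i> * of_real (\<sigma> * (\<kappa>\<^sup>2 / (4 * t)))) / ((1 + \<i> * \<sigma>) * of_real (sqrt (2 * t))) * (G b - G a)) {a..b}"
proof -
  let ?l = "(1 + \<i> * \<sigma>) * of_real (sqrt (2 * t))"
  let ?d = "- ?l * of_real (\<kappa> / (4 * t))"
  have l: "?l\<^sup>2 = 4 * \<i> * of_real (\<sigma> * t)"
    unfolding power_mult_distrib one_plus_i_squared(1)[OF \<sigma>] of_real_power[symmetric] using t by simp
  have l0: "?l \<noteq> 0" using one_plus_i_squared(2)[OF \<sigma>] t by simp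
  have G: "gauss_primitive (?d + ?l * of_real w) = G w" for w
  proof -
    have "- (a * b) * c + (a * b) * d = a * (b * (d - c))" for a b c d :: complex
      by (simp add: algebra_simps)
    then show ?thesis by (simp only: G_def of_real_mult of_real_diff mult_minus_left)
  qed
  have "((\<lambda>k. exp (\<i> * of_real (\<sigma> * (\<kappa>\<^sup>2 / (4 * t)))) / ?l * (?l * exp (- (?d + ?l * of_real k)\<^sup>2))) has_integral
     exp (\<i> * of_real (\<sigma> * (\<kappa>\<^sup>2 / (4 * t)))) / ?l * (G b - G a)) {a..b}"
    using gauss_primitive_has_integral[OF ab, of ?l ?d] unfolding G by (rule has_integral_mult_right)
  moreover have "exp (\<i> * of_real (\<sigma> * (\<kappa>\<^sup>2 / (4 * t)))) / ?l * (?l * exp (- (?d + ?l * of_real k)\<^sup>2)) =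
      exp (\<i> * of_real (\<sigma> * (2 * \<kappa> * k - 4 * t * k\<^sup>2)))" for k
  proof -
    have "(?d + ?l * of_real k)\<^sup>2 = ?l\<^sup>2 * of_real ((k - \<kappa> / (4 * t))\<^sup>2)"
      by (simp add: power2_eq_square algebra_simps)
    also have "\<dots> = \<i> * of_real (4 * \<sigma> * t * (k - \<kappa> / (4 * t))\<^sup>2)"
      unfolding l by simp
    finally have "\<i> * of_real (\<sigma> * (\<kappa>\<^sup>2 / (4 * t))) - (?d + ?l * of_real k)\<^sup>2 =
        \<i> * of_real (\<sigma> * (\<kappa>\<^sup>2 / (4 * t)) - 4 * \<sigma> * t * (k - \<kappa> / (4 * t))\<^sup>2)"
      by (simp add: algebra_simps)
    also have "\<sigma> * (\<kappa>\<^sup>2 / (4 * t)) - 4 * \<sigma> * t * (k - \<kappa> / (4 * t))\<^sup>2 = \<sigma> * (2 * \<kappa> * k - 4 * t * k\<^sup>2)"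
      using t by (simp add: power2_eq_square field_simps)
    finally have "exp (\<i> * of_real (\<sigma> * (\<kappa>\<^sup>2 / (4 * t)))) * exp (- (?d + ?l * of_real k)\<^sup>2) =
      exp (\<i> * of_real (\<sigma> * (2 * \<kappa> * k - 4 * t * k\<^sup>2)))"
      by (simp only: exp_add[symmetric] add_uminus_conv_diff)
    then show ?thesis using l0 by simp
  qed
  ultimately show ?thesis by simp
qed

text \<open>After exchanging the integrals, the k-integral is a Fresnel integral with \<kappa> = y -
  x. Its primitive in k is bounded uniformly in y and tends to opposite constants at the two ends,
  so dominated convergence in y yields p - (-p). This gives convergence in k even when the transform
  of v is not absolutely integrable.\<close>

lemma gauss_fourier_limits:
  fixes t x :: real
  assumes v: "decays C v" and t: "t > 0"
  defines "I \<equiv> of_real (sqrt pi) / ((1 + \<i>) * of_real (sqrt (2 * t)))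
     * integral {0..} (\<lambda>y. exp (\<i> * of_real ((y - x)\<^sup>2 / (4 * t))) * v y)"
    and "h \<equiv> \<lambda>k. exp (- 2 * \<i> * of_real k * of_real x - dispersion (of_real k) * of_real t)
          * half_line_fourier v (of_real k)"
  shows "(h has_integral I) UNIV" and "((\<lambda>S. integral {-S..S} h) \<longlongrightarrow> I) at_top"
proof -
  have s1: "(1::real) = 1 \<or> (1::real) = - 1" by simp
  let ?l = "(1 + \<i> * of_real 1) * of_real (sqrt (2 * t))"
  let ?e = "\<lambda>y. exp (\<i> * of_real (1 * ((y - x)\<^sup>2 / (4 * t))))"
  let ?G = "\<lambda>y w. gauss_diagonal 1 (sqrt (2 * t) * (w - (y - x) / (4 * t)))"
  define \<Phi> where "\<Phi> w = integral {0..} (\<lambda>y. ?e y / ?l * ?G y w * v y)" for w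
  define p where "p = integral {0..} (\<lambda>y. ?e y / ?l * of_real (sqrt pi / 2) * v y)"
  obtain B where B: "B \<ge> 0" "\<And>w. norm (gauss_diagonal 1 w) \<le> B"
    using gauss_primitive_ray_bounded[OF s1] by blast
  have sq: "sqrt (2 * t) > 0" using t by simp
  have l0: "?l \<noteq> 0" using one_plus_i_squared(2)[OF s1] sq by simp
  have d: "decays (B / norm ?l * C) (\<lambda>y. ?e y / ?l * ?G y w * v y)" for w
  proof (rule decays_mult[OF v])
    show "continuous_on {0..} (\<lambda>y. ?e y / ?l * ?G y w)" using t l0 by (intro continuous_intros) auto
    show "norm (?e y / ?l * ?G y w) \<le> B / norm ?l" for y
      unfolding norm_mult[of "?e y / ?l"] norm_divide[of "?e y"] norm_exp_i_times
      unfolding times_divide_eq_left mult_1_left by (rule divide_right_mono[OF B(2)]) simp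
  qed
  have lim: "((\<lambda>S. integral {0..} (\<lambda>y. ?e y / ?l * ?G y (\<tau> * S) * v y)) \<longlongrightarrow> integral {0..} (\<lambda>y. ?e y / ?l * (\<tau> * of_real (sqrt pi / 2)) * v y)) at_top"
    if \<tau>: "\<tau> = 1 \<or> \<tau> = - 1" for \<tau> :: real
  proof (rule dominated_convergence_at_top(2))
    show "(\<lambda>y. ?e y / ?l * ?G y (\<tau> * S) * v y) integrable_on {0..}" for S
      by (rule decays_integrable(1)[OF d]) simp
    show "(\<lambda>y. B / norm ?l * C / (1 + y)\<^sup>2) integrable_on {0..}"
      using has_integral_inverse_square[OF order_refl decays_nonneg[OF d]] by (auto simp: integrable_on_def)
    show "norm (?e y / ?l * ?G y (\<tau> * S) * v y) \<le> B / norm ?l * C / (1 + y)\<^sup>2" if "y \<in> {0..}" for S y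
      by (rule decays_bound[OF d]) (use that in simp)
    show "((\<lambda>S. ?e y / ?l * ?G y (\<tau> * S) * v y) \<longlongrightarrow> ?e y / ?l * (\<tau> * of_real (sqrt pi / 2)) * v y) at_top" for y
    proof (intro tendsto_mult tendsto_const)
      show "((\<lambda>S. ?G y (\<tau> * S)) \<longlongrightarrow> \<tau> * of_real (sqrt pi / 2)) at_top"
        using \<tau> gauss_primitive_ray_tendsto(1)[OF s1 sq, of "(y - x) / (4 * t)"]
          filterlim_compose[OF gauss_primitive_ray_tendsto(2)[OF s1 sq, of "(y - x) / (4 * t)"] filterlim_uminus_at_bot_at_top]
        by auto
    qed
  qed
  have top: "(\<Phi> \<longlongrightarrow> p) at_top" using lim[of 1] by (simp add: \<Phi>_def[abs_def] p_def)
  have "((\<lambda>S. \<Phi> (- S)) \<longlongrightarrow> - p) at_top" using lim[of "- 1"] by (simp add: \<Phi>_def p_def)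
  then have bot: "(\<Phi> \<longlongrightarrow> - p) at_bot" by (simp add: filterlim_at_bot_mirror)
  have h: "(h has_integral \<Phi> b - \<Phi> a) {a..b}" if "a \<le> b" for a b
  proof -
    let ?k = "\<lambda>k y. exp (\<i> * of_real (1 * (2 * (y - x) * k - 4 * t * k\<^sup>2)))"
    have "((\<lambda>k. integral {0..} (\<lambda>y. ?k k y * v y)) has_integral integral {0..} (\<lambda>y. integral {a..b} (\<lambda>k. ?k k y) * v y)) {a..b}"
      by (rule half_line_swap[OF that v, where M = 1])
        (auto simp: case_prod_unfold norm_exp_i_times simp del: of_real_mult of_real_diff of_real_power intro!: continuous_intros)
    also have "(\<lambda>y. integral {a..b} (\<lambda>k. ?k k y) * v y) = (\<lambda>y. ?e y / ?l * ?G y b * v y - ?e y / ?l * ?G y a * v y)"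
      unfolding integral_unique[OF fresnel_has_integral[OF s1 t that]] by (simp add: algebra_simps)
    also have "integral {0..} \<dots> = \<Phi> b - \<Phi> a"
      unfolding \<Phi>_def by (intro integral_diff decays_integrable(1)[OF d]) auto
    also have "(\<lambda>k. integral {0..} (\<lambda>y. ?k k y * v y)) = h"
    proof
      fix k
      have "?k k y * v y = exp (- 2 * \<i> * of_real k * of_real x - dispersion (of_real k) * of_real t) *
         (exp (2 * \<i> * of_real k * of_real y) * v y)" for y
        unfolding mult.assoc[symmetric] exp_add[symmetric] by (simp add: dispersion_def algebra_simps)
      then show "integral {0..} (\<lambda>y. ?k k y * v y) = h k"
        unfolding h_def half_line_fourier_def by (simp only: integral_mult_right)
    qed
    finally show ?thesis .
  qed
  have I: "p - (- p) = I"
  proof -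
    have "p = (of_real (sqrt pi / 2) / ?l) * integral {0..} (\<lambda>y. ?e y * v y)"
      unfolding p_def by (subst integral_mult_right[symmetric]) (simp add: mult_ac)
    then show ?thesis by (simp add: I_def)
  qed
  show "(h has_integral I) UNIV"
    using has_integral_UNIV_antiderivative[OF h top bot] unfolding I .
  have "((\<lambda>S. \<Phi> S - \<Phi> (- S)) \<longlongrightarrow> p - (- p)) at_top"
    by (intro tendsto_diff top \<open>((\<lambda>S. \<Phi> (- S)) \<longlongrightarrow> - p) at_top\<close>)
  then show "((\<lambda>S. integral {-S..S} h) \<longlongrightarrow> I) at_top"
    unfolding I
    by (rule tendsto_at_top_transform) (rule integral_unique[OF h, symmetric], simp)
qed

lemma integral_symmetric:
  fixes F :: "real \<Rightarrow> complex"
  assumes "continuous_on UNIV F" "S \<ge> 0"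
  shows "integral {-S..S} F = integral {0..S} (\<lambda>r. F r + F (- r))"
proof -
  have c: "continuous_on A F" "continuous_on A (\<lambda>r. F (- r))" for A
    by (rule continuous_on_subset[OF assms(1)], simp, rule continuous_on_compose2[OF assms(1)])
      (auto intro!: continuous_intros)
  have "integral {-S..0} F + integral {0..S} F = integral {-S..S} F"
    by (rule Henstock_Kurzweil_Integration.integral_combine) (use assms(2) in \<open>auto intro!: integrable_continuous_real c\<close>)
  then have "integral {-S..S} F = integral {-S..0} F + integral {0..S} F" by simp
  also have "integral {-S..0} F = integral {0..S} (\<lambda>r. F (- r))"
    using Henstock_Kurzweil_Integration.integral_reflect_real[of S 0 "\<lambda>r. F (- r)"] by simp
  finally show ?thesis
    by (subst integral_add) (auto intro!: integrable_continuous_real c)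
qed

text \<open>Meant for a function that can be estimated in the fourth quadrant but not in the third:
  its integral over the negative half-axis is recovered from the symmetric integral over the line
  and the positive half-axis.\<close>

lemma real_axis_contour_tendsto:
  assumes cont: "continuous_on UNIV A"
    and L: "((\<lambda>S. integral {-S..S} (\<lambda>r. A (of_real r))) \<longlongrightarrow> L) at_top"
    and V: "((\<lambda>R. contour_integral (linepath 0 (of_real R)) A) \<longlongrightarrow> V) at_top"
  shows "((\<lambda>S. contour_integral (linepath 0 (- of_real S)) A) \<longlongrightarrow> V - L) at_top"
proof (rule tendsto_at_top_transform[OF tendsto_diff[OF V L]])
  have c: "continuous_on B (\<lambda>r. A (c * of_real r))" for c B
    by (intro continuous_on_compose2[OF cont] continuous_intros) auto
  have cr: "continuous_on B (\<lambda>r. A (of_real r))" for B using c[of B 1] by simp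
  fix S :: real assume S: "S \<ge> 0"
  have "contour_integral (linepath 0 (of_real S)) A = integral {0..S} (\<lambda>r. A (of_real r))"
    using contour_integral_unique[OF contour_integral_ray[OF c[of _ 1] S]] by simp
  moreover have "contour_integral (linepath 0 (- of_real S)) A = - integral {0..S} (\<lambda>r. A (- of_real r))"
    using contour_integral_unique[OF contour_integral_ray[OF c[of _ "- 1"] S]] by simp
  moreover have "integral {-S..S} (\<lambda>r. A (of_real r)) =
      integral {0..S} (\<lambda>r. A (of_real r)) + integral {0..S} (\<lambda>r. A (- of_real r))"
    unfolding integral_symmetric[OF cr S]
    by (subst integral_add) (use c[of _ "- 1"] in \<open>auto intro!: integrable_continuous_real cr\<close>)
  ultimately show "contour_integral (linepath 0 (of_real S)) A - integral {-S..S} (\<lambda>r. A (of_real r)) =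
    contour_integral (linepath 0 (- of_real S)) A" by simp
qed

section \<open>The representation formula and the Neumann value\<close>

lemma dispersion_minus [simp]: "dispersion (- k) = dispersion k"
  by (simp add: dispersion_def)

lemma exp_shift:
  "exp (\<kappa> * complex_of_real (\<tau> - t)) = exp (- \<kappa> * complex_of_real t) * exp (\<kappa> * complex_of_real \<tau>)"
proof -
  have "\<kappa> * complex_of_real (\<tau> - t) = - \<kappa> * complex_of_real t + \<kappa> * complex_of_real \<tau>"
    by (simp add: algebra_simps)
  then show ?thesis by (simp only: exp_add)
qed

lemma deriv_dispersion: "deriv dispersion k = 8 * \<i> * k"
  unfolding dispersion_def[abs_def]
  by (rule DERIV_imp_deriv) (auto intro!: derivative_eq_intros)

lemma Re_dispersion: "Re (dispersion k) = - 8 * Re k * Im k"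
  by (simp add: dispersion_def power2_eq_square)

section \<open>The boundary transform and the representation formula\<close>

lemma time_integral_holomorphic:
  fixes c :: "real \<Rightarrow> complex"
  assumes "continuous_on {0..t} c"
  shows "(\<lambda>k. integral {0..t} (\<lambda>\<tau>. exp (dispersion k * of_real (\<tau> - t)) * c \<tau>)) holomorphic_on UNIV"
proof -
  have "(\<lambda>k. integral (cbox 0 t) (\<lambda>\<tau>. exp (dispersion k * of_real (\<tau> - t)) * c \<tau>)) holomorphic_on UNIV"
  proof (rule leibniz_rule_holomorphic)
    fix k :: complex and \<tau> :: real
    show "((\<lambda>k. exp (dispersion k * of_real (\<tau> - t)) * c \<tau>) has_field_derivative
        8 * \<i> * k * of_real (\<tau> - t) * exp (dispersion k * of_real (\<tau> - t)) * c \<tau>) (at k within UNIV)"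
      unfolding dispersion_def by (auto intro!: derivative_eq_intros)
  next
    show "(\<lambda>\<tau>. exp (dispersion k * of_real (\<tau> - t)) * c \<tau>) integrable_on cbox 0 t" for k
      by (intro integrable_continuous continuous_intros) (use assms in auto)
    show "continuous_on (UNIV \<times> cbox 0 t) (\<lambda>(k, \<tau>). 8 * \<i> * k * of_real (\<tau> - t) *
        exp (dispersion k * of_real (\<tau> - t)) * c \<tau>)"
      unfolding case_prod_unfold dispersion_def
      by (intro continuous_intros continuous_on_compose2[OF assms]) auto
  qed auto
  then show ?thesis by simp
qed

context quarter_plane_solution begin

text \<open>The exponent is shifted by t so that the exponential factor is at most 1 in modulus
  wherever Re f(k) >= 0, which includes the closed fourth quadrant.\<close>

definition bdry_transform :: "real \<Rightarrow> complex \<Rightarrow> complex" where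
  "bdry_transform t k = integral {0..t} (\<lambda>\<tau>. exp (dispersion k * of_real (\<tau> - t)) * bdry k \<tau>)"

lemma bdry_transform_eq:
  "bdry_transform t k = \<i> * integral {0..t} (\<lambda>\<tau>. exp (dispersion k * of_real (\<tau> - t)) * ux 0 \<tau>)
     + 2 * k * integral {0..t} (\<lambda>\<tau>. exp (dispersion k * of_real (\<tau> - t)) * u 0 \<tau>)"
proof -
  have "bdry_transform t k = integral {0..t} (\<lambda>\<tau>. \<i> * (exp (dispersion k * of_real (\<tau> - t)) * ux 0 \<tau>)
     + 2 * k * (exp (dispersion k * of_real (\<tau> - t)) * u 0 \<tau>))"
    unfolding bdry_transform_def bdry_def by (simp add: algebra_simps)
  also have "\<dots> = integral {0..t} (\<lambda>\<tau>. \<i> * (exp (dispersion k * of_real (\<tau> - t)) * ux 0 \<tau>))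
     + integral {0..t} (\<lambda>\<tau>. 2 * k * (exp (dispersion k * of_real (\<tau> - t)) * u 0 \<tau>))"
    by (intro integral_add integrable_continuous_real continuous_intros continuous_time) auto
  finally show ?thesis by simp
qed

lemma bdry_transform_holomorphic: "bdry_transform t holomorphic_on UNIV"
  unfolding bdry_transform_eq[abs_def]
  by (intro holomorphic_intros time_integral_holomorphic continuous_time) auto

lemma hat_evolution:
  assumes "t \<ge> 0" "Im k \<ge> 0"
  shows "hat t k = exp (- dispersion k * t) * hat 0 k - bdry_transform t k"
proof -
  have E: "exp (dispersion k * of_real (\<tau> - t)) * bdry k \<tau> = exp (- dispersion k * t) * (exp (dispersion k * \<tau>) * bdry k \<tau>)" for \<tau>
    by (simp only: exp_shift mult.assoc)
  have "bdry_transform t k = exp (- dispersion k * t) * integral {0..t} (\<lambda>\<tau>. exp (dispersion k * \<tau>) * bdry k \<tau>)"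
    unfolding bdry_transform_def E by (rule integral_mult_right)
  moreover have "exp (- dispersion k * t) * (exp (dispersion k * t) * hat t k) = hat t k"
    by (simp add: exp_minus)
  ultimately show ?thesis unfolding global_relation[OF assms] by (simp only: right_diff_distrib)
qed

text \<open>On the lower half-plane the contour integrand is 2i(A + B), with A the boundary term at
  k and B the transform at time t and -k. Whatever A contributes on the imaginary axis returns with
  the opposite sign on the positive real axis, so only its integral over the whole line survives in
  J.\<close>

lemma representation:
  assumes x: "x > 0" and t: "t > 0"
  shows "\<exists>I J.
    ((\<lambda>k::real. exp (- 2 * \<i> * of_real k * of_real x - dispersion (of_real k) * of_real t)
       * hat 0 (of_real k)) has_integral I) UNIV \<and>
    (\<lambda>k. exp (- 2 * \<i> * k * of_real x - dispersion k * of_real t)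
       * (deriv dispersion k * time_transform (\<lambda>t. u 0 t) (dispersion k) t + 2 * \<i> * hat 0 (- k))) has_D3_integral J \<and>
    u x t = 1 / of_real pi * I + 1 / (2 * \<i> * of_real pi) * J"
proof -
  from t have t0: "t \<ge> 0" by simp
  obtain C0 where C0: "decays C0 (\<lambda>x. u x 0)" using solution_decays[of 0] by auto
  obtain C where C: "decays C (\<lambda>x. u x t)" "decays C (\<lambda>x. ux x t)" using solution_decays[OF t0] by blast
  obtain D where D: "\<And>k. Re (dispersion k) \<ge> 0 \<Longrightarrow> (1 + norm k) * norm (bdry_transform t k) \<le> D"
    using boundary_transform_decay[of t] t0 unfolding bdry_transform_def by auto
  let ?e = "\<lambda>k. exp (- 2 * \<i> * k * of_real x)"
  define A where "A k = ?e k * bdry_transform t k" for k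
  define B where "B k = ?e k * hat t (- k)" for k
  define h where "h k = exp (- 2 * \<i> * k * of_real x - dispersion k * of_real t)
       * (deriv dispersion k * time_transform (\<lambda>t. u 0 t) (dispersion k) t + 2 * \<i> * hat 0 (- k))" for k
  have ne: "norm (?e k) = exp (2 * x * Im k)" for k by simp
  have ed: "exp (- 2 * \<i> * k * of_real x - dispersion k * of_real t) = ?e k * exp (- dispersion k * t)" for k
    unfolding exp_add[symmetric] by simp
  have holA: "A holomorphic_on UNIV"
    unfolding A_def by (intro holomorphic_intros bdry_transform_holomorphic)
  have contA: "continuous_on S A" for S
    using holomorphic_on_imp_continuous_on[OF holA] by (rule continuous_on_subset) simp
  have contB: "continuous_on {k. Im k \<le> 0} B"
    unfolding B_def by (intro continuous_intros continuous_on_compose2[OF hat_continuous[OF t0]]) auto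
  have holB: "B holomorphic_on {k. Im k < 0}"
  proof -
    have "(hat t \<circ> uminus) holomorphic_on {k. Im k < 0}"
      unfolding hat_def
      by (rule holomorphic_on_compose_gen[OF _ half_line_fourier_holomorphic[OF C(1)]]) (auto intro!: holomorphic_intros)
    then show ?thesis unfolding B_def by (auto intro!: holomorphic_intros simp: o_def)
  qed
  have boundA: "(1 + norm k) * norm (A k) \<le> D * exp (2 * x * Im k)" if "Im k \<le> 0" "1 * Re k \<ge> 0" for k
  proof -
    have "Re (dispersion k) \<ge> 0" using that by (simp add: Re_dispersion mult_nonneg_nonpos)
    from mult_right_mono[OF D[OF this], of "exp (2 * x * Im k)"] show ?thesis
      unfolding A_def norm_mult[of "?e k"] ne by (simp add: mult_ac)
  qed
  have boundB: "(1 + norm k) * norm (B k) \<le> 2 * C * exp (2 * x * Im k)" if "Im k \<le> 0" for k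
    using mult_right_mono[OF hat_sup_bound_decays[OF t0 C, of "- k"], of "exp (2 * x * Im k)"] that
    unfolding B_def norm_mult[of "?e k"] ne by (simp add: mult_ac)
  obtain VA where VA: "((\<lambda>R. contour_integral (imaginary_ray R) A) \<longlongrightarrow> VA) at_top"
    "((\<lambda>R. contour_integral (linepath 0 (of_real (1 * R))) A) \<longlongrightarrow> - VA) at_top"
    by (rule quadrant_contour[of 1 x A D]) (use x contA holomorphic_on_subset[OF holA] boundA in auto)
  obtain VB where VB: "((\<lambda>R. contour_integral (imaginary_ray R) B) \<longlongrightarrow> VB) at_top"
    "((\<lambda>R. contour_integral (linepath 0 (of_real (- 1 * R))) B) \<longlongrightarrow> - VB) at_top"
    by (rule quadrant_contour[of "- 1" x B "2 * C"]) (use x contB holB boundB in auto)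
  let ?a = "\<lambda>k. exp (- 2 * \<i> * of_real k * of_real x - dispersion (of_real k) * of_real t)
       * hat 0 (of_real k)"
  let ?m = "\<lambda>k. ?e (of_real k) * hat t (of_real k)"
  obtain I where I: "(?a has_integral I) UNIV" "((\<lambda>S. integral {-S..S} ?a) \<longlongrightarrow> I) at_top"
    using gauss_fourier_limits[OF C0 t, of x] unfolding hat_def by blast
  have M: "((\<lambda>S. integral {-S..S} ?m) \<longlongrightarrow> of_real pi * u x t) at_top"
    using fourier_inversion[OF C has_derivs(1)[OF _ t0], of x] x unfolding hat_def by simp
  \<comment> \<open>On the real axis the global relation splits A into two parts whose symmetric
    integrals are known: the first gives \<open>I\<close>, the second inverts to pi u(x,t).\<close>
  have Aam: "A (of_real k) = ?a k - ?m k" for k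
  proof -
    have "bdry_transform t (of_real k) =
        exp (- dispersion (of_real k) * t) * hat 0 (of_real k) - hat t (of_real k)"
      using hat_evolution[OF t0, of "of_real k"] by simp
    then show ?thesis unfolding A_def ed by (simp only: right_diff_distrib mult.assoc)
  qed
  have ch: "continuous_on UNIV (\<lambda>k. hat s (of_real k))" if "s \<ge> 0" for s
    by (rule continuous_on_compose2[OF hat_continuous[OF that]]) (auto intro!: continuous_intros)
  have L: "((\<lambda>S. integral {-S..S} (\<lambda>r. A (of_real r))) \<longlongrightarrow> I - of_real pi * u x t) at_top"
  proof -
    have "integral {-S..S} (\<lambda>r. A (of_real r)) = integral {-S..S} ?a - integral {-S..S} ?m" for S
      unfolding Aam
      by (intro integral_diff integrable_continuous_real continuous_intros continuous_on_subset[OF ch])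
        (auto simp: dispersion_def intro!: continuous_intros t0)
    then show ?thesis using tendsto_diff[OF I(2) M] by simp
  qed
  have WA: "((\<lambda>S. contour_integral (linepath 0 (- of_real S)) A) \<longlongrightarrow> - VA - (I - of_real pi * u x t)) at_top"
    by (rule real_axis_contour_tendsto[OF contA L]) (use VA(2) in simp)
  \<comment> \<open>As f is even, the Neumann data drop out of the difference of the boundary
    transforms at k and -k. The Dirichlet data remain with the factor 4k = f'(k)/(2i). The relation
    at -k, valid for Im k <= 0, replaces the initial transform.\<close>
  have hAB: "h k = 2 * \<i> * (A k + B k)" if "Im k \<le> 0" for k
  proof -
    let ?T = "integral {0..t} (\<lambda>\<tau>. exp (dispersion k * of_real (\<tau> - t)) * u 0 \<tau>)"
    have "exp (dispersion k * of_real (\<tau> - t)) * u 0 \<tau> = exp (- dispersion k * t) * (exp (dispersion k * \<tau>) * u 0 \<tau>)" for \<tau>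
      by (simp only: exp_shift mult.assoc)
    then have T: "exp (- dispersion k * t) * time_transform (\<lambda>t. u 0 t) (dispersion k) t = ?T"
      unfolding time_transform_def by (simp only: integral_mult_right)
    have "bdry_transform t k - bdry_transform t (- k) = 4 * k * ?T"
      unfolding bdry_transform_eq by simp
    moreover have "exp (- dispersion k * t) * hat 0 (- k) = hat t (- k) + bdry_transform t (- k)"
      using hat_evolution[OF t0, of "- k"] that by simp
    ultimately have "8 * \<i> * k * ?T + 2 * \<i> * (exp (- dispersion k * t) * hat 0 (- k)) = 2 * \<i> * (bdry_transform t k + hat t (- k))"
      by (simp add: algebra_simps)
    moreover have "h k = ?e k * (8 * \<i> * k * (exp (- dispersion k * t) * time_transform (\<lambda>t. u 0 t) (dispersion k) t)
        + 2 * \<i> * (exp (- dispersion k * t) * hat 0 (- k)))"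
      unfolding h_def deriv_dispersion ed by (simp add: algebra_simps del: exp_minus)
    ultimately show ?thesis unfolding T A_def B_def by (simp add: algebra_simps)
  qed
  have seg: "closed_segment p q \<subseteq> {k. Im k \<le> 0}" if "Im p \<le> 0" "Im q \<le> 0" for p q
    using that by (intro closed_segment_subset) (auto simp: convex_halfspace_Im_le)
  have ci: "contour_integral (linepath p q) h = 2 * \<i> * (contour_integral (linepath p q) A + contour_integral (linepath p q) B)"
    if "Im p \<le> 0" "Im q \<le> 0" for p q
  proof -
    have "contour_integral (linepath p q) h = contour_integral (linepath p q) (\<lambda>k. 2 * \<i> * (A k + B k))"
      by (rule contour_integral_cong) (use seg[OF that] hAB in auto)
    also have "\<dots> = 2 * \<i> * contour_integral (linepath p q) (\<lambda>k. A k + B k)"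
      by (intro contour_integral_lmul contour_integrable_continuous_linepath continuous_intros contA continuous_on_subset[OF contB seg[OF that]])
    also have "contour_integral (linepath p q) (\<lambda>k. A k + B k) = contour_integral (linepath p q) A + contour_integral (linepath p q) B"
      by (intro contour_integral_add contour_integrable_continuous_linepath contA continuous_on_subset[OF contB seg[OF that]])
    finally show ?thesis .
  qed
  have hc: "continuous_on (closed_segment p q) h" if "Im p \<le> 0" "Im q \<le> 0" for p q
  proof -
    have "continuous_on (closed_segment p q) (\<lambda>k. 2 * \<i> * (A k + B k))"
      by (intro continuous_intros contA continuous_on_subset[OF contB seg[OF that]])
    then show ?thesis
      by (rule continuous_on_eq) (use seg[OF that] hAB in auto)
  qed
  \<comment> \<open>\<open>VA\<close> and \<open>VB\<close> each cancel between the two rays. What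
    remains is minus the symmetric integral of A.\<close>
  have "h has_D3_integral 2 * \<i> * (VA + VB) + 2 * \<i> * ((- VA - (I - of_real pi * u x t)) + - VB)"
  proof (rule has_D3_integral_split)
    show "((\<lambda>R. contour_integral (imaginary_ray R) h) \<longlongrightarrow> 2 * \<i> * (VA + VB)) at_top"
      by (rule tendsto_at_top_transform[OF tendsto_mult_left[OF tendsto_add[OF VA(1) VB(1)]]]) (rule ci[symmetric], auto)
    have VB2: "((\<lambda>S. contour_integral (linepath 0 (- of_real S)) B) \<longlongrightarrow> - VB) at_top" using VB(2) by simp
    show "((\<lambda>S. contour_integral (linepath 0 (- of_real S)) h) \<longlongrightarrow>
        2 * \<i> * ((- VA - (I - of_real pi * u x t)) + - VB)) at_top"
      by (rule tendsto_at_top_transform[OF tendsto_mult_left[OF tendsto_add[OF WA VB2]]]) (rule ci[symmetric], auto)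
  qed (auto intro!: hc)
  also have "2 * \<i> * (VA + VB) + 2 * \<i> * ((- VA - (I - of_real pi * u x t)) + - VB) = 2 * \<i> * (of_real pi * u x t - I)"
    by (simp add: algebra_simps)
  finally have J: "h has_D3_integral 2 * \<i> * (of_real pi * u x t - I)" .
  show ?thesis
    by (intro exI conjI, rule I(1), rule J[unfolded h_def]) (simp add: field_simps)
qed

end

section \<open>The Neumann value: Fresnel and Abel integrals\<close>

abbreviation fresnel_integral :: "real \<Rightarrow> real \<Rightarrow> real \<Rightarrow> complex" where
  "fresnel_integral \<sigma> \<tau> S \<equiv> integral {0..S} (\<lambda>r. exp (- (\<i> * of_real (\<sigma> * (4 * \<tau> * r\<^sup>2)))))"

text \<open>The case \<kappa> = 0 of the completed square. The second claim is uniform in the length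
  S, and its singularity 1/sqrt(\<tau>) is integrable when \<tau> = t - s runs down to 0.\<close>

lemma fresnel_tendsto:
  fixes \<sigma> \<tau> :: real
  assumes \<sigma>: "\<sigma> = 1 \<or> \<sigma> = - 1" and \<tau>: "\<tau> > 0"
  shows "((\<lambda>S. fresnel_integral \<sigma> \<tau> S) \<longlongrightarrow>
      of_real (sqrt pi / 2) / ((1 + \<i> * \<sigma>) * of_real (sqrt 2)) / of_real (sqrt \<tau>)) at_top"
    and fresnel_bound: "\<lbrakk>\<And>w. norm (gauss_diagonal \<sigma> w) \<le> B; S \<ge> 0\<rbrakk> \<Longrightarrow>
      norm (fresnel_integral \<sigma> \<tau> S) \<le> B / sqrt \<tau>"
proof -
  let ?l = "(1 + \<i> * \<sigma>) * of_real (sqrt (2 * \<tau>))"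
  let ?G = "\<lambda>w. gauss_diagonal \<sigma> (sqrt (2 * \<tau>) * w)"
  have I: "fresnel_integral \<sigma> \<tau> S = ?G S / ?l" if "S \<ge> 0" for S
    using integral_unique[OF fresnel_has_integral[OF \<sigma> \<tau> that, of 0]] by (simp add: gauss_primitive_0)
  have sq: "sqrt (2 * \<tau>) > 0" using \<tau> by simp
  have "((\<lambda>S. ?G S / ?l) \<longlongrightarrow> of_real (sqrt pi / 2) / ?l) at_top"
    using gauss_primitive_ray_tendsto(1)[OF \<sigma> sq, of 0] one_plus_i_squared(2)[OF \<sigma>] sq
    by (intro tendsto_divide tendsto_const) auto
  also have "?l = (1 + \<i> * \<sigma>) * of_real (sqrt 2) * of_real (sqrt \<tau>)" by (simp add: real_sqrt_mult)
  finally have "((\<lambda>S. ?G S / ((1 + \<i> * \<sigma>) * of_real (sqrt 2) * of_real (sqrt \<tau>))) \<longlongrightarrow>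
      of_real (sqrt pi / 2) / ((1 + \<i> * \<sigma>) * of_real (sqrt 2) * of_real (sqrt \<tau>))) at_top" .
  then show "((\<lambda>S. fresnel_integral \<sigma> \<tau> S) \<longlongrightarrow>
      of_real (sqrt pi / 2) / ((1 + \<i> * \<sigma>) * of_real (sqrt 2)) / of_real (sqrt \<tau>)) at_top"
    unfolding divide_divide_eq_left
    by (rule tendsto_at_top_transform) (simp only: I, simp add: real_sqrt_mult mult.assoc)
  show "norm (fresnel_integral \<sigma> \<tau> S) \<le> B / sqrt \<tau>"
    if B: "\<And>w. norm (gauss_diagonal \<sigma> w) \<le> B" and S: "S \<ge> 0"
  proof -
    have B0: "B \<ge> 0" using B[of 0] norm_ge_zero order_trans by blast
    have "norm (1 + \<i> * \<sigma>) \<ge> 1" using abs_Re_le_cmod[of "1 + \<i> * \<sigma>"] by simp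
    moreover have "sqrt (2 * \<tau>) \<ge> sqrt \<tau>" using \<tau> by simp
    ultimately have "1 * sqrt \<tau> \<le> norm (1 + \<i> * \<sigma>) * sqrt (2 * \<tau>)" using \<tau> by (intro mult_mono) auto
    also have "\<dots> = norm ?l" using \<tau> by (simp add: norm_mult)
    finally have "sqrt \<tau> \<le> norm ?l" by simp
    then show ?thesis
      unfolding I[OF S] norm_divide using B0 \<tau> B[of "sqrt (2 * \<tau>) * S"]
      by (auto intro!: frac_le simp del: of_real_mult)
  qed
qed

lemma inverse_sqrt_has_integral:
  fixes t :: real
  assumes "t > 0"
  shows "((\<lambda>s. 1 / sqrt (t - s)) has_integral 2 * sqrt t) {0..t}"
proof -
  have "((\<lambda>s. 1 / sqrt (t - s)) has_integral - 2 * sqrt (t - t) - (- 2 * sqrt (t - 0))) {0..t}"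
  proof (rule fundamental_theorem_of_calculus_interior)
    show "continuous_on {0..t} (\<lambda>s. - 2 * sqrt (t - s))" by (intro continuous_intros)
    fix s assume "s \<in> {0<..<t}"
    then show "((\<lambda>s. - 2 * sqrt (t - s)) has_vector_derivative 1 / sqrt (t - s)) (at s)"
      unfolding has_real_derivative_iff_has_vector_derivative[symmetric]
      by (auto intro!: derivative_eq_intros simp: field_simps)
  qed (use assms in simp)
  then show ?thesis by simp
qed

context quarter_plane_solution begin

definition abel_integral :: "real \<Rightarrow> complex" where
  "abel_integral t = integral {0..t} (\<lambda>s. ut 0 s / of_real (sqrt (t - s)))"

definition qfun :: "real \<Rightarrow> complex \<Rightarrow> complex" where
  "qfun t k = u 0 t - dispersion k * integral {0..t} (\<lambda>s. exp (dispersion k * of_real (s - t)) * u 0 s)"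

text \<open>Integration by parts in s removes the growing factor f(k) and cancels u(0,t). On the
  rays only oscillating exponentials are left, and the derivative u_t(0,s) of the Abel integral
  appears.\<close>

lemma qfun_eq:
  assumes "t \<ge> 0"
  shows "qfun t k = exp (- dispersion k * t) * u 0 0 + integral {0..t} (\<lambda>s. exp (dispersion k * of_real (s - t)) * ut 0 s)"
proof -
  let ?f = "dispersion k" and ?e = "\<lambda>s. exp (dispersion k * of_real (s - t))"
  have "((\<lambda>s. ?f * (?e s * u 0 s) + ?e s * ut 0 s) has_integral ?e t * u 0 t - ?e 0 * u 0 0) {0..t}"
  proof (rule fundamental_theorem_of_calculus[OF assms])
    fix s assume s: "s \<in> {0..t}"
    have d1: "((\<lambda>s. u 0 s) has_vector_derivative ut 0 s) (at s within {0..t})"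
      using has_derivs(3)[of 0 s] s by (auto intro: has_vector_derivative_within_subset)
    have d2: "(?e has_vector_derivative ?e s * ?f) (at s within {0..t})"
      unfolding of_real_diff by (rule has_vector_derivative_real_field) (auto intro!: derivative_eq_intros)
    show "((\<lambda>s. ?e s * u 0 s) has_vector_derivative ?f * (?e s * u 0 s) + ?e s * ut 0 s) (at s within {0..t})"
      by (rule has_vector_derivative_eq_rhs[OF has_vector_derivative_mult[OF d2 d1]]) (simp add: algebra_simps)
  qed
  moreover have "((\<lambda>s. ?f * (?e s * u 0 s) + ?e s * ut 0 s) has_integral
      ?f * integral {0..t} (\<lambda>s. ?e s * u 0 s) + integral {0..t} (\<lambda>s. ?e s * ut 0 s)) {0..t}"
    by (intro has_integral_add has_integral_mult_right integrable_integral integrable_continuous_real continuous_intros continuous_time) auto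
  ultimately have "?e t * u 0 t - ?e 0 * u 0 0 = ?f * integral {0..t} (\<lambda>s. ?e s * u 0 s) + integral {0..t} (\<lambda>s. ?e s * ut 0 s)"
    by (rule has_integral_unique)
  then show ?thesis unfolding qfun_def by (simp add: algebra_simps)
qed

lemma qfun_continuous: "t \<ge> 0 \<Longrightarrow> continuous_on A (qfun t)"
proof -
  have "qfun t holomorphic_on UNIV"
    unfolding qfun_def
    by (intro holomorphic_intros time_integral_holomorphic continuous_time)
      (auto simp: dispersion_def[abs_def] intro!: holomorphic_intros)
  then show ?thesis by (rule continuous_on_subset[OF holomorphic_on_imp_continuous_on]) simp
qed

text \<open>On a ray \<open>k = cr\<close> with \<open>c\<^sup>2 = \<sigma>\<close> the exponential \<open>e\<^bsup>-ft\<^esup>\<close> oscillates, and exchanging the integrals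
  leaves Fresnel integrals that converge boundedly after division by \<open>\<surd>(t - s)\<close>.\<close>

lemma qfun_ray:
  fixes \<sigma> t :: real
  assumes \<sigma>: "\<sigma> = 1 \<or> \<sigma> = - 1" and c: "c\<^sup>2 = of_real \<sigma>" and t: "t > 0"
  shows "(\<lambda>s. ut 0 s / of_real (sqrt (t - s))) integrable_on {0..t}"
    and "((\<lambda>S. integral {0..S} (\<lambda>r. qfun t (c * of_real r))) \<longlongrightarrow>
      of_real (sqrt pi / 2) / ((1 + \<i> * \<sigma>) * of_real (sqrt 2)) * (u 0 0 / of_real (sqrt t) + abel_integral t)) at_top"
proof -
  let ?K = "of_real (sqrt pi / 2) / ((1 + \<i> * \<sigma>) * of_real (sqrt 2))"
  let ?E = "\<lambda>\<tau> r. exp (- (\<i> * of_real (\<sigma> * (4 * \<tau> * r\<^sup>2))))"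
  from t have t0: "t \<ge> 0" by simp
  have f: "dispersion (c * of_real r) = \<i> * of_real (\<sigma> * (4 * r\<^sup>2))" for r
    by (simp add: dispersion_def power_mult_distrib c)
  have q: "qfun t (c * of_real r) = ?E t r * u 0 0 + integral {0..t} (\<lambda>s. ?E (t - s) r * ut 0 s)" for r
  proof -
    have "exp (dispersion (c * of_real r) * of_real (s - t)) = ?E (t - s) r" for s
      unfolding f by (simp add: algebra_simps)
    moreover have "exp (- dispersion (c * of_real r) * of_real t) = ?E t r"
      unfolding f by (simp add: algebra_simps)
    ultimately show ?thesis unfolding qfun_eq[OF t0] by simp
  qed
  have cu: "continuous_on {0..t} (\<lambda>s. ut 0 s)" by (rule continuous_time) auto
  obtain M where M: "\<And>s. s \<in> {0..t} \<Longrightarrow> norm (ut 0 s) \<le> M"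
    using bounded_on_time_interval[OF cu] by blast
  obtain B where B: "B \<ge> 0" "\<And>w. norm (gauss_diagonal \<sigma> w) \<le> B"
    using gauss_primitive_ray_bounded[OF \<sigma>] by blast
  have c2: "continuous_on (X \<times> {0..t}) (\<lambda>(r, s). ?E (t - s) r * ut 0 s)" for X
    unfolding case_prod_unfold by (intro continuous_intros continuous_on_compose2[OF cu]) auto
  \<comment> \<open>At s = t the phase vanishes and the inner integral grows like S, so this one
    point is reset to 0. The value agrees with the limit claimed below, where division by sqrt(0)
    yields 0.\<close>
  define F where "F S s = (if s = t then 0 else integral {0..S} (\<lambda>r. ?E (t - s) r) * ut 0 s)" for S s
  have swap: "integral {0..S} (\<lambda>r. qfun t (c * of_real r)) =
      integral {0..S} (\<lambda>r. ?E t r) * u 0 0 + integral {0..t} (F S)" for S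
  proof -
    have "integral {0..S} (\<lambda>r. qfun t (c * of_real r)) =
      integral {0..S} (\<lambda>r. ?E t r * u 0 0) + integral {0..S} (\<lambda>r. integral {0..t} (\<lambda>s. ?E (t - s) r * ut 0 s))"
      unfolding q
    proof (rule integral_add)
      show "(\<lambda>r. ?E t r * u 0 0) integrable_on {0..S}" by (intro integrable_continuous_real continuous_intros)
      show "(\<lambda>r. integral {0..t} (\<lambda>s. ?E (t - s) r * ut 0 s)) integrable_on {0..S}"
        using integral_continuous_on_param[of "{0..S}" 0 t "\<lambda>r s. ?E (t - s) r * ut 0 s"] c2
        by (intro integrable_continuous_real) simp
    qed
    also have "integral {0..S} (\<lambda>r. integral {0..t} (\<lambda>s. ?E (t - s) r * ut 0 s)) =
        integral {0..t} (\<lambda>s. integral {0..S} (\<lambda>r. ?E (t - s) r * ut 0 s))"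
      using integral_swap_continuous[of 0 0 S t "\<lambda>r s. ?E (t - s) r * ut 0 s"] c2[of "{0..S}"] cbox_Pair_eq[of 0 0 S t] by simp
    also have "\<dots> = integral {0..t} (F S)"
      by (rule integral_spike[of "{t}"]) (auto simp: F_def)
    finally show ?thesis by simp
  qed
  have Fi: "F S integrable_on {0..t}" for S
  proof (rule integrable_spike_finite[of "{t}"])
    have "continuous_on ({0..t} \<times> cbox 0 S) (\<lambda>(s, r). ?E (t - s) r)"
      unfolding case_prod_unfold by (intro continuous_intros)
    from integral_continuous_on_param[OF this]
    show "(\<lambda>s. integral {0..S} (\<lambda>r. ?E (t - s) r) * ut 0 s) integrable_on {0..t}"
      by (intro integrable_continuous_real continuous_intros cu) simp
  qed (auto simp: F_def)
  have bound: "norm (F S s) \<le> B * M * (1 / sqrt (t - s))" if "S \<ge> 0" "s \<in> {0..t}" for S s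
  proof (cases "s = t")
    case False
    then have "t - s > 0" using that by simp
    from mult_mono[OF fresnel_bound[OF \<sigma> this B(2) that(1)] M[OF that(2)]] B(1) \<open>t - s > 0\<close>
    show ?thesis using False by (simp add: F_def norm_mult)
  qed (simp add: F_def)
  have conv: "((\<lambda>S. F S s) \<longlongrightarrow> ?K * (ut 0 s / of_real (sqrt (t - s)))) at_top" if "s \<in> {0..t}" for s
  proof (cases "s = t")
    case False
    then have "t - s > 0" using that by simp
    from tendsto_mult[OF fresnel_tendsto(1)[OF \<sigma> this] tendsto_const[of "ut 0 s"]]
    show ?thesis using False by (simp add: F_def mult_ac)
  qed (simp add: F_def)
  note bi = has_integral_integrable[OF has_integral_mult_right[OF inverse_sqrt_has_integral[OF t], of "B * M"]]
  note D = dominated_convergence_at_top[OF Fi bi bound conv]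
  have K0: "?K \<noteq> 0" using one_plus_i_squared(2)[OF \<sigma>] by simp
  \<comment> \<open>Dominated convergence delivers integrability of \<open>?K\<close> times the Abel
    integrand; the nonzero constant is divided out.\<close>
  show "(\<lambda>s. ut 0 s / of_real (sqrt (t - s))) integrable_on {0..t}"
    using integrable_on_mult_right[OF D(1), of "1 / ?K"] K0 by (simp only: mult.assoc[symmetric] nonzero_divide_eq_eq) simp
  have "((\<lambda>S. integral {0..S} (\<lambda>r. ?E t r) * u 0 0 + integral {0..t} (F S)) \<longlongrightarrow>
      ?K / of_real (sqrt t) * u 0 0 + ?K * abel_integral t) at_top"
    unfolding abel_integral_def
    using D(2) by (intro tendsto_intros fresnel_tendsto(1)[OF \<sigma> t]) (simp only: integral_mult_right)
  then show "((\<lambda>S. integral {0..S} (\<lambda>r. qfun t (c * of_real r))) \<longlongrightarrow>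
      ?K * (u 0 0 / of_real (sqrt t) + abel_integral t)) at_top"
    unfolding swap by (simp add: distrib_left)
qed

text \<open>Both rays contribute the same amount. The imaginary one, with direction -i and \<sigma>
  = -1, is traversed inwards and gives i/(1-i) = -1/(1+i) in place of the -1/(1+i) of the negative
  real axis.\<close>

lemma qfun_D3:
  assumes t: "t > 0"
  shows "qfun t has_D3_integral - 2 * (of_real (sqrt pi / 2) / ((1 + \<i>) * of_real (sqrt 2)) *
     (u 0 0 / of_real (sqrt t) + abel_integral t))"
proof -
  from t have t0: "t \<ge> 0" by simp
  let ?X = "u 0 0 / of_real (sqrt t) + abel_integral t"
  let ?K = "\<lambda>\<sigma>. of_real (sqrt pi / 2) / ((1 + \<i> * of_real \<sigma>) * of_real (sqrt 2))"
  have c: "continuous_on A (\<lambda>r. qfun t (c * of_real r))" for A c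
    by (rule continuous_on_compose2[OF qfun_continuous[OF t0, of UNIV]]) (auto intro!: continuous_intros)
  have ray: "((\<lambda>R. contour_integral (linepath 0 (c * of_real R)) (qfun t)) \<longlongrightarrow> c * (?K \<sigma> * ?X)) at_top"
    if "\<sigma> = 1 \<or> \<sigma> = - 1" "c\<^sup>2 = of_real \<sigma>" for c and \<sigma> :: real
    by (rule tendsto_at_top_transform[OF tendsto_mult_left[OF qfun_ray(2)[OF that t]]])
      (simp add: contour_integral_unique[OF contour_integral_ray[OF c]])
  have W: "((\<lambda>R. contour_integral (linepath 0 (- of_real R)) (qfun t)) \<longlongrightarrow> - (?K 1 * ?X)) at_top"
    using ray[of 1 "- 1"] by simp
  have "((\<lambda>R. - contour_integral (linepath 0 (- \<i> * of_real R)) (qfun t)) \<longlongrightarrow> - (- \<i> * (?K (- 1) * ?X))) at_top"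
    by (intro tendsto_minus ray) (auto simp: power2_eq_square)
  moreover have "- contour_integral (linepath 0 (- \<i> * of_real R)) (qfun t) = contour_integral (imaginary_ray R) (qfun t)" for R
    by (rule contour_integral_reverse_linepath[symmetric]) (rule qfun_continuous[OF t0])
  moreover have "\<i> * ?K (- 1) = - ?K 1"
  proof -
    have "1 - \<i> \<noteq> 0" "1 + \<i> \<noteq> 0" by (simp_all add: complex_eq_iff)
    then have i: "\<i> / (1 - \<i>) = - (1 / (1 + \<i>))" by (simp add: field_simps)
    have "\<i> * (P / ((1 - \<i>) * Q)) = \<i> / (1 - \<i>) * (P / Q)" for P Q by simp
    then have "\<i> * (P / ((1 - \<i>) * Q)) = - (P / ((1 + \<i>) * Q))" for P Q by (simp add: i)
    from this[of "of_real (sqrt pi / 2)" "of_real (sqrt 2)"] show ?thesis by simp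
  qed
  then have "- (- \<i> * (?K (- 1) * ?X)) = - (?K 1 * ?X)"
    by (metis (no_types, lifting) minus_mult_left mult.assoc minus_minus)
  ultimately have V: "((\<lambda>R. contour_integral (imaginary_ray R) (qfun t)) \<longlongrightarrow> - (?K 1 * ?X)) at_top"
    by simp
  have "qfun t has_D3_integral - (?K 1 * ?X) + - (?K 1 * ?X)"
    by (rule has_D3_integral_split[OF _ _ V W]) (rule qfun_continuous[OF t0])+
  then show ?thesis by simp
qed

text \<open>\<open>K\<close> is the Fresnel constant: the integral of exp(-4i\<tau>r^2) over r > 0
  is K/sqrt(\<tau>). The factor pi/2 on the left is the half value of inversion at x = 0. The corner
  value u(0,0) is kept in both terms of the last bracket so that its second term remains visible as
  the ray integral of \<open>qfun\<close>.\<close>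

lemma neumann_value:
  assumes t: "t > 0"
  defines "A \<equiv> integral {0..} (\<lambda>y. exp (\<i> * of_real (y\<^sup>2 / (4 * t))) * ux y 0)"
    and "K \<equiv> of_real (sqrt pi / 2) / ((1 + \<i>) * of_real (sqrt 2))"
  shows "of_real (pi / 2) * ux 0 t =
    2 * K / of_real (sqrt t) * A + 2 * (u 0 0 * K / of_real (sqrt t) - K * (u 0 0 / of_real (sqrt t) + abel_integral t))"
proof -
  from t have t0: "t \<ge> 0" by simp
  obtain C0 where C0: "decays C0 (\<lambda>x. u x 0)" "decays C0 (\<lambda>x. ux x 0)" using solution_decays[of 0] by auto
  obtain C where C: "decays C (\<lambda>x. u x t)" "decays C (\<lambda>x. ux x t)" "decays C (\<lambda>x. uxx x t)" using solution_decays[OF t0] by blast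
  let ?k = of_real
  define N0 where "N0 k = exp (- dispersion (?k k) * t) * half_line_fourier (\<lambda>x. ux x 0) (?k k)" for k
  define N where "N k = half_line_fourier (\<lambda>x. ux x t) (?k k)" for k
  have ch: "continuous_on UNIV (\<lambda>k. half_line_fourier v (?k k))" if "decays D v" for D v
    by (rule continuous_on_compose2[OF half_line_fourier_continuous[OF that]]) (auto intro!: continuous_intros)
  have cN: "continuous_on UNIV N" unfolding N_def by (rule ch[OF C(2)])
  have cN0: "continuous_on UNIV N0" unfolding N0_def dispersion_def by (intro continuous_intros ch[OF C0(2)])
  have sym: "N r - N0 r + (N (- r) - N0 (- r)) = 2 * (exp (- dispersion (?k r) * t) * u 0 0 - qfun t (?k r))" for r
  proof -
    let ?e = "exp (- dispersion (?k r) * t)"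
    have *: "half_line_fourier (\<lambda>x. ux x t) k - exp (- dispersion k * t) * half_line_fourier (\<lambda>x. ux x 0) k =
        exp (- dispersion k * t) * u 0 0 - u 0 t + 2 * \<i> * k * bdry_transform t k" if "Im k \<ge> 0" for k
    proof -
      have h: "half_line_fourier (\<lambda>x. ux x t) k = - u 0 t - 2 * \<i> * k * hat t k"
        "half_line_fourier (\<lambda>x. ux x 0) k = - u 0 0 - 2 * \<i> * k * hat 0 k"
        unfolding hat_def using half_line_fourier_deriv[OF C(1,2) has_derivs(1)[OF _ t0] that]
          half_line_fourier_deriv[OF C0 has_derivs(1)[OF _ order_refl] that] by auto
      show ?thesis unfolding h hat_evolution[OF t0 that] by (simp add: algebra_simps)
    qed
    have "N r - N0 r + (N (- r) - N0 (- r)) = 2 * (?e * u 0 0 - u 0 t) + 2 * \<i> * ?k r * (bdry_transform t (?k r) - bdry_transform t (- ?k r))"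
    proof -
      have n1: "N r - N0 r = ?e * u 0 0 - u 0 t + 2 * \<i> * ?k r * bdry_transform t (?k r)"
        unfolding N_def N0_def by (rule *) simp
      have n2: "N (- r) - N0 (- r) = ?e * u 0 0 - u 0 t + 2 * \<i> * (- ?k r) * bdry_transform t (- ?k r)"
        using *[of "- ?k r"] by (simp add: N_def N0_def)
      show ?thesis unfolding n1 n2 by (simp add: algebra_simps)
    qed
    \<comment> \<open>The Neumann data cancel in the difference, the Dirichlet data double: 2ik
      times 4k is 2f(k), which is the factor inside \<open>qfun\<close>.\<close>
    also have "2 * \<i> * ?k r * (bdry_transform t (?k r) - bdry_transform t (- ?k r)) = 2 * (u 0 t - qfun t (?k r))"
      unfolding bdry_transform_eq qfun_def by (simp add: dispersion_def power2_eq_square algebra_simps)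
    finally show ?thesis by (simp add: algebra_simps)
  qed
  \<comment> \<open>The identity holds for every finite S. Its four integrals converge separately,
    so limits are taken term by term.\<close>
  have exact: "integral {-S..S} N - integral {-S..S} N0 =
      2 * (integral {0..S} (\<lambda>r. exp (- dispersion (?k r) * t)) * u 0 0 - integral {0..S} (\<lambda>r. qfun t (?k r)))" if S: "S \<ge> 0" for S
  proof -
    have "integral {-S..S} N - integral {-S..S} N0 = integral {-S..S} (\<lambda>r. N r - N0 r)"
      by (intro integral_diff[symmetric] integrable_continuous_real continuous_on_subset[OF cN] continuous_on_subset[OF cN0]) auto
    also have "\<dots> = integral {0..S} (\<lambda>r. 2 * (exp (- dispersion (?k r) * t) * u 0 0 - qfun t (?k r)))"
      unfolding integral_symmetric[OF continuous_on_diff[OF cN cN0] S] sym ..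
    also have "\<dots> = 2 * integral {0..S} (\<lambda>r. exp (- dispersion (?k r) * t) * u 0 0 - qfun t (?k r))"
      by (rule integral_mult_right)
    also have "integral {0..S} (\<lambda>r. exp (- dispersion (?k r) * t) * u 0 0 - qfun t (?k r)) =
        integral {0..S} (\<lambda>r. exp (- dispersion (?k r) * t) * u 0 0) - integral {0..S} (\<lambda>r. qfun t (?k r))"
      by (intro integral_diff integrable_continuous_real continuous_intros continuous_on_compose2[OF qfun_continuous[OF t0, of UNIV]])
        (auto simp: dispersion_def intro!: continuous_intros)
    finally show ?thesis by simp
  qed
  have lN: "((\<lambda>S. integral {-S..S} N) \<longlongrightarrow> of_real (pi / 2) * ux 0 t) at_top"
    using fourier_inversion[OF C(2,3) has_derivs(2)[OF _ t0], of 0] by (simp add: N_def[abs_def])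
  have s1: "(1::real) = 1 \<or> (1::real) = - 1" by simp
  have "of_real (sqrt pi) / ((1 + \<i>) * of_real (sqrt (2 * t))) = 2 * K / of_real (sqrt t)"
    by (simp add: K_def real_sqrt_mult)
  then have lN0: "((\<lambda>S. integral {-S..S} N0) \<longlongrightarrow> 2 * K / of_real (sqrt t) * A) at_top"
    using gauss_fourier_limits(2)[OF C0(2) t, of 0] by (simp add: N0_def[abs_def] A_def)
  have "exp (- dispersion (?k r) * t) = exp (- (\<i> * of_real (1 * (4 * t * r\<^sup>2))))" for r
    by (simp add: dispersion_def algebra_simps)
  then have lE: "((\<lambda>S. integral {0..S} (\<lambda>r. exp (- dispersion (?k r) * t))) \<longlongrightarrow> K / of_real (sqrt t)) at_top"
    using fresnel_tendsto(1)[OF s1 t] by (simp add: K_def)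
  have lq: "((\<lambda>S. integral {0..S} (\<lambda>r. qfun t (?k r))) \<longlongrightarrow> K * (u 0 0 / of_real (sqrt t) + abel_integral t)) at_top"
    using qfun_ray(2)[OF s1 _ t, of 1] by (simp add: K_def)
  let ?L = "2 * K / of_real (sqrt t) * A + 2 * (K / of_real (sqrt t) * u 0 0 - K * (u 0 0 / of_real (sqrt t) + abel_integral t))"
  have "((\<lambda>S. integral {-S..S} N0 + 2 * (integral {0..S} (\<lambda>r. exp (- dispersion (?k r) * t)) * u 0 0 - integral {0..S} (\<lambda>r. qfun t (?k r)))) \<longlongrightarrow> ?L) at_top"
    by (intro tendsto_add lN0 tendsto_mult_left tendsto_diff tendsto_mult_right lE lq)
  then have "((\<lambda>S. integral {-S..S} N) \<longlongrightarrow> ?L) at_top"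
    by (rule tendsto_at_top_transform) (simp only: exact[symmetric], simp)
  from tendsto_unique[OF _ lN this] show ?thesis by (simp add: mult_ac)
qed

lemma initial_fresnel_integrable:
  assumes "t > 0"
  shows "(\<lambda>y. exp (\<i> * of_real (y\<^sup>2 / (4 * t))) * ux y 0) integrable_on {0..}"
proof -
  obtain C where C: "decays C (\<lambda>x. ux x 0)" using solution_decays[of 0] by auto
  have "decays (1 * C) (\<lambda>y. exp (\<i> * of_real (y\<^sup>2 / (4 * t))) * ux y 0)"
  proof (rule decays_mult[OF C])
    show "continuous_on {0..} (\<lambda>y. exp (\<i> * of_real (y\<^sup>2 / (4 * t))))"
      using assms by (intro continuous_intros) auto
    show "norm (exp (\<i> * of_real (y\<^sup>2 / (4 * t)))) \<le> 1" for y
      by (simp only: norm_exp_i_times order_refl)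
  qed
  then show ?thesis by (rule decays_integrable(1)) simp
qed

text \<open>1/(1+i) = (1-i)/2 = exp(-i pi/4)/sqrt(2). The factor 4/pi combines 2/pi, which undoes
  the half value of inversion, with the 2 that all terms of the Neumann identity share.\<close>

lemma neumann_constant:
  "4 * (of_real (sqrt pi / 2) / ((1 + \<i>) * of_real (sqrt 2))) / of_real pi
     = exp (- \<i> * of_real pi / 4) / of_real (sqrt pi)"
proof -
  have "exp (- \<i> * of_real pi / 4) = cis (- (pi / 4))"
    by (simp add: cis_conv_exp)
  also have "\<dots> = (1 - \<i>) * of_real (sqrt 2 / 2)"
    by (simp add: complex_eq_iff cos_45 sin_45)
  finally have e: "exp (- \<i> * of_real pi / 4) = (1 - \<i>) * of_real (sqrt 2 / 2)" .
  have "1 + \<i> \<noteq> 0" by (simp add: complex_eq_iff)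
  then have i: "1 / (1 + \<i>) = (1 - \<i>) / 2" by (simp add: field_simps)
  have p: "of_real pi = of_real (sqrt pi) * of_real (sqrt pi)"
    by (simp flip: of_real_mult)
  have s: "1 / complex_of_real (sqrt 2) = complex_of_real (sqrt 2 / 2)"
  proof -
    have "1 / sqrt 2 = sqrt 2 / (2::real)" by (simp add: field_simps)
    then have "complex_of_real (1 / sqrt 2) = complex_of_real (sqrt 2 / 2)" by (simp only:)
    then show ?thesis by simp
  qed
  have "4 * (of_real (sqrt pi / 2) / ((1 + \<i>) * of_real (sqrt 2))) / of_real pi =
      2 * (1 / (1 + \<i>)) * (1 / of_real (sqrt 2)) * (of_real (sqrt pi) / of_real pi)"
    by simp
  also have "\<dots> = (1 - \<i>) * of_real (sqrt 2 / 2) * (1 / of_real (sqrt pi))"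
    unfolding i s by (subst p) (simp add: field_simps)
  finally show ?thesis unfolding e by simp
qed

text \<open>Initial and Dirichlet data meet at the corner, where both equal u(0,0); hence the shape
  \<open>u 0 0 - u 0 0\<close>. The two formulas are one identity grouped in two ways, the second
  isolating the value of the contour integral of \<open>qfun\<close>.\<close>

lemma neumann_formulas:
  assumes t: "t > 0"
  defines "A \<equiv> integral {0..} (\<lambda>y. exp (\<i> * of_real (y\<^sup>2 / (4 * t))) * ux y 0)"
    and "K \<equiv> of_real (sqrt pi / 2) / ((1 + \<i>) * of_real (sqrt 2))"
  shows "ux 0 t = exp (- \<i> * of_real pi / 4) / of_real (sqrt pi)
        * ((u 0 0 - u 0 0) / of_real (sqrt t) + 1 / of_real (sqrt t) * A - abel_integral t)"
    and "ux 0 t = exp (- \<i> * of_real pi / 4) / of_real (sqrt (pi * t)) * (u 0 0 + A)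
        + 2 / of_real pi * (- 2 * (K * (u 0 0 / of_real (sqrt t) + abel_integral t)))"
proof -
  let ?c = "exp (- \<i> * of_real pi / 4)"
  have c: "?c / of_real (sqrt pi) = 4 * K / of_real pi"
    unfolding K_def by (rule neumann_constant[symmetric])
  have c': "?c / of_real (sqrt (pi * t)) = 4 * K / of_real pi / of_real (sqrt t)"
  proof -
    have "?c / of_real (sqrt (pi * t)) = ?c / of_real (sqrt pi) / of_real (sqrt t)"
      by (simp add: real_sqrt_mult)
    then show ?thesis unfolding c .
  qed
  have st: "of_real (sqrt t) \<noteq> 0" using t by simp
  have "ux 0 t = 2 / of_real pi * (of_real (pi / 2) * ux 0 t)" by simp
  also note neumann_value[OF t, folded A_def K_def]
  finally have N: "ux 0 t = 2 / of_real pi * (2 * K / of_real (sqrt t) * A +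
    2 * (u 0 0 * K / of_real (sqrt t) - K * (u 0 0 / of_real (sqrt t) + abel_integral t)))" .
  show "ux 0 t = ?c / of_real (sqrt pi)
        * ((u 0 0 - u 0 0) / of_real (sqrt t) + 1 / of_real (sqrt t) * A - abel_integral t)"
  proof -
    have "2 / P * (2 * K / s * A + 2 * (v * K / s - K * (v / s + B))) = 4 * K / P * ((v - v) / s + 1 / s * A - B)"
      for P K s A v B :: complex
      by (simp add: algebra_simps add_divide_distrib diff_divide_distrib)
    then show ?thesis unfolding c by (rule trans[OF N])
  qed
  show "ux 0 t = ?c / of_real (sqrt (pi * t)) * (u 0 0 + A)
        + 2 / of_real pi * (- 2 * (K * (u 0 0 / of_real (sqrt t) + abel_integral t)))"
  proof -
    have "2 / P * (2 * K / s * A + 2 * (v * K / s - K * (v / s + B))) =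
        4 * K / P / s * (v + A) + 2 / P * (- 2 * (K * (v / s + B)))" for P K s A v B :: complex
      by (simp add: algebra_simps add_divide_distrib diff_divide_distrib)
    then show ?thesis unfolding c' by (rule trans[OF N])
  qed
qed

end

theorem proposition2p2:
  fixes u :: "real \<Rightarrow> real \<Rightarrow> complex"
    and u0 g0 g1 :: "real \<Rightarrow> complex"
  assumes sol: "free_schroedinger_solution u"
    and u0: "u0 = (\<lambda>x. u x 0)"
    and g0: "g0 = (\<lambda>t. u 0 t)"
    and g1: "g1 = (\<lambda>t. partial_x u 0 t)"
  shows "(\<forall>x>0. \<forall>t>0. \<exists>I J.
      ((\<lambda>k::real. exp (- 2 * \<i> * complex_of_real k * complex_of_real x
            - dispersion (complex_of_real k) * complex_of_real t)
          * half_line_fourier u0 (complex_of_real k)) has_integral I) UNIV \<and>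
      ((\<lambda>k::complex. exp (- 2 * \<i> * k * complex_of_real x - dispersion k * complex_of_real t)
          * (deriv dispersion k * time_transform g0 (dispersion k) t
             + 2 * \<i> * half_line_fourier u0 (- k))) has_D3_integral J) \<and>
      u x t = 1 / complex_of_real pi * I + 1 / (2 * \<i> * complex_of_real pi) * J) \<and>
    (\<forall>t>0. \<exists>A B.
      ((\<lambda>x::real. exp (\<i> * complex_of_real (x\<^sup>2 / (4 * t))) * half_deriv u0 x)
          has_integral A) {0..} \<and>
      ((\<lambda>s::real. half_deriv g0 s / complex_of_real (sqrt (t - s))) has_integral B) {0..t} \<and>
      g1 t = exp (- \<i> * complex_of_real pi / 4) / complex_of_real (sqrt pi)
        * ((u0 0 - g0 0) / complex_of_real (sqrt t) + 1 / complex_of_real (sqrt t) * A - B)) \<and>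
    (\<forall>t>0. \<exists>A J.
      ((\<lambda>x::real. exp (\<i> * complex_of_real (x\<^sup>2 / (4 * t))) * half_deriv u0 x)
          has_integral A) {0..} \<and>
      ((\<lambda>k::complex. g0 t - dispersion k * integral {0..t}
            (\<lambda>s. exp (dispersion k * complex_of_real (s - t)) * g0 s)) has_D3_integral J) \<and>
      g1 t = exp (- \<i> * complex_of_real pi / 4) / complex_of_real (sqrt (pi * t)) * (u0 0 + A)
        + 2 / complex_of_real pi * J)"
proof -
  interpret quarter_plane_solution u using sol by unfold_locales
  have u0': "half_deriv u0 = (\<lambda>x. ux x 0)" and g0': "half_deriv g0 = ut 0"
    by (auto simp: u0 g0 partial_x_def partial_t_def fun_eq_iff)
  have hat0: "half_line_fourier u0 = hat 0" by (simp add: u0 hat_def)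
  show ?thesis
  proof (intro conjI allI impI, goal_cases)
    case (1 x t)
    then show ?case unfolding hat0 g0 by (rule representation)
  next
    case (2 t)
    have s: "(1::real) = 1 \<or> (1::real) = - 1" by simp
    have abel: "((\<lambda>s. ut 0 s / complex_of_real (sqrt (t - s))) has_integral abel_integral t) {0..t}"
      unfolding abel_integral_def by (rule integrable_integral, rule qfun_ray(1)[OF s _ 2, of 1]) simp
    show ?case
      unfolding u0' g0' unfolding u0 g0 g1
      by (intro exI conjI, rule integrable_integral[OF initial_fresnel_integrable[OF 2]], rule abel,
          rule neumann_formulas(1)[OF 2])
  next
    case (3 t)
    show ?case
      unfolding u0' unfolding u0 g0 g1
      by (intro exI conjI, rule integrable_integral[OF initial_fresnel_integrable[OF 3]],
          rule qfun_D3[OF 3, unfolded qfun_def[abs_def]], rule neumann_formulas(2)[OF 3])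
  qed
qed

end
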